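(* Let $\mathcal{X}$ be a finite set, $\mathcal{H}$ a finite-dimensional Hilbert space, and $W:\mathcal{X}\to\mathcal{S}(\mathcal{H})$, $x\mapsto W_x$, a classical-quantum channel. Then for every $\epsilon\in(0,1)$, \[ R(W)=R_\epsilon(W)=C(W):=\sup_{p\in\mathcal{P}(\mathcal{X})} I(X;B)_{W\times p}. \]
   Context: $\mathcal{S}(\mathcal{H})$ is the set of density matrices on $\mathcal{H}$ and $\mathcal{P}(\mathcal{X})$ the set of probability distributions on $\mathcal{X}$. For $p\in\mathcal{P}(\mathcal{X})$, $W(p):=\sum_x p(x)W_x$ and $I(X;B)_{W\times p}:=\sum_x p(x)D(W_x\|W(p))$, where $D(\rho\|\sigma)=\mathrm{Tr}\,\rho(\log\rho-\log\sigma)$; all logarithms are base 2. For $n\ge1$ and $x^n=(x_1,\dots,x_n)\in\mathcal{X}^n$ let $W^{\otimes n}_{x^n}:=W_{x_1}\otimes\cdots\otimes W_{x_n}$ and, for a distribution $p^n$ on $\mathcal{X}^n$, $W^{\otimes n}(p^n):=\sum_{x^n}p^n(x^n)W^{\otimes n}_{x^n}$. For a positive integer $M$, $\mathcal{P}_M(\mathcal{X}^n)$ is the set of distributions $q$ on $\mathcal{X}^n$ with $Mq(x^n)\in\mathbb{Z}$ for all $x^n$. Define the worst-case resolution error \[ \varepsilon(W^{\otimes n},M):=\sup_{p^n\in\mathcal{P}(\mathcal{X}^n)}\inf_{q^n\in\mathcal{P}_M(\mathcal{X}^n)}\tfrac12\|W^{\otimes n}(p^n)-W^{\otimes n}(q^n)\|_1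 . \] The worst-input resolvability rate is $R(W):=\inf\{R>0:\ \forall\gamma>0,\ \liminf_{n\to\infty}\varepsilon(W^{\otimes n},\lfloor 2^{n(R+\gamma)}\rfloor)=0\}$. For $\epsilon\in(0,1)$, $M_\epsilon(W^{\otimes n}):=\min\{M\in\mathbb{N}_+:\varepsilon(W^{\otimes n},M)\le\epsilon\}$ and $R_\epsilon(W):=\liminf_{n\to\infty}\frac1n\log M_\epsilon(W^{\otimes n})$. *)

theory Defs
  imports "Jordan_Normal_Form.Matrix" "HOL-Library.Extended_Real" "HOL-Library.Liminf_Limsup"
begin

definition adj_mat :: "complex mat \<Rightarrow> complex mat" where
  "adj_mat A = mat (dim_col A) (dim_row A) (\<lambda>(i,j). cnj (A $$ (j,i)))"

definition mtrace :: "complex mat \<Rightarrow> complex" where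
  "mtrace A = (\<Sum>i<dim_row A. A $$ (i,i))"

definition hermitian_mat :: "nat \<Rightarrow> complex mat \<Rightarrow> bool" where
  "hermitian_mat d A \<longleftrightarrow> A \<in> carrier_mat d d \<and> adj_mat A = A"

definition unitary_mat :: "nat \<Rightarrow> complex mat \<Rightarrow> bool" where
  "unitary_mat d U \<longleftrightarrow> U \<in> carrier_mat d d \<and> U * adj_mat U = 1\<^sub>m d \<and> adj_mat U * U = 1\<^sub>m d"

definition rdiag_mat :: "nat \<Rightarrow> (nat \<Rightarrow> real) \<Rightarrow> complex mat" where
  "rdiag_mat d lam = mat d d (\<lambda>(i,j). if i = j then complex_of_real (lam i) else 0)"

text \<open>Functional calculus for Hermitian matrices via a spectral decomposition
  A = U diag(lam) U^*; the result does not depend on the chosen decomposition.\<close>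
definition herm_fun :: "(real \<Rightarrow> real) \<Rightarrow> complex mat \<Rightarrow> complex mat" where
  "herm_fun f A = (SOME B. \<exists>U lam. unitary_mat (dim_row A) U \<and>
       A = U * rdiag_mat (dim_row A) lam * adj_mat U \<and>
       B = U * rdiag_mat (dim_row A) (\<lambda>i. f (lam i)) * adj_mat U)"

definition psd_mat :: "nat \<Rightarrow> complex mat \<Rightarrow> bool" where
  "psd_mat d A \<longleftrightarrow> hermitian_mat d A \<and>
     (\<forall>v \<in> carrier_vec d. 0 \<le> Re (scalar_prod (map_vec cnj v) (A *\<^sub>v v)))"

definition density_mat :: "nat \<Rightarrow> complex mat \<Rightarrow> bool" where
  "density_mat d A \<longleftrightarrow> psd_mat d A \<and> mtrace A = 1"

text \<open>Base-2 logarithm on the support, 0 on the kernel (so that 0 log 0 = 0 and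
  log sigma is the usual support-restricted logarithm).\<close>
definition log2_supp :: "real \<Rightarrow> real" where
  "log2_supp t = (if t > 0 then log 2 t else 0)"

definition mlog2 :: "complex mat \<Rightarrow> complex mat" where
  "mlog2 A = herm_fun log2_supp A"

definition rel_entropy :: "complex mat \<Rightarrow> complex mat \<Rightarrow> real" where
  "rel_entropy \<rho> \<sigma> = Re (mtrace (\<rho> * (mlog2 \<rho> - mlog2 \<sigma>)))"

definition trace_norm :: "complex mat \<Rightarrow> real" where
  "trace_norm A = Re (mtrace (herm_fun sqrt (adj_mat A * A)))"

definition kron_mat :: "complex mat \<Rightarrow> complex mat \<Rightarrow> complex mat" where
  "kron_mat A B = mat (dim_row A * dim_row B) (dim_col A * dim_col B)
     (\<lambda>(i,j). A $$ (i div dim_row B, j div dim_col B) * B $$ (i mod dim_row B, j mod dim_col B))"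

definition cq_channel :: "nat \<Rightarrow> ('x::finite \<Rightarrow> complex mat) \<Rightarrow> bool" where
  "cq_channel d W \<longleftrightarrow> (\<forall>x. density_mat d (W x))"

definition distr_on :: "'a set \<Rightarrow> ('a \<Rightarrow> real) \<Rightarrow> bool" where
  "distr_on S p \<longleftrightarrow> (\<forall>x\<in>S. 0 \<le> p x) \<and> (\<Sum>x\<in>S. p x) = 1"

definition mixture :: "nat \<Rightarrow> 'a set \<Rightarrow> ('a \<Rightarrow> complex mat) \<Rightarrow> ('a \<Rightarrow> real) \<Rightarrow> complex mat" where
  "mixture d S W p = mat d d (\<lambda>(i,j). \<Sum>x\<in>S. complex_of_real (p x) * (W x $$ (i,j)))"

definition holevo_info :: "nat \<Rightarrow> ('x::finite \<Rightarrow> complex mat) \<Rightarrow> ('x \<Rightarrow> real) \<Rightarrow> real" where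
  "holevo_info d W p = (\<Sum>x\<in>UNIV. p x * rel_entropy (W x) (mixture d UNIV W p))"

definition cq_capacity :: "nat \<Rightarrow> ('x::finite \<Rightarrow> complex mat) \<Rightarrow> real" where
  "cq_capacity d W = (SUP p \<in> {p. distr_on UNIV p}. holevo_info d W p)"

definition seqs :: "nat \<Rightarrow> 'x list set" where
  "seqs n = {xs. length xs = n}"

definition tensor_channel :: "('x \<Rightarrow> complex mat) \<Rightarrow> 'x list \<Rightarrow> complex mat" where
  "tensor_channel W xs = foldr (\<lambda>x A. kron_mat (W x) A) xs (1\<^sub>m 1)"

definition type_distr :: "nat \<Rightarrow> nat \<Rightarrow> ('x list \<Rightarrow> real) \<Rightarrow> bool" where
  "type_distr n M q \<longleftrightarrow> distr_on (seqs n) q \<and> (\<forall>xs\<in>seqs n. real M * q xs \<in> \<int>)"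

definition resol_err :: "nat \<Rightarrow> ('x::finite \<Rightarrow> complex mat) \<Rightarrow> nat \<Rightarrow> nat \<Rightarrow> real" where
  "resol_err d W n M =
     (SUP p \<in> {p. distr_on (seqs n) p}.
        INF q \<in> {q. type_distr n M q}.
          trace_norm (mixture (d ^ n) (seqs n) (tensor_channel W) p
                      - mixture (d ^ n) (seqs n) (tensor_channel W) q) / 2)"

text \<open>Worst-input resolvability rate R(W) (as an extended real; Inf {} = infinity).\<close>
definition resol_rate :: "nat \<Rightarrow> ('x::finite \<Rightarrow> complex mat) \<Rightarrow> ereal" where
  "resol_rate d W = Inf (ereal ` {R. R > 0 \<and> (\<forall>\<gamma>>0.
       liminf (\<lambda>n. ereal (resol_err d W n (nat \<lfloor>2 powr (real n * (R + \<gamma>))\<rfloor>))) = 0)})"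

definition min_size :: "nat \<Rightarrow> ('x::finite \<Rightarrow> complex mat) \<Rightarrow> real \<Rightarrow> nat \<Rightarrow> nat" where
  "min_size d W \<epsilon> n = (LEAST M. M \<ge> 1 \<and> resol_err d W n M \<le> \<epsilon>)"

definition resol_rate_eps :: "nat \<Rightarrow> ('x::finite \<Rightarrow> complex mat) \<Rightarrow> real \<Rightarrow> ereal" where
  "resol_rate_eps d W \<epsilon> = liminf (\<lambda>n. ereal (log 2 (real (min_size d W \<epsilon> n)) / real n))"

end

theory Submission
  imports Defs "HOL-Analysis.Inner_Product" "HOL-Real_Asymp.Real_Asymp"
    "Jordan_Normal_Form.Spectral_Radius"
begin

text \<open>
  Operators live in the *-algebra of finitely supported infinite matrices, a real inner product space
  for the Hilbert--Schmidt product, so that all dimensions \<open>d ^ n\<close> share one type.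

  Achievability. Split an input distribution on \<open>X^n\<close> by the type \<open>P\<close> of the sequences. Truncating
  \<open>W_{x^n}\<close> to its typical eigenvalues and to those of the reference state
  \<open>\<omega> = W(P)^{(x) n}\<close> changes it little, and the truncation \<open>A\<close> satisfies
  \<open>tr (A \<omega>^{-1} A) \<le> 2^{n (I(P) + o(1))}\<close> with \<open>I(P) \<le> C(W)\<close>. By the Cauchy--Schwarz inequality
  and a second moment bound, \<open>M\<close> independent samples therefore approximate each of the polynomially
  many parts as soon as \<open>M\<close> exceeds \<open>2^{n C(W)}\<close> exponentially.

  Converse. Let \<open>\<rho>\<close> be the average of the outputs of \<open>N = 2^{n (I(p) - o(1))}\<close> independent codewords
  drawn from \<open>p^n\<close>, and let \<open>\<tau>\<close> be a fixed state. The Neyman--Pearson test between \<open>\<tau>\<close> and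
  \<open>\<gamma> W(p)^{(x) n}\<close> accepts \<open>\<rho>\<close> only with small probability, except for an event of probability
  \<open>exp (- c N)\<close>; on its complement \<open>\<tau>\<close> is dominated by \<open>\<gamma> W(p)^{(x) n}\<close> and hence has almost no weight
  on the low-rank subspace carrying \<open>\<rho>\<close>. So \<open>\<rho>\<close> and \<open>\<tau>\<close> are almost orthogonal up to probability
  \<open>exp (- c N)\<close>, and a union bound over the at most \<open>|X|^{n M}\<close> outputs of \<open>M\<close>-types forces
  \<open>n M log |X| \<ge> c N\<close>.
\<close>

hide_const (open) Determinant.adj_mat
hide_fact (open) Determinant.adj_mat_def

section \<open>The algebra of finitely supported matrices\<close>

text \<open>The input is arbitrary, so no single i.i.d. reference state fits all sequences. A
  reference that depends only on the type makes \<open>I(P)\<close> the exponent, and a polynomial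
  number of parts is the price. In the converse the approximating \<open>M\<close>-type is arbitrary
  too: the union bound runs over a doubly exponential family and needs a doubly exponentially small
  failure probability. A scalar Chernoff bound provides it, because each test is built from \<tau>
  and the product state alone, before the codewords are drawn, so that only the numbers tr (T W_y)
  are random. The trace norm enters through its dual form, the maximum of tr (V A) over contractions
  V; the estimates thereby become Cauchy-Schwarz inequalities for the Hilbert-Schmidt product.
  Typicality is expressed by power sums tr \<rho>^(1+t) expanded to second order in t, which gives
  exponential tails uniformly over all states of dimension d. The equalities follow from a cycle:
  the \<epsilon>-rate is at most the rate, the rate at most the capacity, the capacity at most the
  \<epsilon>-rate.\<close>

typedef fmat = "{f :: nat \<Rightarrow> nat \<Rightarrow> complex. \<exists>N. \<forall>i j. N \<le> i \<or> N \<le> j \<longrightarrow> f i j = 0}"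
  morphisms ent mk_fmat
  by (rule exI[of _ "\<lambda>_ _. 0"]) simp

setup_lifting type_definition_fmat

definition car :: "nat \<Rightarrow> fmat \<Rightarrow> bool" where
  "car N A \<longleftrightarrow> (\<forall>i j. N \<le> i \<or> N \<le> j \<longrightarrow> ent A i j = 0)"

lemma car_mono: "car N A \<Longrightarrow> N \<le> N' \<Longrightarrow> car N' A"
  unfolding car_def by (meson order_trans)

lemma car_ex: "\<exists>N. car N A"
  using ent[of A] by (auto simp: car_def)

lemma car_ex2: "\<exists>N. car N A \<and> car N B"
  by (meson car_ex car_mono nle_le)

lemma car_ex3: "\<exists>N. car N A \<and> car N B \<and> car N C"
  by (meson car_ex car_ex2 car_mono nle_le)

lemma fmat_eqI: "(\<And>i j. ent A i j = ent B i j) \<Longrightarrow> A = B"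
  by (metis ent_inject ext)

instantiation fmat :: real_vector
begin
lift_definition zero_fmat :: fmat is "\<lambda>_ _. 0" by simp
lift_definition plus_fmat :: "fmat \<Rightarrow> fmat \<Rightarrow> fmat" is "\<lambda>f g i j. f i j + g i j"
proof -
  fix f g :: "nat \<Rightarrow> nat \<Rightarrow> complex"
  assume "\<exists>N. \<forall>i j. N \<le> i \<or> N \<le> j \<longrightarrow> f i j = 0" "\<exists>N. \<forall>i j. N \<le> i \<or> N \<le> j \<longrightarrow> g i j = 0"
  then obtain N M where "\<forall>i j. N \<le> i \<or> N \<le> j \<longrightarrow> f i j = 0" "\<forall>i j. M \<le> i \<or> M \<le> j \<longrightarrow> g i j = 0"
    by blast
  then show "\<exists>N. \<forall>i j. N \<le> i \<or> N \<le> j \<longrightarrow> f i j + g i j = 0"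
    by (intro exI[of _ "max N M"]) auto
qed
lift_definition uminus_fmat :: "fmat \<Rightarrow> fmat" is "\<lambda>f i j. - f i j" by auto
definition minus_fmat :: "fmat \<Rightarrow> fmat \<Rightarrow> fmat" where "minus_fmat A B = A + - B"
lift_definition scaleR_fmat :: "real \<Rightarrow> fmat \<Rightarrow> fmat" is "\<lambda>r f i j. complex_of_real r * f i j"
  by fastforce
instance
proof
  fix A B C :: fmat and r s :: real
  show "A + B + C = A + (B + C)" by (rule fmat_eqI) (simp add: plus_fmat.rep_eq)
  show "A + B = B + A" by (rule fmat_eqI) (simp add: plus_fmat.rep_eq)
  show "0 + A = A" by (rule fmat_eqI) (simp add: plus_fmat.rep_eq zero_fmat.rep_eq)
  show "- A + A = 0"
    by (rule fmat_eqI) (simp add: plus_fmat.rep_eq zero_fmat.rep_eq uminus_fmat.rep_eq)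
  show "A - B = A + - B" by (rule minus_fmat_def)
  show "r *\<^sub>R (A + B) = r *\<^sub>R A + r *\<^sub>R B"
    by (rule fmat_eqI) (simp add: plus_fmat.rep_eq scaleR_fmat.rep_eq distrib_left)
  show "(r + s) *\<^sub>R A = r *\<^sub>R A + s *\<^sub>R A"
    by (rule fmat_eqI) (simp add: plus_fmat.rep_eq scaleR_fmat.rep_eq distrib_right)
  show "r *\<^sub>R s *\<^sub>R A = (r * s) *\<^sub>R A"
    by (rule fmat_eqI) (simp add: scaleR_fmat.rep_eq)
  show "1 *\<^sub>R A = A"
    by (rule fmat_eqI) (simp add: scaleR_fmat.rep_eq)
qed
end

lemma ent_simps [simp]:
  "ent 0 i j = 0" "ent (A + B) i j = ent A i j + ent B i j" "ent (- A) i j = - ent A i j"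
  "ent (A - B) i j = ent A i j - ent B i j" "ent (r *\<^sub>R A) i j = complex_of_real r * ent A i j"
  by (simp_all only: plus_fmat.rep_eq zero_fmat.rep_eq uminus_fmat.rep_eq minus_fmat_def
      scaleR_fmat.rep_eq) simp

lemma ent_sum [simp]: "ent (\<Sum>x\<in>S. F x) i j = (\<Sum>x\<in>S. ent (F x) i j)"
  by (induct S rule: infinite_finite_induct) auto

instantiation fmat :: times
begin
text \<open>The sum runs over indices with two nonzero factors, a finite set by the support
  condition, so that the product needs no dimension; \<open>ent_times\<close> recovers the usual sum
  below any bound on one factor.\<close>

lift_definition times_fmat :: "fmat \<Rightarrow> fmat \<Rightarrow> fmat" is
  "\<lambda>f g i j. \<Sum>k | f i k \<noteq> 0 \<and> g k j \<noteq> 0. f i k * g k j"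
proof -
  fix f g :: "nat \<Rightarrow> nat \<Rightarrow> complex"
  assume "\<exists>N. \<forall>i j. N \<le> i \<or> N \<le> j \<longrightarrow> f i j = 0" "\<exists>N. \<forall>i j. N \<le> i \<or> N \<le> j \<longrightarrow> g i j = 0"
  then obtain N M where "\<forall>i j. N \<le> i \<or> N \<le> j \<longrightarrow> f i j = 0" "\<forall>i j. M \<le> i \<or> M \<le> j \<longrightarrow> g i j = 0"
    by blast
  then show "\<exists>N. \<forall>i j. N \<le> i \<or> N \<le> j \<longrightarrow> (\<Sum>k | f i k \<noteq> 0 \<and> g k j \<noteq> 0. f i k * g k j) = 0"
    by (intro exI[of _ "max N M"]) (auto intro!: sum.neutral)
qed
instance ..
end

lemma ent_times:
  assumes "car N A \<or> car N B"
  shows "ent (A * B) i j = (\<Sum>k<N. ent A i k * ent B k j)"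
  unfolding times_fmat.rep_eq
  by (rule sum.mono_neutral_left)
    (use assms in \<open>auto simp: car_def not_less[symmetric]\<close>)

lemma car_times: "car N A \<Longrightarrow> car N B \<Longrightarrow> car N (A * B)"
  by (auto simp: car_def ent_times[of N])

instance fmat :: ring
proof
  fix A B C :: fmat
  obtain N where N: "car N A" "car N B" "car N C" using car_ex3 by blast
  have AB: "car N (A * B)" and BC: "car N (B * C)" by (simp_all add: car_times N)
  show "A * B * C = A * (B * C)"
  proof (rule fmat_eqI)
    fix i j
    have "ent (A * B * C) i j = (\<Sum>k<N. \<Sum>l<N. ent A i l * ent B l k * ent C k j)"
      by (simp add: ent_times[of N] N AB sum_distrib_right)
    also have "\<dots> = (\<Sum>l<N. \<Sum>k<N. ent A i l * ent B l k * ent C k j)"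
      by (rule sum.swap)
    also have "\<dots> = ent (A * (B * C)) i j"
      by (simp add: ent_times[of N] N BC sum_distrib_left mult.assoc)
    finally show "ent (A * B * C) i j = ent (A * (B * C)) i j" .
  qed
  show "(A + B) * C = A * C + B * C" "A * (B + C) = A * B + A * C"
    by (auto intro!: fmat_eqI simp: ent_times[of N] N distrib_left distrib_right sum.distrib)
qed

instance fmat :: real_algebra
proof
  fix A B :: fmat and r :: real
  obtain N where N: "car N A" "car N B" using car_ex2 by blast
  show "r *\<^sub>R A * B = r *\<^sub>R (A * B)" "A * r *\<^sub>R B = r *\<^sub>R (A * B)"
    by (auto intro!: fmat_eqI simp: ent_times[of N] N sum_distrib_left algebra_simps)
qed

lift_definition adj :: "fmat \<Rightarrow> fmat" is "\<lambda>f i j. cnj (f j i)" by auto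

lemma ent_adj [simp]: "ent (adj A) i j = cnj (ent A j i)"
  by (simp add: adj.rep_eq)

lemma adj_adj [simp]: "adj (adj A) = A"
  by (rule fmat_eqI) simp

lemma adj_add [simp]: "adj (A + B) = adj A + adj B" by (rule fmat_eqI) simp
lemma adj_diff [simp]: "adj (A - B) = adj A - adj B" by (rule fmat_eqI) simp
lemma adj_zero [simp]: "adj 0 = 0" by (rule fmat_eqI) simp
lemma adj_scaleR [simp]: "adj (r *\<^sub>R A) = r *\<^sub>R adj A" by (rule fmat_eqI) simp
lemma adj_sum [simp]: "adj (\<Sum>x\<in>S. F x) = (\<Sum>x\<in>S. adj (F x))"
  by (induct S rule: infinite_finite_induct) auto

lemma car_adj: "car N A \<Longrightarrow> car N (adj A)"
  by (simp add: car_def)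

lemma adj_mult [simp]: "adj (A * B) = adj B * adj A"
proof -
  obtain N where N: "car N A" "car N B" using car_ex2 by blast
  then show ?thesis
    by (auto intro!: fmat_eqI simp: ent_times[of N] car_adj mult.commute)
qed

text \<open>The real part keeps everything in a real inner product space: it is still cyclic and
  invariant under \<open>adj\<close>, and for a product of two self-adjoint matrices it is the trace
  itself.\<close>

definition rtr :: "fmat \<Rightarrow> real" where
  "rtr A = (\<Sum>i | ent A i i \<noteq> 0. Re (ent A i i))"

lemma rtr_car: "car N A \<Longrightarrow> rtr A = (\<Sum>i<N. Re (ent A i i))"
  unfolding rtr_def
  by (rule sum.mono_neutral_left) (auto simp: car_def not_less[symmetric])

lemma car_add: "car N A \<Longrightarrow> car N B \<Longrightarrow> car N (A + B)" by (simp add: car_def)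
lemma car_diff: "car N A \<Longrightarrow> car N B \<Longrightarrow> car N (A - B)" by (simp add: car_def)
lemma car_scaleR: "car N A \<Longrightarrow> car N (r *\<^sub>R A)" by (simp add: car_def)
lemma car_zero: "car N 0" by (simp add: car_def)
lemma car_sum: "(\<And>x. x \<in> S \<Longrightarrow> car N (F x)) \<Longrightarrow> car N (\<Sum>x\<in>S. F x)"
  by (simp add: car_def)

lemma rtr_add: "rtr (A + B) = rtr A + rtr B"
proof -
  obtain N where N: "car N A" "car N B" using car_ex2 by blast
  then show ?thesis by (simp add: rtr_car[of N] car_add sum.distrib)
qed

lemma rtr_scaleR: "rtr (r *\<^sub>R A) = r * rtr A"
proof -
  obtain N where N: "car N A" using car_ex by blast
  then show ?thesis by (simp add: rtr_car[of N] car_scaleR sum_distrib_left)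
qed

lemma rtr_zero [simp]: "rtr 0 = 0" by (simp add: rtr_def)

lemma rtr_diff: "rtr (A - B) = rtr A - rtr B"
  using rtr_add[of "A - B" B] by simp

lemma rtr_sum: "rtr (\<Sum>x\<in>S. F x) = (\<Sum>x\<in>S. rtr (F x))"
  by (induct S rule: infinite_finite_induct) (auto simp: rtr_add)

lemma rtr_adj [simp]: "rtr (adj A) = rtr A"
  by (simp add: rtr_def)

lemma rtr_comm: "rtr (A * B) = rtr (B * A)"
proof -
  obtain N where N: "car N A" "car N B" using car_ex2 by blast
  have "rtr (A * B) = (\<Sum>i<N. \<Sum>k<N. Re (ent A i k * ent B k i))"
    by (simp add: rtr_car[of N] car_times N ent_times[of N])
  also have "\<dots> = (\<Sum>k<N. \<Sum>i<N. Re (ent A i k * ent B k i))" by (rule sum.swap)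
  also have "\<dots> = rtr (B * A)"
    by (simp add: rtr_car[of N] car_times N ent_times[of N] mult.commute)
  finally show ?thesis .
qed

lemma rtr_adj_mult: 
  assumes "car N A"
  shows "rtr (adj A * A) = (\<Sum>i<N. \<Sum>k<N. (cmod (ent A i k))\<^sup>2)"
proof -
  have *: "Re (cnj z * z) = (cmod z)\<^sup>2" for z
    unfolding cmod_power2 by (simp add: power2_eq_square)
  have "rtr (adj A * A) = (\<Sum>k<N. \<Sum>i<N. (cmod (ent A i k))\<^sup>2)"
    using assms by (simp add: rtr_car[of N] car_times car_adj ent_times[of N] * del: times_complex.sel)
  also have "\<dots> = (\<Sum>i<N. \<Sum>k<N. (cmod (ent A i k))\<^sup>2)" by (rule sum.swap)
  finally show ?thesis .
qed

instantiation fmat :: real_inner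
begin
definition inner_fmat :: "fmat \<Rightarrow> fmat \<Rightarrow> real" where "inner_fmat A B = rtr (adj A * B)"
definition norm_fmat :: "fmat \<Rightarrow> real" where "norm_fmat A = sqrt (inner A A)"
definition dist_fmat :: "fmat \<Rightarrow> fmat \<Rightarrow> real" where "dist_fmat A B = norm (A - B)"
definition sgn_fmat :: "fmat \<Rightarrow> fmat" where "sgn_fmat A = inverse (norm A) *\<^sub>R A"
definition uniformity_fmat :: "(fmat \<times> fmat) filter" where
  "uniformity_fmat = (INF e\<in>{0<..}. principal {(x, y). dist x y < e})"
definition open_fmat :: "fmat set \<Rightarrow> bool" where
  "open_fmat U \<longleftrightarrow> (\<forall>x\<in>U. eventually (\<lambda>(x', y). x' = x \<longrightarrow> y \<in> U) uniformity)"
instance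
proof
  fix A B C :: fmat and r :: real
  show "inner A B = inner B A"
    unfolding inner_fmat_def by (metis adj_adj adj_mult rtr_adj)
  show "inner (A + B) C = inner A C + inner B C"
    by (simp add: inner_fmat_def distrib_right rtr_add)
  show "inner (r *\<^sub>R A) B = r * inner A B"
    by (simp add: inner_fmat_def rtr_scaleR)
  obtain N where N: "car N A" using car_ex by blast
  show "0 \<le> inner A A"
    by (simp add: inner_fmat_def rtr_adj_mult[OF N] sum_nonneg)
  show "inner A A = 0 \<longleftrightarrow> A = 0"
  proof
    assume "inner A A = 0"
    then have "\<forall>i<N. \<forall>k<N. ent A i k = 0"
      by (simp add: inner_fmat_def rtr_adj_mult[OF N] sum_nonneg sum_nonneg_eq_0_iff)
    then show "A = 0"
      using N by (intro fmat_eqI) (metis car_def ent_simps(1) not_le)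
  qed (simp add: inner_fmat_def)
qed (simp_all add: norm_fmat_def dist_fmat_def sgn_fmat_def uniformity_fmat_def open_fmat_def)
end

lemma norm_sq: "(norm (A::fmat))\<^sup>2 = rtr (adj A * A)"
  by (simp add: norm_fmat_def inner_fmat_def flip: inner_fmat_def)

lemma norm_adj: "norm (adj A) = norm A"
proof -
  have "(norm (adj A))\<^sup>2 = (norm A)\<^sup>2" by (simp add: norm_sq rtr_comm)
  then show ?thesis by simp
qed

lemma rtr_mult_le: "rtr (A * B) \<le> norm A * norm B"
  using norm_cauchy_schwarz[of "adj A" B] by (simp add: inner_fmat_def norm_adj)

subsection \<open>Contractions\<close>

text \<open>Operator norm at most 1, read off the action on Hilbert-Schmidt norms by left
  multiplication; the columns of \<open>X\<close> play the role of vectors.\<close>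

definition contr :: "fmat \<Rightarrow> bool" where
  "contr V \<longleftrightarrow> (\<forall>X. norm (V * X) \<le> norm X)"

lemma contrD: "contr V \<Longrightarrow> norm (V * X) \<le> norm X"
  by (simp add: contr_def)

text \<open>With \<open>Y = adj V * X\<close>, Cauchy-Schwarz bounds the square of
  \<open>norm Y\<close> by \<open>norm X * norm (V * Y)\<close>, hence by
  \<open>norm X * norm Y\<close>; one factor cancels.\<close>

lemma contr_adj: assumes "contr V" shows "contr (adj V)"
  unfolding contr_def
proof
  fix X
  let ?Y = "adj V * X"
  have "(norm ?Y)\<^sup>2 = rtr (adj X * (V * ?Y))" by (simp add: norm_sq mult.assoc)
  also have "\<dots> \<le> norm (adj X) * norm (V * ?Y)" by (rule rtr_mult_le)
  also have "\<dots> \<le> norm X * norm ?Y"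
    by (simp add: norm_adj contrD[OF assms] mult_left_mono)
  finally show "norm ?Y \<le> norm X"
    by (metis mult_le_cancel_right power2_eq_square norm_ge_zero order.trans not_less)
qed

lemma contr_mult_right: assumes "contr V" shows "norm (X * V) \<le> norm X"
  using contrD[OF contr_adj[OF assms], of "adj X"] by (metis adj_mult norm_adj)

subsection \<open>Diagonal matrices and functional calculus\<close>

lift_definition dg :: "nat \<Rightarrow> (nat \<Rightarrow> real) \<Rightarrow> fmat" is
  "\<lambda>D f i j. if i = j \<and> i < D then complex_of_real (f i) else 0"
  by (metis linorder_not_less)

lemma ent_dg: "ent (dg D f) i j = (if i = j \<and> i < D then complex_of_real (f i) else 0)"
  by (simp add: dg.rep_eq)

lemma car_dg: "car D (dg D f)" by (auto simp: car_def ent_dg)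

lemma ent_dg_mult: "ent (dg D f * A) i j = (if i < D then complex_of_real (f i) * ent A i j else 0)"
proof -
  have "ent (dg D f * A) i j = (\<Sum>k<D. if k = i then complex_of_real (f i) * ent A i j else 0)"
    unfolding ent_times[OF disjI1[OF car_dg]] by (rule sum.cong) (auto simp: ent_dg)
  then show ?thesis by simp
qed

lemma dg_mult: "dg D f * dg D g = dg D (\<lambda>i. f i * g i)"
  by (rule fmat_eqI) (simp add: ent_dg_mult, simp add: ent_dg)

lemma adj_dg [simp]: "adj (dg D f) = dg D f"
  by (rule fmat_eqI) (simp add: ent_dg)

lemma dg_add: "dg D f + dg D g = dg D (\<lambda>i. f i + g i)"
  by (rule fmat_eqI) (simp add: ent_dg)

lemma dg_diff: "dg D f - dg D g = dg D (\<lambda>i. f i - g i)"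
  by (rule fmat_eqI) (simp add: ent_dg)

lemma dg_scaleR: "r *\<^sub>R dg D f = dg D (\<lambda>i. r * f i)"
  by (rule fmat_eqI) (simp add: ent_dg)

lemma dg_cong: "(\<And>i. i < D \<Longrightarrow> f i = g i) \<Longrightarrow> dg D f = dg D g"
  by (rule fmat_eqI) (simp add: ent_dg)

lemma rtr_dg: "rtr (dg D f) = (\<Sum>i<D. f i)"
  by (simp add: rtr_car[OF car_dg] ent_dg)

text \<open>The algebra has no unit, since an infinite identity is not finitely supported;
  \<open>one D\<close> acts as a unit on \<open>car D\<close> only.\<close>

abbreviation one :: "nat \<Rightarrow> fmat" where "one D \<equiv> dg D (\<lambda>_. 1)"

lemma one_left: "car D A \<Longrightarrow> one D * A = A"
  by (rule fmat_eqI) (auto simp: ent_dg_mult car_def)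

lemma one_right: "car D A \<Longrightarrow> A * one D = A"
  using one_left[OF car_adj] by (metis adj_adj adj_dg adj_mult)

lemma norm_dg_mult_le:
  assumes "0 \<le> c" "\<And>i. i < D \<Longrightarrow> \<bar>f i\<bar> \<le> c * \<bar>g i\<bar>"
  shows "norm (dg D f * X) \<le> c * norm (dg D g * X)"
proof -
  obtain N where N: "car N X" "D \<le> N" using car_ex by (meson car_mono nle_le)
  have c: "car N (dg D h * X)" for h by (meson N car_dg car_mono car_times)
  have e: "(cmod (ent (dg D f * X) i k))\<^sup>2 \<le> (c * cmod (ent (dg D g * X) i k))\<^sup>2" for i k
  proof (rule power_mono)
    show "cmod (ent (dg D f * X) i k) \<le> c * cmod (ent (dg D g * X) i k)"
      using mult_right_mono[OF assms(2), of i "cmod (ent X i k)"]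
      by (auto simp: ent_dg_mult norm_mult mult.assoc)
  qed simp
  have "(norm (dg D f * X))\<^sup>2 = (\<Sum>i<N. \<Sum>k<N. (cmod (ent (dg D f * X) i k))\<^sup>2)"
    unfolding norm_sq by (rule rtr_adj_mult[OF c])
  also have "\<dots> \<le> (\<Sum>i<N. \<Sum>k<N. (c * cmod (ent (dg D g * X) i k))\<^sup>2)"
    by (intro sum_mono e)
  also have "\<dots> = c\<^sup>2 * (\<Sum>i<N. \<Sum>k<N. (cmod (ent (dg D g * X) i k))\<^sup>2)"
    by (simp add: power_mult_distrib sum_distrib_left)
  also have "\<dots> = (c * norm (dg D g * X))\<^sup>2"
    unfolding power_mult_distrib norm_sq by (simp only: rtr_adj_mult[OF c])
  finally show ?thesis by (rule power2_le_imp_le) (simp add: assms(1))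
qed

definition uni :: "nat \<Rightarrow> fmat \<Rightarrow> bool" where
  "uni D u \<longleftrightarrow> car D u \<and> u * adj u = one D \<and> adj u * u = one D"

text \<open>The function is indexed by eigenvectors and not by eigenvalues, so any selection of
  eigenvectors is a legitimate argument, and products, sums and cut-offs in one basis are
  pointwise.\<close>

definition fc :: "nat \<Rightarrow> fmat \<Rightarrow> (nat \<Rightarrow> real) \<Rightarrow> fmat" where
  "fc D u f = u * dg D f * adj u"

lemma car_fc: "uni D u \<Longrightarrow> car D (fc D u f)"
  unfolding fc_def uni_def by (intro car_times car_dg car_adj) auto

lemma fc_mult:
  assumes "uni D u" shows "fc D u f * fc D u g = fc D u (\<lambda>i. f i * g i)"
proof -
  have "fc D u f * fc D u g = u * dg D f * (adj u * u) * dg D g * adj u"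
    by (simp add: fc_def mult.assoc)
  also have "\<dots> = u * (dg D f * dg D g) * adj u"
    using assms by (simp add: uni_def mult.assoc one_left[OF car_times[OF car_dg]]
        one_left[OF car_dg] flip: mult.assoc[of "dg D (\<lambda>_. 1)"])
  finally show ?thesis by (simp add: fc_def dg_mult)
qed

lemma adj_fc [simp]: "adj (fc D u f) = fc D u f"
  by (simp add: fc_def mult.assoc)

lemma fc_add: "fc D u f + fc D u g = fc D u (\<lambda>i. f i + g i)"
  by (simp add: fc_def distrib_left distrib_right flip: dg_add)

lemma fc_diff: "fc D u f - fc D u g = fc D u (\<lambda>i. f i - g i)"
  by (simp add: fc_def left_diff_distrib right_diff_distrib flip: dg_diff)

lemma fc_scaleR: "r *\<^sub>R fc D u f = fc D u (\<lambda>i. r * f i)"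
  by (simp add: fc_def flip: dg_scaleR)

lemma fc_cong: "(\<And>i. i < D \<Longrightarrow> f i = g i) \<Longrightarrow> fc D u f = fc D u g"
  unfolding fc_def by (simp cong: dg_cong)

lemma fc_one: "uni D u \<Longrightarrow> fc D u (\<lambda>_. 1) = one D"
  by (simp add: fc_def uni_def one_right)

lemma rtr_fc: assumes "uni D u" shows "rtr (fc D u f) = (\<Sum>i<D. f i)"
proof -
  have "rtr (fc D u f) = rtr (adj u * u * dg D f)"
    unfolding fc_def by (subst rtr_comm) (simp add: mult.assoc)
  also have "\<dots> = (\<Sum>i<D. f i)"
    using assms by (simp add: uni_def dg_mult rtr_dg)
  finally show ?thesis .
qed

lemma norm_fc_mult: assumes "uni D u" shows "norm (fc D u f * X) = norm (dg D f * (adj u * X))"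
proof -
  have *: "adj u * (u * Z) = one D * Z" for Z
    using assms by (simp add: uni_def flip: mult.assoc)
  have "one D * dg D f = dg D f" by (simp add: one_left car_dg)
  then have "one D * (dg D f * Z) = dg D f * Z" for Z by (simp flip: mult.assoc)
  then have "(norm (fc D u f * X))\<^sup>2 = (norm (dg D f * (adj u * X)))\<^sup>2"
    by (simp add: norm_sq fc_def mult.assoc *)
  then show ?thesis by simp
qed

text \<open>This replaces operator inequalities: \<open>f^2 <= c^2 g^2\<close> pointwise in a common
  eigenbasis becomes a comparison of Hilbert-Schmidt norms.\<close>

lemma norm_fc_mult_le:
  assumes "uni D u" "0 \<le> c" "\<And>i. i < D \<Longrightarrow> \<bar>f i\<bar> \<le> c * \<bar>g i\<bar>"
  shows "norm (fc D u f * X) \<le> c * norm (fc D u g * X)"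
  unfolding norm_fc_mult[OF assms(1)] by (rule norm_dg_mult_le[OF assms(2,3)])

lemma contr_one: "contr (one D)"
  unfolding contr_def
proof
  fix X
  obtain N where N: "car N X" "D \<le> N" using car_ex by (meson car_mono nle_le)
  have c: "car N (one D * X)" by (meson N car_dg car_mono car_times)
  have "(norm (one D * X))\<^sup>2 \<le> (norm X)\<^sup>2"
    unfolding norm_sq rtr_adj_mult[OF c] rtr_adj_mult[OF N(1)]
    by (intro sum_mono) (simp add: ent_dg_mult)
  then show "norm (one D * X) \<le> norm X" by (rule power2_le_imp_le) simp
qed

lemma norm_fc_mult_bound:
  assumes "uni D u" "0 \<le> c" "\<And>i. i < D \<Longrightarrow> \<bar>f i\<bar> \<le> c"
  shows "norm (fc D u f * X) \<le> c * norm X"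
proof -
  have "norm (fc D u f * X) \<le> c * norm (fc D u (\<lambda>_. 1) * X)"
    by (rule norm_fc_mult_le) (use assms in auto)
  also have "\<dots> \<le> c * norm X"
    by (simp add: fc_one[OF assms(1)] contrD[OF contr_one] mult_left_mono assms(2))
  finally show ?thesis .
qed

lemma contr_fc: "uni D u \<Longrightarrow> (\<And>i. i < D \<Longrightarrow> \<bar>f i\<bar> \<le> 1) \<Longrightarrow> contr (fc D u f)"
  unfolding contr_def using norm_fc_mult_bound[of D u 1 f] by simp

lemma norm_fc: "uni D u \<Longrightarrow> norm (fc D u f) = sqrt (\<Sum>i<D. (f i)\<^sup>2)"
  by (simp add: norm_fmat_def inner_fmat_def fc_mult rtr_fc power2_eq_square)

text \<open>Hoelder's inequality between operator norm and trace norm: \<open>g\<close> splits into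
  \<open>sgn g * sqrt |g|\<close> times \<open>sqrt |g|\<close>, and each factor has squared
  Hilbert-Schmidt norm at most the sum of the \<open>|g i|\<close>.\<close>

lemma rtr_contr_fc_le:
  assumes "uni D u" "contr V"
  shows "rtr (V * fc D u g) \<le> (\<Sum>i<D. \<bar>g i\<bar>)"
proof -
  have g: "fc D u g = fc D u (\<lambda>i. sgn (g i) * sqrt \<bar>g i\<bar>) * fc D u (\<lambda>i. sqrt \<bar>g i\<bar>)"
    unfolding fc_mult[OF assms(1)] by (rule fc_cong) (simp add: sgn_mult_abs mult.assoc)
  have "rtr (V * fc D u g) \<le> norm (V * fc D u (\<lambda>i. sgn (g i) * sqrt \<bar>g i\<bar>)) * norm (fc D u (\<lambda>i. sqrt \<bar>g i\<bar>))"
    unfolding g mult.assoc[symmetric] by (rule rtr_mult_le)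
  also have "\<dots> \<le> norm (fc D u (\<lambda>i. sgn (g i) * sqrt \<bar>g i\<bar>)) * norm (fc D u (\<lambda>i. sqrt \<bar>g i\<bar>))"
    by (intro mult_right_mono contrD assms) simp
  also have "\<dots> \<le> sqrt (\<Sum>i<D. \<bar>g i\<bar>) * sqrt (\<Sum>i<D. \<bar>g i\<bar>)"
    unfolding norm_fc[OF assms(1)]
    by (intro mult_mono real_sqrt_le_mono sum_mono)
      (auto simp: power_mult_distrib sgn_if sum_nonneg)
  also have "\<dots> = (\<Sum>i<D. \<bar>g i\<bar>)" by (simp add: sum_nonneg)
  finally show ?thesis .
qed


section \<open>Matrices as elements of the algebra\<close>

lift_definition op :: "complex mat \<Rightarrow> fmat" is
  "\<lambda>A i j. if i < dim_row A \<and> j < dim_col A then A $$ (i,j) else 0"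
proof -
  fix A :: "complex mat"
  show "\<exists>N. \<forall>i j. N \<le> i \<or> N \<le> j \<longrightarrow> (if i < dim_row A \<and> j < dim_col A then A $$ (i,j) else 0) = 0"
    by (rule exI[of _ "max (dim_row A) (dim_col A)"]) auto
qed

lemma ent_op: "ent (op A) i j = (if i < dim_row A \<and> j < dim_col A then A $$ (i,j) else 0)"
  by (simp add: op.rep_eq)

lemma car_op: "A \<in> carrier_mat D D \<Longrightarrow> car D (op A)"
  by (auto simp: car_def ent_op)

lemma op_inj: "A \<in> carrier_mat D D \<Longrightarrow> B \<in> carrier_mat D D \<Longrightarrow> op A = op B \<Longrightarrow> A = B"
  by (rule eq_matI) (metis carrier_matD ent_op, auto)

lemma op_surj: assumes "car D X" shows "\<exists>A \<in> carrier_mat D D. op A = X"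
proof
  show "mat D D (\<lambda>(i,j). ent X i j) \<in> carrier_mat D D" by simp
  show "op (mat D D (\<lambda>(i,j). ent X i j)) = X"
    by (rule fmat_eqI) (use assms in \<open>auto simp: ent_op car_def\<close>)
qed

lemma op_mult:
  assumes "A \<in> carrier_mat D D" "B \<in> carrier_mat D D"
  shows "op (A * B) = op A * op B"
  by (rule fmat_eqI)
    (use assms in \<open>auto simp: ent_op ent_times[OF disjI1[OF car_op[OF assms(1)]]] scalar_prod_def
      atLeast0LessThan intro!: sum.cong\<close>)

lemma adj_mat_carrier: "A \<in> carrier_mat D D \<Longrightarrow> adj_mat A \<in> carrier_mat D D"
  by (simp add: adj_mat_def)

lemma rdiag_mat_carrier: "rdiag_mat D l \<in> carrier_mat D D"
  by (simp add: rdiag_mat_def)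

lemma op_adj: "op (adj_mat A) = adj (op A)"
  by (rule fmat_eqI) (auto simp: ent_op adj_mat_def)

lemma op_diff: "A \<in> carrier_mat D D \<Longrightarrow> B \<in> carrier_mat D D \<Longrightarrow> op (A - B) = op A - op B"
  by (rule fmat_eqI) (auto simp: ent_op)

lemma op_rdiag: "op (rdiag_mat D l) = dg D l"
  by (rule fmat_eqI) (auto simp: ent_op ent_dg rdiag_mat_def)

lemma op_one: "op (1\<^sub>m D) = one D"
  by (rule fmat_eqI) (auto simp: ent_op ent_dg)

lemma rtr_op: "A \<in> carrier_mat D D \<Longrightarrow> rtr (op A) = Re (mtrace A)"
  by (simp add: rtr_car[OF car_op] mtrace_def ent_op)

lemma op_mixture:
  assumes "\<And>x. x \<in> S \<Longrightarrow> W x \<in> carrier_mat D D"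
  shows "op (mixture D S W p) = (\<Sum>x\<in>S. p x *\<^sub>R op (W x))"
proof (rule fmat_eqI)
  fix i j
  show "ent (op (mixture D S W p)) i j = ent (\<Sum>x\<in>S. p x *\<^sub>R op (W x)) i j"
    using carrier_matD[OF assms]
    by (auto simp: ent_op mixture_def intro!: sum.cong sum.neutral)
qed

lemma mixture_carrier: "mixture D S W p \<in> carrier_mat D D"
  by (simp add: mixture_def)

lemma unitary_matD: "unitary_mat D U \<Longrightarrow> U \<in> carrier_mat D D"
  by (simp add: unitary_mat_def)

lemma uni_op: "unitary_mat D U \<Longrightarrow> uni D (op U)"
  using op_mult[of U D "adj_mat U"] op_mult[of "adj_mat U" D U]
  by (simp add: uni_def unitary_mat_def adj_mat_carrier car_op op_adj op_one)

lemma op_fc: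
  assumes "unitary_mat D U"
  shows "op (U * rdiag_mat D l * adj_mat U) = fc D (op U) l"
proof -
  have U: "U \<in> carrier_mat D D" using assms by (rule unitary_matD)
  show ?thesis
    by (simp add: fc_def op_mult[of _ D] U rdiag_mat_carrier adj_mat_carrier op_rdiag op_adj
        mult_carrier_mat[of _ D D])
qed

section \<open>The spectral theorem\<close>

text \<open>A vector of length \<open>n + 1\<close> stored as column \<open>n\<close> of a square
  matrix, so that vectors stay inside the algebra and a squared norm appears as a multiple of
  \<open>unit_at n\<close>.\<close>

lift_definition colv :: "nat \<Rightarrow> (nat \<Rightarrow> complex) \<Rightarrow> fmat" is
  "\<lambda>n f i j. if i \<le> n \<and> j = n then f i else 0"
proof -
  fix n and f :: "nat \<Rightarrow> complex"
  show "\<exists>N. \<forall>i j. N \<le> i \<or> N \<le> j \<longrightarrow> (if i \<le> n \<and> j = n then f i else 0) = 0"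
    by (rule exI[of _ "Suc n"]) auto
qed

lemma ent_colv: "ent (colv n f) i j = (if i \<le> n \<and> j = n then f i else 0)"
  by (simp add: colv.rep_eq)

lemma car_colv: "car (Suc n) (colv n f)"
  by (auto simp: car_def ent_colv)

abbreviation unit_at :: "nat \<Rightarrow> fmat" where "unit_at n \<equiv> dg (Suc n) (\<lambda>i. if i = n then 1 else 0)"

lemma ent_unit_at: "ent (unit_at n) i j = (if i = n \<and> j = n then 1 else 0)"
  by (auto simp: ent_dg)

lemma ent_mult_unit_at: "ent (A * unit_at n) i j = (if j = n then ent A i n else 0)"
proof -
  have "A * unit_at n = adj (unit_at n * adj A)" by simp
  then show ?thesis by (simp only: ent_adj ent_dg_mult) simp
qed

text \<open>A complex matrix has nonempty spectrum, which gives the eigenvector; its eigenvalue is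
  real because \<open>adj v * A * v\<close> is self-adjoint. The last coordinate is made real
  because a reflection can carry the last basis vector to \<open>v\<close> only if their inner
  product is real.\<close>

lemma hermitian_eigenvector:
  assumes "car (Suc n) A" "adj A = A"
  obtains f e where "A * colv n f = e *\<^sub>R colv n f" "adj (colv n f) * colv n f = unit_at n"
    "Im (f n) = 0"
proof -
  obtain M where M: "M \<in> carrier_mat (Suc n) (Suc n)" "op M = A"
    using op_surj[OF assms(1)] by blast
  obtain e where "eigenvalue M e"
    using spectrum_non_empty[OF M(1)] by (auto simp: spectrum_def)
  then obtain v where v: "v \<in> carrier_vec (Suc n)" "v \<noteq> 0\<^sub>v (Suc n)" "M *\<^sub>v v = e \<cdot>\<^sub>v v"
    using M(1) by (auto simp: eigenvalue_def eigenvector_def)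
  define s where "s = (\<Sum>i<Suc n. (cmod (v $ i))\<^sup>2)"
  have "\<exists>i<Suc n. v $ i \<noteq> 0"
    using v(1,2) by (metis carrier_vecD eq_vecI index_zero_vec(1) index_zero_vec(2))
  then obtain i0 where i0: "i0 < Suc n" "v $ i0 \<noteq> 0" by blast
  have "0 < (cmod (v $ i0))\<^sup>2" using i0 by simp
  also have "\<dots> \<le> s" unfolding s_def using i0 by (intro member_le_sum) auto
  finally have s: "0 < s" .
  \<comment> \<open>Division by \<open>sqrt s\<close> normalises; the phase turns the last
    coordinate into a nonnegative number, and is 1 when that coordinate vanishes.\<close>
  define c where "c = (if v $ n = 0 then 1 else cnj (v $ n) / cmod (v $ n)) / sqrt s"
  have c: "(cmod c)\<^sup>2 = 1 / s" using s by (simp add: c_def norm_divide power_divide)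
  define f where "f i = c * v $ i" for i
  let ?v = "colv n f"
  have ev: "(\<Sum>k<Suc n. ent A i k * f k) = e * f i" if "i < Suc n" for i
  proof -
    have "(\<Sum>k<Suc n. M $$ (i,k) * v $ k) = e * v $ i"
      using arg_cong[OF v(3), of "\<lambda>w. w $ i"] that M(1) v(1)
      by (simp add: mult_mat_vec_def scalar_prod_def atLeast0LessThan)
    moreover have "(\<Sum>k<Suc n. ent A i k * f k) = c * (\<Sum>k<Suc n. M $$ (i,k) * v $ k)"
      unfolding sum_distrib_left
      by (rule sum.cong) (use that M in \<open>auto simp: ent_op f_def M(2)[symmetric]\<close>)
    ultimately show ?thesis by (simp add: f_def)
  qed
  have fnorm: "(\<Sum>k<Suc n. cnj (f k) * f k) = 1"
  proof -
    have "(\<Sum>k<Suc n. cnj (f k) * f k) = (\<Sum>k<Suc n. complex_of_real ((cmod (f k))\<^sup>2))"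
      by (intro sum.cong refl) (metis complex_norm_square mult.commute)
    also have "(\<Sum>k<Suc n. (cmod (f k))\<^sup>2) = (cmod c)\<^sup>2 * s"
      by (simp add: f_def norm_mult power_mult_distrib s_def sum_distrib_left distrib_left)
    then have "(\<Sum>k<Suc n. complex_of_real ((cmod (f k))\<^sup>2)) = 1"
      using s c by (simp only: of_real_sum[symmetric]) simp
    finally show ?thesis .
  qed
  have 1: "adj ?v * ?v = unit_at n"
    by (rule fmat_eqI) (use fnorm in \<open>auto simp: ent_unit_at ent_times[OF disjI2[OF car_colv]] ent_colv
       simp del: sum.lessThan_Suc\<close>)
  have Av: "ent (A * ?v) i j = (if i \<le> n \<and> j = n then e * f i else 0)" for i j
  proof (cases "i \<le> n \<and> j = n")
    case True
    then show ?thesis using ev[of i]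
      by (simp add: ent_times[OF disjI2[OF car_colv]] ent_colv del: sum.lessThan_Suc)
  next
    case False
    then show ?thesis using assms(1)
      by (auto simp: ent_times[OF disjI2[OF car_colv]] ent_colv car_def simp del: sum.lessThan_Suc)
  qed
  have "ent (adj ?v * (A * ?v)) n n = (\<Sum>k<Suc n. cnj (f k) * (e * f k))"
    unfolding ent_times[OF disjI1[OF car_adj[OF car_colv]]]
    by (rule sum.cong) (auto simp: Av ent_colv)
  also have "\<dots> = e * (\<Sum>k<Suc n. cnj (f k) * f k)"
    unfolding sum_distrib_left by (intro sum.cong refl) simp
  finally have e: "ent (adj ?v * (A * ?v)) n n = e" by (simp only: fnorm mult_1_right)
  have "adj (adj ?v * (A * ?v)) = adj ?v * (A * ?v)" by (simp add: assms(2) mult.assoc)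
  then have "cnj e = e" using e ent_adj by metis
  then have er: "complex_of_real (Re e) = e" by (simp add: complex_eq_iff)
  have 2: "A * ?v = Re e *\<^sub>R ?v"
    by (rule fmat_eqI) (simp add: Av ent_colv er)
  have "cnj (v $ n) * v $ n = complex_of_real ((cmod (v $ n))\<^sup>2)"
    by (metis complex_norm_square mult.commute)
  then have "f n = complex_of_real ((if v $ n = 0 then 0 else cmod (v $ n)) / sqrt s)"
    by (auto simp: f_def c_def power2_eq_square)
  then have "Im (f n) = 0" by (metis Im_complex_of_real)
  with 1 2 show ?thesis using that by blast
qed

lemma dg_Suc: "dg (Suc n) f = dg n f + f n *\<^sub>R unit_at n"
  by (rule fmat_eqI) (auto simp: ent_dg)

text \<open>A Householder reflection moves the eigenvector to the last basis vector, which splits off a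
  one-dimensional block.\<close>
lemma spectral:
  assumes "car D A" "adj A = A"
  shows "\<exists>u l. uni D u \<and> A = fc D u l"
  using assms
proof (induction D arbitrary: A)
  case 0
  have "A = 0" using 0 by (intro fmat_eqI) (auto simp: car_def)
  moreover have "fc 0 0 (\<lambda>_. 0) = 0" "uni 0 0"
    by (auto intro!: fmat_eqI simp: uni_def fc_def ent_dg car_zero)
  ultimately show ?case by metis
next
  case (Suc n)
  let ?E = "unit_at n" and ?I = "one (Suc n)"
  obtain f e where f: "A * colv n f = e *\<^sub>R colv n f" "adj (colv n f) * colv n f = ?E" "Im (f n) = 0"
    using hermitian_eigenvector[OF Suc.prems] .
  define v where "v = colv n f"
  define w where "w = v - ?E"
  have cw: "car (Suc n) w" by (simp add: w_def v_def car_diff car_colv car_dg)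
  have EE: "?E * ?E = ?E" unfolding dg_mult by (rule dg_cong) auto
  have vE: "v * ?E = v" by (rule fmat_eqI) (simp add: ent_mult_unit_at v_def ent_colv)
  have wE: "w * ?E = w" by (simp add: w_def left_diff_distrib vE EE)
  have Ev: "?E * v = Re (f n) *\<^sub>R ?E"
    by (rule fmat_eqI) (use f(3) in \<open>auto simp: ent_dg_mult ent_unit_at v_def ent_colv complex_eq_iff\<close>)
  have vE': "adj v * ?E = Re (f n) *\<^sub>R ?E"
    using arg_cong[OF Ev, of adj] by simp
  \<comment> \<open>The squared length of \<open>w\<close>, a difference of two unit vectors with
    real inner product.\<close>
  define r where "r = 2 - 2 * Re (f n)"
  have *: "X - c *\<^sub>R X - (c *\<^sub>R X - X) = (2 - 2 * c) *\<^sub>R X" for c and X :: fmat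
    by (rule fmat_eqI) (simp add: algebra_simps)
  have "adj w * w = ?E - Re (f n) *\<^sub>R ?E - (Re (f n) *\<^sub>R ?E - ?E)"
    using f(2) by (simp add: w_def left_diff_distrib right_diff_distrib EE Ev vE' flip: v_def)
  then have ww: "adj w * w = r *\<^sub>R ?E" by (simp only: * r_def)
  have wE2: "adj w * ?E = (- (r / 2)) *\<^sub>R ?E"
  proof -
    have "- (r / 2) = Re (f n) - 1" by (simp add: r_def field_simps)
    then show ?thesis
      by (simp only:) (simp add: w_def left_diff_distrib vE' EE scaleR_left_diff_distrib)
  qed
  \<comment> \<open>If \<open>v\<close> is already the last basis vector, then \<open>r = 0\<close>
    and division by zero yields 0, so \<open>H\<close> is the identity, as it should be.\<close>
  define H where "H = ?I - (2 / r) *\<^sub>R (w * adj w)"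
  have adjH: "adj H = H" by (simp add: H_def)
  have cH: "car (Suc n) H" by (auto simp: H_def intro!: car_diff car_dg car_scaleR car_times car_adj cw)
  have w0: "w = 0" if "r = 0"
  proof -
    have "(norm w)\<^sup>2 = 0" by (simp add: norm_sq ww that)
    then show ?thesis by simp
  qed
  have HH: "H * H = ?I"
  proof -
    have "w * adj w * (w * adj w) = r *\<^sub>R (w * adj w)"
    proof -
      have "w * adj w * (w * adj w) = w * (adj w * w) * adj w" by (simp add: mult.assoc)
      then show ?thesis by (simp add: ww wE)
    qed
    moreover have "?I * (w * adj w) = w * adj w" "(w * adj w) * ?I = w * adj w"
      by (simp_all add: one_left one_right cw car_adj car_times)
    ultimately show ?thesis using w0
      by (cases "r = 0") (simp_all add: H_def left_diff_distrib right_diff_distrib one_left car_dg scaleR_2)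
  qed
  have HE: "H * ?E = v"
  proof -
    have "w * adj w * ?E = (- (r / 2)) *\<^sub>R w"
      by (simp add: mult.assoc wE2 wE)
    then have "H * ?E = ?E + w"
      using w0 by (cases "r = 0") (simp_all add: H_def left_diff_distrib one_left car_dg)
    then show ?thesis by (simp add: w_def)
  qed
  have Hv: "H * v = ?E"
    unfolding HE[symmetric] by (simp add: HH one_left car_dg flip: mult.assoc)
  define A1 where "A1 = H * A * H"
  define A2 where "A2 = A1 - e *\<^sub>R ?E"
  have adjA1: "adj A1 = A1" by (simp add: A1_def adjH Suc.prems(2) mult.assoc)
  have "A1 * ?E = e *\<^sub>R ?E"
    by (simp add: A1_def mult.assoc HE f(1)[folded v_def] Hv)
  then have A2E: "A2 * ?E = 0" by (simp add: A2_def left_diff_distrib EE)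
  have adjA2: "adj A2 = A2" by (simp add: A2_def adjA1)
  have cA1: "car (Suc n) A1" by (simp add: A1_def car_times cH Suc.prems(1))
  then have cA2: "car (Suc n) A2" by (simp add: A2_def car_diff car_scaleR car_dg)
  have col0: "ent A2 i n = 0" for i
    using ent_mult_unit_at[of A2 n i n] by (simp add: A2E)
  then have row0: "ent A2 n i = 0" for i
    by (metis adjA2 complex_cnj_zero ent_adj)
  have "car n A2"
    unfolding car_def using cA2 col0 row0 by (metis car_def le_antisym not_less_eq_eq)
  then obtain u l where u: "uni n u" "A2 = fc n u l"
    using Suc.IH adjA2 by blast
  have cu: "car n u" using u(1) by (simp add: uni_def)
  have uE: "u * ?E = 0" "adj u * ?E = 0"
    by (rule fmat_eqI, use cu in \<open>simp add: ent_mult_unit_at car_def\<close>)+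
  have Eu: "?E * u = 0" "?E * adj u = 0"
    using arg_cong[OF uE(2), of adj] arg_cong[OF uE(1), of adj] by simp_all
  have I: "?I = one n + ?E" using dg_Suc[of n "\<lambda>_. 1"] by simp
  let ?u = "u + ?E"
  have uu: "uni (Suc n) ?u"
    using u(1) car_mono[OF cu, of "Suc n"]
    by (simp add: uni_def car_add car_dg distrib_left distrib_right uE Eu EE flip: I)
  have uu': "uni (Suc n) (H * ?u)"
  proof -
    have "H * ?u * adj (H * ?u) = H * (?u * adj ?u) * H"
      by (simp only: adj_mult adjH mult.assoc)
    also have "\<dots> = ?I" using uu by (simp add: uni_def one_right cH HH)
    finally have 1: "H * ?u * adj (H * ?u) = ?I" .
    have "adj (H * ?u) * (H * ?u) = adj ?u * (H * H) * ?u"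
      by (simp only: adj_mult adjH mult.assoc)
    also have "\<dots> = ?I" using uu by (simp only: HH uni_def one_right[OF car_adj])
    finally show ?thesis using 1 uu by (simp add: uni_def car_times cH)
  qed
  let ?l = "\<lambda>i. if i = n then e else l i"
  have dgl: "dg (Suc n) ?l = dg n l + e *\<^sub>R ?E"
    by (subst dg_Suc) (simp cong: dg_cong)
  have Edg: "?E * dg n l = 0" "dg n l * ?E = 0"
    by (rule fmat_eqI, auto simp: ent_dg_mult ent_mult_unit_at ent_dg)+
  have "?u * dg (Suc n) ?l * adj ?u = u * dg n l * adj u + e *\<^sub>R ?E"
    by (simp add: dgl distrib_left distrib_right uE Eu EE Edg mult.assoc)
  then have A1: "A1 = ?u * dg (Suc n) ?l * adj ?u"
    using u(2) by (simp add: fc_def A2_def diff_eq_eq)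
  have "fc (Suc n) (H * ?u) ?l = H * (?u * dg (Suc n) ?l * adj ?u) * H"
    by (simp only: fc_def adj_mult adjH mult.assoc)
  also have "\<dots> = (H * H) * A * (H * H)" unfolding A1[symmetric] A1_def by (simp only: mult.assoc)
  also have "\<dots> = A" by (simp only: HH one_left one_right Suc.prems(1))
  finally show ?case using uu' by metis
qed

lemma spectral_mat:
  assumes "hermitian_mat D A"
  shows "\<exists>U l. unitary_mat D U \<and> A = U * rdiag_mat D l * adj_mat U"
proof -
  have A: "A \<in> carrier_mat D D" "adj_mat A = A" using assms by (auto simp: hermitian_mat_def)
  obtain u l where u: "uni D u" "op A = fc D u l"
    using spectral[OF car_op[OF A(1)]] A(2) by (metis op_adj)
  obtain U where U: "U \<in> carrier_mat D D" "op U = u" using op_surj u(1) unfolding uni_def by blast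
  have aU: "adj_mat U \<in> carrier_mat D D" using U(1) by (rule adj_mat_carrier)
  have "unitary_mat D U"
    unfolding unitary_mat_def
    by (intro conjI U(1); rule op_inj[of _ D])
      (use u(1) U aU in \<open>auto simp: op_mult[of _ D] op_adj op_one uni_def\<close>)
  moreover have "A = U * rdiag_mat D l * adj_mat U"
    by (rule op_inj[of _ D])
      (use A U aU u(2) op_fc[OF calculation] in \<open>auto simp: rdiag_mat_def\<close>)
  ultimately show ?thesis by blast
qed

text \<open>\<open>herm_fun\<close> is a choice, so the decomposition is whichever one witnesses the
  chosen value, and it may vary with \<open>f\<close>. The spectral theorem guarantees that there is
  something to choose.\<close>

lemma herm_fun_decomp:
  assumes "hermitian_mat D A"
  obtains U l where "unitary_mat D U" "A = U * rdiag_mat D l * adj_mat U"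
    "herm_fun f A = U * rdiag_mat D (\<lambda>i. f (l i)) * adj_mat U"
proof -
  have D: "dim_row A = D" using assms by (auto simp: hermitian_mat_def)
  have "\<exists>B U l. unitary_mat D U \<and> A = U * rdiag_mat D l * adj_mat U \<and>
      B = U * rdiag_mat D (\<lambda>i. f (l i)) * adj_mat U"
    using spectral_mat[OF assms] by auto
  then have "\<exists>U l. unitary_mat D U \<and> A = U * rdiag_mat D l * adj_mat U \<and>
      herm_fun f A = U * rdiag_mat D (\<lambda>i. f (l i)) * adj_mat U"
    unfolding herm_fun_def D by (rule someI_ex)
  then show ?thesis by (elim exE conjE) (rule that)
qed

section \<open>The trace norm\<close>

text \<open>The eigenvalue \<open>l i\<close> is the squared norm of \<open>op A\<close> on the
  \<open>i\<close>-th eigenprojection, hence nonnegative.\<close>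

lemma trace_norm_decomp:
  assumes "A \<in> carrier_mat D D"
  obtains u l where "uni D u" "adj (op A) * op A = fc D u l" "\<And>i. i < D \<Longrightarrow> 0 \<le> l i"
    "trace_norm A = (\<Sum>i<D. sqrt (l i))"
proof -
  let ?B = "adj_mat A * A"
  have aA: "adj_mat A \<in> carrier_mat D D" using assms by (rule adj_mat_carrier)
  then have B: "?B \<in> carrier_mat D D" using assms by simp
  have opB: "op ?B = adj (op A) * op A" by (simp add: op_mult[OF aA assms] op_adj)
  have "hermitian_mat D ?B"
    unfolding hermitian_mat_def
    by (intro conjI B op_inj[OF adj_mat_carrier[OF B] B]) (simp add: op_adj opB)
  then obtain U l where U: "unitary_mat D U" "?B = U * rdiag_mat D l * adj_mat U"
    "herm_fun sqrt ?B = U * rdiag_mat D (\<lambda>i. sqrt (l i)) * adj_mat U"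
    using herm_fun_decomp[of D ?B sqrt] by blast
  have u: "uni D (op U)" using U(1) by (rule uni_op)
  have Bl: "adj (op A) * op A = fc D (op U) l"
    unfolding opB[symmetric] by (subst U(2)) (rule op_fc[OF U(1)])
  have "0 \<le> l i" if "i < D" for i
  proof -
    let ?e = "fc D (op U) (\<lambda>j. if j = i then 1 else 0)"
    have "(norm (op A * ?e))\<^sup>2 = rtr (?e * (fc D (op U) l * ?e))"
      by (simp add: norm_sq mult.assoc flip: Bl)
    also have "\<dots> = l i"
      using that by (simp add: fc_mult[OF u] rtr_fc[OF u] if_distrib cong: if_cong)
    finally show ?thesis by (metis zero_le_power2)
  qed
  moreover have "trace_norm A = (\<Sum>i<D. sqrt (l i))"
  proof -
    have c: "U * rdiag_mat D (\<lambda>i. sqrt (l i)) * adj_mat U \<in> carrier_mat D D"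
      using unitary_matD[OF U(1)] by (auto simp: rdiag_mat_def adj_mat_def)
    show ?thesis
      by (simp only: trace_norm_def U(3) rtr_op[OF c, symmetric] op_fc[OF U(1)] rtr_fc[OF u])
  qed
  ultimately show ?thesis using that u Bl by blast
qed

text \<open>Polar decomposition: \<open>V\<close> is the pseudoinverse of the modulus of
  \<open>A\<close> times the adjoint of \<open>A\<close>. Then \<open>V * adj V\<close> is the
  projection onto the support of the modulus, which makes \<open>adj V\<close>, and so
  \<open>V\<close>, a contraction.\<close>

lemma trace_norm_attained:
  assumes "A \<in> carrier_mat D D"
  shows "\<exists>V. contr V \<and> trace_norm A = rtr (V * op A)"
proof -
  obtain u l where u: "uni D u" "adj (op A) * op A = fc D u l" "\<And>i. i < D \<Longrightarrow> 0 \<le> l i"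
    "trace_norm A = (\<Sum>i<D. sqrt (l i))" using trace_norm_decomp[OF assms] by blast
  let ?k = "fc D u (\<lambda>i. if 0 < l i then 1 / sqrt (l i) else 0)"
  define V where "V = ?k * adj (op A)"
  have "rtr (V * op A) = rtr (?k * fc D u l)" by (simp add: V_def mult.assoc u(2))
  also have "\<dots> = (\<Sum>i<D. sqrt (l i))"
    unfolding fc_mult[OF u(1)] rtr_fc[OF u(1)]
    by (rule sum.cong) (use u(3) in \<open>auto simp: real_div_sqrt not_less intro: antisym\<close>)
  finally have 1: "trace_norm A = rtr (V * op A)" by (simp add: u(4))
  have "contr (adj V)"
    unfolding contr_def
  proof
    fix X
    let ?p = "fc D u (\<lambda>i. if 0 < l i then 1 else 0)"
    have "V * adj V = ?k * fc D u l * ?k" by (simp add: V_def u(2)[symmetric] mult.assoc)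
    also have "\<dots> = ?p * ?p"
      unfolding fc_mult[OF u(1)] by (rule fc_cong) (auto simp: field_simps)
    finally have pp: "V * adj V = ?p * ?p" .
    have "(norm (adj V * X))\<^sup>2 = rtr (adj X * (V * adj V) * X)" by (simp add: norm_sq mult.assoc)
    also have "\<dots> = (norm (?p * X))\<^sup>2" unfolding pp by (simp add: norm_sq mult.assoc)
    finally have "(norm (adj V * X))\<^sup>2 = (norm (?p * X))\<^sup>2" .
    then have "norm (adj V * X) = norm (?p * X)" by simp
    also have "\<dots> \<le> norm X" by (intro contrD contr_fc u(1)) auto
    finally show "norm (adj V * X) \<le> norm X" .
  qed
  then have "contr V" using contr_adj by fastforce
  with 1 show ?thesis by blast
qed

text \<open>The identity is split into the rank-one eigenprojections \<open>e i\<close> of the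
  squared modulus; Cauchy-Schwarz bounds each piece by
  \<open>norm (e i) * norm (op A * e i)\<close>, that is, by a singular value.\<close>

lemma rtr_contr_le_trace_norm:
  assumes "A \<in> carrier_mat D D" "contr V"
  shows "rtr (V * op A) \<le> trace_norm A"
proof -
  obtain u l where u: "uni D u" "adj (op A) * op A = fc D u l" "\<And>i. i < D \<Longrightarrow> 0 \<le> l i"
    "trace_norm A = (\<Sum>i<D. sqrt (l i))" using trace_norm_decomp[OF assms(1)] by blast
  define e where "e i = fc D u (\<lambda>j. if j = i then 1 else 0)" for i
  have ee: "e i * e i = e i" for i unfolding e_def fc_mult[OF u(1)] by (rule fc_cong) auto
  have "(\<Sum>i<N. e i) = fc D u (\<lambda>j. if j < N then 1 else 0)" for N
  proof (induction N)
    case 0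
    show ?case using fc_scaleR[of 0 D u "\<lambda>_. 0"] by simp
  next
    case (Suc N)
    then show ?case by (simp add: e_def fc_add) (rule fc_cong, auto)
  qed
  then have "(\<Sum>i<D. e i) = fc D u (\<lambda>_. 1)"
    using fc_cong[of D "\<lambda>j. if j < D then 1 else 0" "\<lambda>_. 1" u] by simp
  then have one: "(\<Sum>i<D. e i) = one D" by (simp add: fc_one u(1))
  have "rtr (V * op A) = (\<Sum>i<D. rtr (V * op A * e i))"
    using one_right[OF car_op[OF assms(1)]]
    by (simp flip: rtr_sum sum_distrib_left add: one mult.assoc)
  also have "\<dots> \<le> (\<Sum>i<D. sqrt (l i))"
  proof (rule sum_mono)
    fix i assume i: "i \<in> {..<D}"
    have "rtr (V * op A * e i) = rtr (e i * V * (op A * e i))"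
      using rtr_comm[of "V * op A * e i" "e i"] by (simp add: mult.assoc ee)
    also have "\<dots> \<le> norm (e i * V) * norm (op A * e i)" by (rule rtr_mult_le)
    also have "\<dots> \<le> norm (e i) * norm (op A * e i)"
      by (intro mult_right_mono contr_mult_right assms) simp
    also have "norm (e i) = 1"
      using i by (simp add: e_def norm_fc[OF u(1)] if_distrib[of "\<lambda>x. x\<^sup>2"] cong: if_cong)
    also have "norm (op A * e i) = sqrt (l i)"
    proof -
      have "(norm (op A * e i))\<^sup>2 = rtr (e i * (fc D u l * e i))"
        by (simp add: norm_sq mult.assoc e_def flip: u(2))
      also have "\<dots> = l i"
        using i by (simp add: e_def fc_mult[OF u(1)] rtr_fc[OF u(1)] if_distrib cong: if_cong)
      finally show ?thesis by (metis norm_ge_zero real_sqrt_unique)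
    qed
    finally show "rtr (V * op A * e i) \<le> sqrt (l i)" by simp
  qed
  finally show ?thesis by (simp add: u(4))
qed

section \<open>Expectations over independent samples\<close>

text \<open>Expectation over \<open>m\<close> independent samples with weights \<open>p\<close> on
  \<open>S\<close>, by recursion on \<open>m\<close>, so that no probability space has to be
  built.\<close>

primrec iexp :: "'a set \<Rightarrow> ('a \<Rightarrow> real) \<Rightarrow> nat \<Rightarrow> ('a list \<Rightarrow> real) \<Rightarrow> real" where
  "iexp S p 0 F = F []"
| "iexp S p (Suc m) F = (\<Sum>x\<in>S. p x * iexp S p m (\<lambda>xs. F (x # xs)))"

lemma iexp_mono:
  assumes "\<And>x. x \<in> S \<Longrightarrow> 0 \<le> p x"
    and "\<And>xs. length xs = m \<Longrightarrow> set xs \<subseteq> S \<Longrightarrow> F xs \<le> G xs"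
  shows "iexp S p m F \<le> iexp S p m G"
  using assms(2)
  by (induction m arbitrary: F G) (auto intro!: sum_mono mult_left_mono assms(1))

lemma iexp_cmult: "iexp S p m (\<lambda>xs. c * F xs) = c * iexp S p m F"
  by (induction m arbitrary: F) (auto simp: sum_distrib_left mult.left_commute)

lemma iexp_add: "iexp S p m (\<lambda>xs. F xs + G xs) = iexp S p m F + iexp S p m G"
  by (induction m arbitrary: F G) (auto simp: distrib_left sum.distrib)

lemma iexp_const: "sum p S = 1 \<Longrightarrow> iexp S p m (\<lambda>_. c) = c"
  by (induction m) (auto simp flip: sum_distrib_right)

lemma iexp_sum: "finite T \<Longrightarrow> sum p S = 1 \<Longrightarrow>
    iexp S p m (\<lambda>xs. \<Sum>t\<in>T. F t xs) = (\<Sum>t\<in>T. iexp S p m (F t))"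
  by (induction T rule: finite_induct) (auto simp: iexp_add iexp_const)

lemma iexp_prod: "iexp S p m (\<lambda>xs. prod_list (map g xs)) = (\<Sum>x\<in>S. p x * g x) ^ m"
  by (induction m) (auto simp: iexp_cmult sum_distrib_right mult.assoc)

lemma iexp_sum_list:
  assumes "sum p S = 1"
  shows "iexp S p m (\<lambda>xs. sum_list (map g xs)) = real m * (\<Sum>x\<in>S. p x * g x)"
proof (induction m)
  case (Suc m)
  have "iexp S p (Suc m) (\<lambda>xs. sum_list (map g xs)) =
      (\<Sum>x\<in>S. p x * g x + p x * (real m * (\<Sum>x\<in>S. p x * g x)))"
    by (simp add: iexp_add iexp_const[OF assms] Suc distrib_left)
  also have "\<dots> = (\<Sum>x\<in>S. p x * g x) + (\<Sum>x\<in>S. p x) * (real m * (\<Sum>x\<in>S. p x * g x))"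
    by (simp add: sum.distrib sum_distrib_right)
  finally show ?case by (simp add: assms distrib_right)
qed simp

text \<open>The first moment method, applied one sample at a time: some value of the next sample has
  a conditional mean no larger than the average.\<close>

lemma iexp_witness:
  assumes "\<And>x. x \<in> S \<Longrightarrow> 0 \<le> p x" "sum p S = 1"
  shows "\<exists>xs. length xs = m \<and> set xs \<subseteq> S \<and> F xs \<le> iexp S p m F"
proof (induction m arbitrary: F)
  case (Suc m)
  let ?G = "\<lambda>x. iexp S p m (\<lambda>xs. F (x # xs))"
  have "\<exists>x\<in>S. ?G x \<le> iexp S p (Suc m) F"
  proof (rule ccontr)
    assume "\<not> ?thesis"
    then have lt: "\<And>x. x \<in> S \<Longrightarrow> iexp S p (Suc m) F < ?G x" by auto
    have fin: "finite S" using assms(2) by (metis sum.infinite zero_neq_one)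
    obtain x0 where x0: "x0 \<in> S" "0 < p x0"
      using assms by (metis less_eq_real_def sum.neutral zero_neq_one)
    have "iexp S p (Suc m) F = (\<Sum>x\<in>S. p x * iexp S p (Suc m) F)"
      using assms(2) by (metis mult_1 sum_distrib_right)
    also have "\<dots> < (\<Sum>x\<in>S. p x * ?G x)"
      by (rule sum_strict_mono_ex1[OF fin])
        (use lt assms(1) x0 in \<open>auto intro!: mult_left_mono bexI[of _ x0] intro: less_imp_le\<close>)
    finally show False by simp
  qed
  then obtain x where x: "x \<in> S" "?G x \<le> iexp S p (Suc m) F" by blast
  obtain xs where "length xs = m" "set xs \<subseteq> S" "F (x # xs) \<le> ?G x"
    using Suc[of "\<lambda>xs. F (x # xs)"] by blast
  then show ?case using x by (intro exI[of _ "x # xs"]) auto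
qed simp

text \<open>Cross terms vanish because the \<open>Y x\<close> are centred. The offset
  \<open>v\<close> carries the induction: it collects the samples already drawn.\<close>

lemma iexp_norm_sq:
  fixes Y :: "'a \<Rightarrow> 'b::real_inner"
  assumes "sum p S = 1" "(\<Sum>x\<in>S. p x *\<^sub>R Y x) = 0"
  shows "iexp S p m (\<lambda>xs. (norm (v + sum_list (map Y xs)))\<^sup>2)
    = (norm v)\<^sup>2 + real m * (\<Sum>x\<in>S. p x * (norm (Y x))\<^sup>2)"
proof (induction m arbitrary: v)
  case (Suc m)
  let ?s = "\<Sum>x\<in>S. p x * (norm (Y x))\<^sup>2"
  have *: "(norm (v + Y x))\<^sup>2 = (norm v)\<^sup>2 + 2 * inner v (Y x) + (norm (Y x))\<^sup>2" for x
    by (simp add: power2_norm_eq_inner inner_add_left inner_add_right inner_commute)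
  have z: "(\<Sum>x\<in>S. p x * inner v (Y x)) = 0"
    using arg_cong[OF assms(2), of "inner v"] by (simp add: inner_sum_right)
  have "iexp S p (Suc m) (\<lambda>xs. (norm (v + sum_list (map Y xs)))\<^sup>2)
    = (\<Sum>x\<in>S. p x * ((norm (v + Y x))\<^sup>2 + real m * ?s))"
    using Suc[of "v + Y _"] by (simp add: add.assoc)
  also have "\<dots> = (\<Sum>x\<in>S. p x * ((norm v)\<^sup>2 + real m * ?s) + 2 * (p x * inner v (Y x))
      + p x * (norm (Y x))\<^sup>2)"
    by (intro sum.cong refl) (simp add: * algebra_simps)
  also have "\<dots> = (\<Sum>x\<in>S. p x) * ((norm v)\<^sup>2 + real m * ?s) + 2 * (\<Sum>x\<in>S. p x * inner v (Y x)) + ?s"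
    by (simp add: sum.distrib sum_distrib_right sum_distrib_left)
  finally show ?case by (simp add: assms(1) z algebra_simps)
qed simp

text \<open>The variance of an average of \<open>m\<close> independent vectors of squared norm at
  most \<open>b\<close> is at most \<open>b / m\<close>.\<close>

lemma iexp_norm_le:
  fixes B :: "'a \<Rightarrow> 'b::real_inner"
  assumes p: "\<And>x. x \<in> S \<Longrightarrow> 0 \<le> p x" "sum p S = 1" and m: "0 < m" and b: "0 < b"
    and B: "\<And>x. x \<in> S \<Longrightarrow> (norm (B x))\<^sup>2 \<le> b"
  shows "iexp S p m (\<lambda>xs. norm ((1 / real m) *\<^sub>R sum_list (map B xs) - (\<Sum>x\<in>S. p x *\<^sub>R B x)))
    \<le> sqrt (b / real m)"
proof -
  define \<mu> where "\<mu> = (\<Sum>x\<in>S. p x *\<^sub>R B x)"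
  define Y where "Y x = B x - \<mu>" for x
  have Y0: "(\<Sum>x\<in>S. p x *\<^sub>R Y x) = 0"
    by (simp add: Y_def scaleR_diff_right sum_subtractf p(2) flip: \<mu>_def scaleR_left.sum)
  have sq: "(\<Sum>x\<in>S. p x * (norm (Y x))\<^sup>2) \<le> b"
  proof -
    have nY: "(norm (Y x))\<^sup>2 = (norm (B x))\<^sup>2 - 2 * inner \<mu> (B x) + (norm \<mu>)\<^sup>2" for x
      by (simp add: Y_def power2_norm_eq_inner inner_diff_left inner_diff_right inner_commute)
    have "(\<Sum>x\<in>S. p x * (norm (Y x))\<^sup>2) = (\<Sum>x\<in>S. p x * (norm (B x))\<^sup>2
        - 2 * (p x * inner \<mu> (B x)) + p x * (norm \<mu>)\<^sup>2)"
      unfolding nY by (intro sum.cong refl) (simp add: algebra_simps)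
    also have "\<dots> = (\<Sum>x\<in>S. p x * (norm (B x))\<^sup>2) - 2 * inner \<mu> \<mu> + (norm \<mu>)\<^sup>2"
      by (simp add: sum.distrib sum_subtractf p(2) inner_sum_right \<mu>_def
          flip: sum_distrib_left sum_distrib_right)
    also have "\<dots> \<le> (\<Sum>x\<in>S. p x * (norm (B x))\<^sup>2)"
      by (simp add: power2_norm_eq_inner)
    also have "\<dots> \<le> (\<Sum>x\<in>S. p x * b)"
      by (intro sum_mono mult_left_mono B p)
    also have "\<dots> = b" using p(2) by (simp flip: sum_distrib_right)
    finally show ?thesis .
  qed
  define c where "c = sqrt (b / real m)"
  have c: "0 < c" "c\<^sup>2 = b / real m" using b m by (auto simp: c_def)
  \<comment> \<open>A parabola above the line replaces Jensen's inequality: it is affine in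
    \<open>r^2\<close>, so linearity and monotonicity of \<open>iexp\<close> suffice, and it is an
    equality at \<open>r = c\<close>, so the constant is not worsened.\<close>
  have am: "r \<le> (1 / (2 * c)) * r\<^sup>2 + c / 2" for r :: real
  proof -
    have "0 \<le> (r - c)\<^sup>2" by simp
    then have "2 * c * r \<le> r\<^sup>2 + c\<^sup>2" by (simp add: power2_diff algebra_simps)
    then show ?thesis using c(1) by (simp add: field_simps power2_eq_square)
  qed
  have len: "(1 / real m) *\<^sub>R sum_list (map B xs) - \<mu> = (1 / real m) *\<^sub>R sum_list (map Y xs)"
    if "length xs = m" for xs
  proof -
    have "sum_list (map Y xs) = sum_list (map B xs) - real (length xs) *\<^sub>R \<mu>"
      by (induction xs) (auto simp: Y_def algebra_simps)
    then show ?thesis using that m by (simp add: scaleR_diff_right)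
  qed
  have "iexp S p m (\<lambda>xs. norm ((1 / real m) *\<^sub>R sum_list (map B xs) - \<mu>))
    \<le> iexp S p m (\<lambda>xs. (1 / (2 * c)) * ((1 / real m)\<^sup>2 * (norm (0 + sum_list (map Y xs)))\<^sup>2) + c / 2)"
  proof (rule iexp_mono[OF p(1)])
    fix xs :: "'a list" assume "length xs = m"
    then show "norm ((1 / real m) *\<^sub>R sum_list (map B xs) - \<mu>)
        \<le> (1 / (2 * c)) * ((1 / real m)\<^sup>2 * (norm (0 + sum_list (map Y xs)))\<^sup>2) + c / 2"
      unfolding len[OF \<open>length xs = m\<close>] using am[of "norm ((1 / real m) *\<^sub>R sum_list (map Y xs))"]
      by (simp add: power_mult_distrib power_divide)
  qed
  also have "\<dots> = (1 / (2 * c)) * ((1 / real m)\<^sup>2 * (real m * (\<Sum>x\<in>S. p x * (norm (Y x))\<^sup>2))) + c / 2"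
    unfolding iexp_add iexp_cmult iexp_norm_sq[OF p(2) Y0] iexp_const[OF p(2)] by simp
  also have "\<dots> \<le> (1 / (2 * c)) * ((1 / real m)\<^sup>2 * (real m * b)) + c / 2"
    using sq c(1) by (intro add_right_mono mult_left_mono) auto
  also have "(1 / real m)\<^sup>2 * (real m * b) = c\<^sup>2"
    unfolding c(2) using m by (simp add: power2_eq_square)
  also have "(1 / (2 * c)) * c\<^sup>2 + c / 2 = c" using c(1) by (simp add: power2_eq_square)
  finally show ?thesis by (simp add: c_def \<mu>_def)
qed

subsection \<open>Sequences\<close>

lemma seqs_0 [simp]: "seqs 0 = {[]}" by (auto simp: seqs_def)

lemma seqs_Suc: "seqs (Suc n) = (\<lambda>(x, xs). x # xs) ` (UNIV \<times> seqs n)"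
  by (auto simp: seqs_def length_Suc_conv image_iff)

lemma finite_seqs [simp]: "finite (seqs n :: 'x::finite list set)"
  by (induction n) (auto simp: seqs_Suc)

lemma card_seqs: "card (seqs n :: 'x::finite list set) = card (UNIV :: 'x set) ^ n"
proof (induction n)
  case (Suc n)
  have "inj_on (\<lambda>(x, xs). x # xs) (UNIV \<times> (seqs n :: 'x list set))"
    by (auto simp: inj_on_def)
  then show ?case by (simp add: seqs_Suc card_image card_cartesian_product Suc)
qed simp

lemma sum_seqs_Suc:
  "(\<Sum>xs\<in>seqs (Suc n). F xs) = (\<Sum>x\<in>(UNIV::'x::finite set). \<Sum>xs\<in>seqs n. F (x # xs))"
proof -
  have "inj_on (\<lambda>(x, xs). x # xs) (UNIV \<times> (seqs n :: 'x list set))"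
    by (auto simp: inj_on_def)
  then show ?thesis
    by (simp add: seqs_Suc sum.reindex sum.cartesian_product case_prod_unfold)
qed

lemma sum_seqs_prod:
  fixes p :: "'x::finite \<Rightarrow> real"
  shows "(\<Sum>xs\<in>seqs n. prod_list (map p xs) * F xs) = iexp UNIV p n F"
  by (induction n arbitrary: F) (simp_all add: sum_seqs_Suc mult.assoc flip: sum_distrib_left)

section \<open>Product functions on digits\<close>

text \<open>Eigenvalues of a tensor product: the index is read in base \<open>d\<close>, with the
  leading digit belonging to the first letter, which is the convention of
  \<open>kron_mat\<close>.\<close>

primrec ltens :: "nat \<Rightarrow> ('x \<Rightarrow> nat \<Rightarrow> real) \<Rightarrow> 'x list \<Rightarrow> nat \<Rightarrow> real" where
  "ltens d l [] i = 1"
| "ltens d l (x # xs) i = l x (i div d ^ length xs) * ltens d l xs (i mod d ^ length xs)"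

lemma sum_div_mod:
  fixes f :: "nat \<Rightarrow> nat \<Rightarrow> 'a::comm_monoid_add"
  shows "(\<Sum>i<a * b. f (i div b) (i mod b)) = (\<Sum>i<a. \<Sum>j<b. f i j)"
  unfolding sum.cartesian_product
proof (rule sum.reindex_bij_witness[where j = "\<lambda>i. (i div b, i mod b)" and i = "\<lambda>(i, j). i * b + j"])
  fix ij assume "ij \<in> {..<a} \<times> {..<b}"
  then obtain i j where ij: "ij = (i, j)" "i < a" "j < b" by auto
  have "i * b + j < Suc i * b" using ij by simp
  also have "\<dots> \<le> a * b" using ij by (intro mult_right_mono) auto
  finally show "(case ij of (i, j) \<Rightarrow> i * b + j) \<in> {..<a * b}" using ij by simp
  show "((case ij of (i, j) \<Rightarrow> i * b + j) div b, (case ij of (i, j) \<Rightarrow> i * b + j) mod b) = ij"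
    using ij by auto
next
  fix i assume "i \<in> {..<a * b}"
  then have "0 < b" "i < a * b" by (auto intro: gr0I)
  then show "(i div b, i mod b) \<in> {..<a} \<times> {..<b}"
    by (simp add: less_mult_imp_div_less)
qed auto

lemma digit_bounds:
  fixes i d :: nat
  assumes "i < d ^ length (x # xs)"
  shows "i div d ^ length xs < d" "i mod d ^ length xs < d ^ length xs"
proof -
  have i: "i < d * d ^ length xs" using assms by simp
  then show "i div d ^ length xs < d" by (simp add: less_mult_imp_div_less)
  show "i mod d ^ length xs < d ^ length xs" using i by (intro mod_less_divisor) (auto intro: gr0I)
qed

lemma sum_ltens: "(\<Sum>i<d ^ length xs. ltens d l xs i) = prod_list (map (\<lambda>x. \<Sum>j<d. l x j) xs)"
proof (induction xs)
  case (Cons x xs)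
  have "(\<Sum>i<d ^ length (x # xs). ltens d l (x # xs) i) =
      (\<Sum>i<d. \<Sum>j<d ^ length xs. l x i * ltens d l xs j)"
    using sum_div_mod[of "\<lambda>i j. l x i * ltens d l xs j" "d ^ length xs" d] by simp
  also have "\<dots> = (\<Sum>i<d. l x i) * (\<Sum>j<d ^ length xs. ltens d l xs j)"
    by (simp add: sum_product)
  finally show ?case using Cons by simp
qed simp

lemma ltens_nonneg:
  assumes "\<And>x j. x \<in> set xs \<Longrightarrow> j < d \<Longrightarrow> 0 \<le> l x j" "i < d ^ length xs"
  shows "0 \<le> ltens d l xs i"
  using assms
proof (induction xs arbitrary: i)
  case (Cons x xs)
  show ?case using digit_bounds[OF Cons.prems(2)] Cons by (auto intro!: mult_nonneg_nonneg)
qed simp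

lemma ltens_mult: "ltens d l xs i * ltens d m xs i = ltens d (\<lambda>x j. l x j * m x j) xs i"
  by (induction xs arbitrary: i) (auto simp: mult_ac)

lemma ltens_powr:
  assumes "\<And>x j. x \<in> set xs \<Longrightarrow> j < d \<Longrightarrow> 0 \<le> l x j" "i < d ^ length xs"
  shows "ltens d l xs i powr t = ltens d (\<lambda>x j. l x j powr t) xs i"
  using assms
proof (induction xs arbitrary: i)
  case (Cons x xs)
  have "0 \<le> ltens d l xs (i mod d ^ length xs)"
    using digit_bounds[OF Cons.prems(2)] Cons.prems(1) by (intro ltens_nonneg) auto
  then show ?case using digit_bounds[OF Cons.prems(2)] Cons by (auto simp: powr_mult)
qed simp

lemma ltens_zero:
  assumes "\<And>x j. x \<in> set xs \<Longrightarrow> j < d \<Longrightarrow> s j = 0 \<Longrightarrow> w x j = 0" "i < d ^ length xs"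
    and "ltens d (\<lambda>_. s) xs i = 0"
  shows "ltens d w xs i = 0"
  using assms
proof (induction xs arbitrary: i)
  case (Cons x xs)
  show ?case using digit_bounds[OF Cons.prems(2)] Cons by auto
qed simp

text \<open>Where an eigenvalue \<open>L\<close> exceeds \<open>a\<close>,
  \<open>L <= L (L / a)^t\<close>, and the resulting sum of powers factors over the letters. The
  value of \<open>t\<close> is settled by \<open>exponent_choice\<close>.\<close>

lemma tail_upper:
  assumes l: "\<And>x j. x \<in> set xs \<Longrightarrow> j < d \<Longrightarrow> 0 \<le> l x j" and a: "0 < a" and t: "0 \<le> t"
  shows "(\<Sum>i<d ^ length xs. if a < ltens d l xs i then ltens d l xs i else 0)
    \<le> a powr (- t) * prod_list (map (\<lambda>x. \<Sum>j<d. l x j powr (1 + t)) xs)"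
proof -
  have "(\<Sum>i<d ^ length xs. if a < ltens d l xs i then ltens d l xs i else 0)
    \<le> (\<Sum>i<d ^ length xs. a powr (- t) * ltens d (\<lambda>x j. l x j powr (1 + t)) xs i)"
  proof (rule sum_mono)
    fix i assume "i \<in> {..<d ^ length xs}"
    then have i: "i < d ^ length xs" by simp
    let ?L = "ltens d l xs i"
    have L0: "0 \<le> ?L" by (rule ltens_nonneg[OF l i])
    show "(if a < ?L then ?L else 0) \<le> a powr (- t) * ltens d (\<lambda>x j. l x j powr (1 + t)) xs i"
    proof -
      have pw: "ltens d (\<lambda>x j. l x j powr (1 + t)) xs i = ?L powr (1 + t)"
        by (rule ltens_powr[symmetric]) (use l i in auto)
      show ?thesis unfolding pw
    proof (cases "a < ?L")
      case True
      have "1 \<le> ?L powr t * a powr (- t)"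
        using powr_mono2[OF t, of a ?L] True a
        by (simp add: powr_minus field_simps)
      then have "?L * 1 \<le> ?L * (?L powr t * a powr (- t))" using L0 by (rule mult_left_mono)
      then show "(if a < ?L then ?L else 0) \<le> a powr (- t) * ?L powr (1 + t)"
        using True a by (simp add: powr_add mult_ac)
    qed (simp add: L0)
    qed
  qed
  then show ?thesis by (simp add: sum_ltens flip: sum_distrib_left)
qed

lemma tail_lower:
  assumes l: "\<And>x j. x \<in> set xs \<Longrightarrow> j < d \<Longrightarrow> 0 \<le> l x j" and a: "0 < a" and t: "0 \<le> t"
  shows "(\<Sum>i<d ^ length xs. if ltens d l xs i < a then ltens d l xs i else 0)
    \<le> a powr t * prod_list (map (\<lambda>x. \<Sum>j<d. l x j powr (1 - t)) xs)"
proof -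
  have "(\<Sum>i<d ^ length xs. if ltens d l xs i < a then ltens d l xs i else 0)
    \<le> (\<Sum>i<d ^ length xs. a powr t * ltens d (\<lambda>x j. l x j powr (1 - t)) xs i)"
  proof (rule sum_mono)
    fix i assume "i \<in> {..<d ^ length xs}"
    then have i: "i < d ^ length xs" by simp
    let ?L = "ltens d l xs i"
    have L0: "0 \<le> ?L" by (rule ltens_nonneg[OF l i])
    show "(if ?L < a then ?L else 0) \<le> a powr t * ltens d (\<lambda>x j. l x j powr (1 - t)) xs i"
    proof -
      have pw: "ltens d (\<lambda>x j. l x j powr (1 - t)) xs i = ?L powr (1 - t)"
        by (rule ltens_powr[symmetric]) (use l i in auto)
      show ?thesis unfolding pw
    proof (cases "?L < a \<and> 0 < ?L")
      case True
      then have "1 \<le> a powr t / ?L powr t"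
        using powr_mono2[OF t, of ?L a] by (simp add: field_simps)
      then have "?L * 1 \<le> ?L * (a powr t / ?L powr t)" using L0 by (rule mult_left_mono)
      then show "(if ?L < a then ?L else 0) \<le> a powr t * ?L powr (1 - t)"
        using True by (simp add: powr_diff mult_ac)
    qed (use L0 in auto)
    qed
  qed
  then show ?thesis by (simp add: sum_ltens flip: sum_distrib_left)
qed

text \<open>Here \<open>w\<close> stands for the diagonal of one state in the eigenbasis of another
  with eigenvalues \<open>s\<close>: the weight is taken from the first, the cut-off from the
  second. As \<open>0 powr (- t) = 0\<close>, the bound could fail at a zero of the second unless
  the first vanishes there as well.\<close>

lemma tail_cross:
  assumes w: "\<And>x j. x \<in> set xs \<Longrightarrow> j < d \<Longrightarrow> 0 \<le> w x j" and s: "\<And>j. j < d \<Longrightarrow> 0 \<le> s j"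
    and ws: "\<And>x j. x \<in> set xs \<Longrightarrow> j < d \<Longrightarrow> s j = 0 \<Longrightarrow> w x j = 0"
    and b: "0 < b" and t: "0 \<le> t"
  shows "(\<Sum>i<d ^ length xs. if b \<le> ltens d (\<lambda>_. s) xs i then 0 else ltens d w xs i)
    \<le> b powr t * prod_list (map (\<lambda>x. \<Sum>j<d. w x j * s j powr (- t)) xs)"
proof -
  have "(\<Sum>i<d ^ length xs. if b \<le> ltens d (\<lambda>_. s) xs i then 0 else ltens d w xs i)
    \<le> (\<Sum>i<d ^ length xs. b powr t * ltens d (\<lambda>x j. w x j * s j powr (- t)) xs i)"
  proof (rule sum_mono)
    fix i assume "i \<in> {..<d ^ length xs}"
    then have i: "i < d ^ length xs" by simp
    let ?S = "ltens d (\<lambda>_. s) xs i" and ?w = "ltens d w xs i"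
    have w0: "0 \<le> ?w" by (rule ltens_nonneg[OF w i])
    have S0: "0 \<le> ?S" by (rule ltens_nonneg[OF s i])
    have Sp: "ltens d (\<lambda>x j. w x j * s j powr (- t)) xs i = ?w * ?S powr (- t)"
      using ltens_powr[of xs d "\<lambda>_. s" i "- t"] s i by (simp add: ltens_mult)
    show "(if b \<le> ?S then 0 else ?w) \<le> b powr t * ltens d (\<lambda>x j. w x j * s j powr (- t)) xs i"
      unfolding Sp
    proof (cases "?S = 0")
      case True
      then show "(if b \<le> ?S then 0 else ?w) \<le> b powr t * (?w * ?S powr (- t))"
        using ltens_zero[OF ws i True] by auto
    next
      case False
      then have S: "0 < ?S" using S0 by simp
      show "(if b \<le> ?S then 0 else ?w) \<le> b powr t * (?w * ?S powr (- t))"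
      proof (cases "b \<le> ?S")
        case False
        then have "1 \<le> b powr t * ?S powr (- t)"
          using powr_mono2[OF t, of ?S b] S by (simp add: powr_minus field_simps)
        then have "?w * 1 \<le> ?w * (b powr t * ?S powr (- t))" using w0 by (rule mult_left_mono)
        then show ?thesis using False by (simp add: mult_ac)
      qed (simp add: w0)
    qed
  qed
  then show ?thesis by (simp add: sum_ltens flip: sum_distrib_left)
qed

subsection \<open>Second-order expansion of Renyi sums\<close>

text \<open>With \<open>u = t * ln s\<close>, the bound \<open>exp u <= 1 + u + u^2 exp |u|\<close>
  leaves the remainder \<open>s u^2 exp |u|\<close>. It is controlled uniformly in \<open>s\<close>
  because the factor \<open>s\<close> beats both the logarithm and \<open>exp |u|\<close> when
  \<open>|t| <= 1/2\<close>.\<close>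

lemma powr_second_order:
  fixes s t :: real
  assumes s: "0 \<le> s" "s \<le> 1" and t: "\<bar>t\<bar> \<le> 1 / 2"
  shows "s powr (1 + t) \<le> s + t * (s * ln s) + 16 * t\<^sup>2"
proof (cases "s = 0")
  case False
  then have s0: "0 < s" using s by simp
  define u where "u = t * ln s"
  have e1: "exp u - 1 \<le> u * exp u"
    using exp_ge_add_one_self[of "- u"] by (simp add: exp_minus field_simps)
  have eu: "exp u \<le> 1 + u + u\<^sup>2 * exp \<bar>u\<bar>"
  proof (cases "0 \<le> u")
    case True
    have "u * (exp u - 1) \<le> u * (u * exp u)" using e1 True by (rule mult_left_mono)
    then show ?thesis using e1 True by (simp add: algebra_simps power2_eq_square)
  next
    case False
    have "u \<le> exp u - 1" using exp_ge_add_one_self[of u] by linarith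
    then have "u * (exp u - 1) \<le> u * u" using False by (intro mult_left_mono_neg) auto
    moreover have "u * u * 1 \<le> u * u * exp \<bar>u\<bar>" by (intro mult_left_mono) auto
    ultimately show ?thesis using e1 by (simp add: algebra_simps power2_eq_square)
  qed
  \<comment> \<open>The quarter gives \<open>|u| <= 2 y\<close> and
    \<open>s exp |u| <= exp (- 2 y)\<close>, while \<open>u^2 = 16 t^2 y^2\<close>; together with
    \<open>y exp (- y) <= 1\<close> this is the origin of 16.\<close>
  define y where "y = - ln s / 4"
  have y0: "0 \<le> y" using s s0 by (simp add: y_def)
  have sy: "s = exp (- (4 * y))" using s0 by (simp add: y_def)
  have "\<bar>u\<bar> \<le> 2 * y"
  proof -
    have "\<bar>u\<bar> = \<bar>t\<bar> * \<bar>ln s\<bar>" by (simp add: u_def abs_mult)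
    also have "\<dots> \<le> 1 / 2 * \<bar>ln s\<bar>" using t by (intro mult_right_mono) auto
    also have "\<bar>ln s\<bar> = 4 * y" using y0 by (simp add: y_def)
    finally show ?thesis by simp
  qed
  then have "s * exp \<bar>u\<bar> \<le> exp (- (4 * y)) * exp (2 * y)" by (simp add: sy)
  also have "\<dots> = (exp (- y))\<^sup>2" by (simp add: power2_eq_square flip: exp_add)
  finally have se: "s * exp \<bar>u\<bar> \<le> (exp (- y))\<^sup>2" .
  have "y * exp (- y) \<le> 1"
  proof -
    have "y \<le> exp y" using exp_ge_add_one_self[of y] by linarith
    then show ?thesis by (simp add: exp_minus field_simps)
  qed
  then have "(y * exp (- y))\<^sup>2 \<le> 1" using y0 by (simp add: abs_le_square_iff power_le_one_iff)
  moreover have "s * (u\<^sup>2 * exp \<bar>u\<bar>) \<le> 16 * t\<^sup>2 * (y * exp (- y))\<^sup>2"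
  proof -
    have "s * (u\<^sup>2 * exp \<bar>u\<bar>) = u\<^sup>2 * (s * exp \<bar>u\<bar>)" by simp
    also have "\<dots> \<le> u\<^sup>2 * (exp (- y))\<^sup>2" using se by (rule mult_left_mono) simp
    also have "\<dots> = 16 * t\<^sup>2 * (y * exp (- y))\<^sup>2"
      by (simp add: u_def y_def power_mult_distrib power_divide)
    finally show ?thesis .
  qed
  ultimately have r: "s * (u\<^sup>2 * exp \<bar>u\<bar>) \<le> 16 * t\<^sup>2"
    using mult_left_mono[of "(y * exp (- y))\<^sup>2" 1 "16 * t\<^sup>2"] by simp
  have "s powr (1 + t) = s * exp u" using s0 by (simp add: powr_def u_def distrib_right exp_add)
  also have "\<dots> \<le> s * (1 + u + u\<^sup>2 * exp \<bar>u\<bar>)" using eu s0 by (intro mult_left_mono) auto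
  also have "\<dots> = s + t * (s * ln s) + s * (u\<^sup>2 * exp \<bar>u\<bar>)" by (simp add: u_def algebra_simps)
  finally show ?thesis using r by simp
qed simp

text \<open>The linear coefficient is minus the entropy in nats and the remainder depends only on
  \<open>d\<close> and \<open>t\<close>; hence one \<open>t\<close> serves all states and all
  types.\<close>

lemma sum_powr_second_order:
  assumes l: "\<And>j. j < d \<Longrightarrow> 0 \<le> l j" "(\<Sum>j<d. l j) = 1" and t: "\<bar>t\<bar> \<le> 1 / 2"
  shows "(\<Sum>j<d. l j powr (1 + t)) \<le> 1 + t * (\<Sum>j<d. l j * ln (l j)) + 16 * real d * t\<^sup>2"
proof -
  have l1: "l j \<le> 1" if "j < d" for j
    using member_le_sum[of j "{..<d}" l] l that by auto
  have "(\<Sum>j<d. l j powr (1 + t)) \<le> (\<Sum>j<d. l j + t * (l j * ln (l j)) + 16 * t\<^sup>2)"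
    by (intro sum_mono powr_second_order t) (auto simp: l l1)
  also have "\<dots> = 1 + t * (\<Sum>j<d. l j * ln (l j)) + 16 * real d * t\<^sup>2"
    by (simp add: sum.distrib l(2) sum_distrib_left)
  finally show ?thesis .
qed

lemma prod_list_le_exp:
  fixes g h :: "'a \<Rightarrow> real"
  assumes "\<And>x. x \<in> set xs \<Longrightarrow> 0 \<le> g x" "\<And>x. x \<in> set xs \<Longrightarrow> g x \<le> 1 + h x"
  shows "prod_list (map g xs) \<le> exp (sum_list (map h xs))" "0 \<le> prod_list (map g xs)"
proof -
  have "0 \<le> prod_list (map g xs) \<and> prod_list (map g xs) \<le> exp (sum_list (map h xs))"
    using assms
  proof (induction xs)
    case (Cons x xs)
    have "g x \<le> exp (h x)" using order_trans[OF Cons.prems(2) exp_ge_add_one_self] by simp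
    then show ?case using Cons by (auto simp: exp_add intro!: mult_mono)
  qed simp
  then show "prod_list (map g xs) \<le> exp (sum_list (map h xs))" "0 \<le> prod_list (map g xs)" by auto
qed

section \<open>Tensor products\<close>

lemma kron_carrier: "A \<in> carrier_mat m m \<Longrightarrow> B \<in> carrier_mat k k \<Longrightarrow> kron_mat A B \<in> carrier_mat (m * k) (m * k)"
  by (simp add: kron_mat_def)

lemma kron_index:
  assumes "A \<in> carrier_mat m m" "B \<in> carrier_mat k k" "i < m * k" "j < m * k"
  shows "kron_mat A B $$ (i, j) = A $$ (i div k, j div k) * B $$ (i mod k, j mod k)"
  using assms by (simp add: kron_mat_def)

lemma div_mod_bounds:
  fixes i m k :: nat
  assumes "i < m * k"
  shows "i div k < m" "i mod k < k"
proof -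
  show "i div k < m" using assms by (simp add: less_mult_imp_div_less)
  show "i mod k < k" using assms by (intro mod_less_divisor) (auto intro: gr0I)
qed

lemma kron_mult:
  assumes A: "A \<in> carrier_mat m m" and C: "C \<in> carrier_mat m m"
    and B: "B \<in> carrier_mat k k" and D: "D \<in> carrier_mat k k"
  shows "kron_mat A B * kron_mat C D = kron_mat (A * C) (B * D)"
proof (rule eq_matI)
  have AC: "A * C \<in> carrier_mat m m" and BD: "B * D \<in> carrier_mat k k" using assms by auto
  note kAB = kron_carrier[OF A B] and kCD = kron_carrier[OF C D] and kk = kron_carrier[OF AC BD]
  show "dim_row (kron_mat A B * kron_mat C D) = dim_row (kron_mat (A * C) (B * D))"
    "dim_col (kron_mat A B * kron_mat C D) = dim_col (kron_mat (A * C) (B * D))"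
    using kAB kCD kk by auto
  fix i j assume "i < dim_row (kron_mat (A * C) (B * D))" "j < dim_col (kron_mat (A * C) (B * D))"
  then have i: "i < m * k" and j: "j < m * k" using kk by auto
  note bi = div_mod_bounds[OF i] and bj = div_mod_bounds[OF j]
  have "(kron_mat A B * kron_mat C D) $$ (i, j) = (\<Sum>r<m * k. kron_mat A B $$ (i, r) * kron_mat C D $$ (r, j))"
    using kAB kCD i j by (simp add: scalar_prod_def atLeast0LessThan)
  also have "\<dots> = (\<Sum>r<m * k. (A $$ (i div k, r div k) * C $$ (r div k, j div k))
      * (B $$ (i mod k, r mod k) * D $$ (r mod k, j mod k)))"
    by (intro sum.cong refl) (simp add: kron_index[OF A B i] kron_index[OF C D _ j])
  also have "\<dots> = (\<Sum>a<m. \<Sum>b<k. (A $$ (i div k, a) * C $$ (a, j div k))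
      * (B $$ (i mod k, b) * D $$ (b, j mod k)))"
    by (rule sum_div_mod[where f = "\<lambda>a b. (A $$ (i div k, a) * C $$ (a, j div k))
      * (B $$ (i mod k, b) * D $$ (b, j mod k))"])
  also have "\<dots> = (A * C) $$ (i div k, j div k) * (B * D) $$ (i mod k, j mod k)"
    using A B C D bi bj by (simp add: scalar_prod_def atLeast0LessThan sum_product)
  also have "\<dots> = kron_mat (A * C) (B * D) $$ (i, j)" by (simp add: kron_index[OF AC BD i j])
  finally show "(kron_mat A B * kron_mat C D) $$ (i, j) = kron_mat (A * C) (B * D) $$ (i, j)" .
qed

lemma kron_adj:
  assumes A: "A \<in> carrier_mat m m" and B: "B \<in> carrier_mat k k"
  shows "adj_mat (kron_mat A B) = kron_mat (adj_mat A) (adj_mat B)"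
proof (rule eq_matI)
  note kAB = kron_carrier[OF A B]
  note kk = kron_carrier[OF adj_mat_carrier[OF A] adj_mat_carrier[OF B]]
  show "dim_row (adj_mat (kron_mat A B)) = dim_row (kron_mat (adj_mat A) (adj_mat B))"
    "dim_col (adj_mat (kron_mat A B)) = dim_col (kron_mat (adj_mat A) (adj_mat B))"
    using adj_mat_carrier[OF kAB] kk by auto
  fix i j assume "i < dim_row (kron_mat (adj_mat A) (adj_mat B))" "j < dim_col (kron_mat (adj_mat A) (adj_mat B))"
  then have i: "i < m * k" and j: "j < m * k" using kk by auto
  note bi = div_mod_bounds[OF i] and bj = div_mod_bounds[OF j]
  have "adj_mat (kron_mat A B) $$ (i, j) = cnj (kron_mat A B $$ (j, i))"
    using kAB i j by (simp add: adj_mat_def)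
  also have "\<dots> = adj_mat A $$ (i div k, j div k) * adj_mat B $$ (i mod k, j mod k)"
    using A B bi bj by (simp add: kron_index[OF A B j i] adj_mat_def)
  also have "\<dots> = kron_mat (adj_mat A) (adj_mat B) $$ (i, j)"
    by (simp add: kron_index[OF adj_mat_carrier[OF A] adj_mat_carrier[OF B] i j])
  finally show "adj_mat (kron_mat A B) $$ (i, j) = kron_mat (adj_mat A) (adj_mat B) $$ (i, j)" .
qed

lemma tensor_channel_simps [simp]:
  "tensor_channel W [] = 1\<^sub>m 1" "tensor_channel W (x # xs) = kron_mat (W x) (tensor_channel W xs)"
  by (simp_all add: tensor_channel_def)

lemma tensor_carrier:
  assumes "\<And>x. x \<in> set xs \<Longrightarrow> A x \<in> carrier_mat d d"
  shows "tensor_channel A xs \<in> carrier_mat (d ^ length xs) (d ^ length xs)"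
  using assms by (induction xs) (auto intro!: kron_carrier)

lemma tensor_mult:
  assumes "\<And>x. A x \<in> carrier_mat d d" "\<And>x. B x \<in> carrier_mat d d"
  shows "tensor_channel A xs * tensor_channel B xs = tensor_channel (\<lambda>x. A x * B x) xs"
proof (induction xs)
  case (Cons x xs)
  have "tensor_channel A xs \<in> carrier_mat (d ^ length xs) (d ^ length xs)"
    "tensor_channel B xs \<in> carrier_mat (d ^ length xs) (d ^ length xs)"
    by (auto intro!: tensor_carrier assms)
  then show ?case using kron_mult[OF assms(1)[of x] assms(2)[of x]] Cons by simp
qed simp

lemma tensor_adj:
  assumes "\<And>x. A x \<in> carrier_mat d d"
  shows "adj_mat (tensor_channel A xs) = tensor_channel (\<lambda>x. adj_mat (A x)) xs"
proof (induction xs)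
  case Nil
  show ?case by (rule eq_matI) (auto simp: adj_mat_def)
next
  case (Cons x xs)
  have "tensor_channel A xs \<in> carrier_mat (d ^ length xs) (d ^ length xs)"
    by (auto intro!: tensor_carrier assms)
  then show ?case using kron_adj[OF assms[of x]] Cons by simp
qed

lemma tensor_rdiag:
  "tensor_channel (\<lambda>x. rdiag_mat d (l x)) xs = rdiag_mat (d ^ length xs) (ltens d l xs)"
proof (induction xs)
  case Nil
  show ?case by (rule eq_matI) (auto simp: rdiag_mat_def)
next
  case (Cons x xs)
  let ?k = "d ^ length xs"
  have kc: "kron_mat (rdiag_mat d (l x)) (rdiag_mat ?k (ltens d l xs)) \<in> carrier_mat (d * ?k) (d * ?k)"
    by (intro kron_carrier rdiag_mat_carrier)
  have "kron_mat (rdiag_mat d (l x)) (rdiag_mat ?k (ltens d l xs)) = rdiag_mat (d * ?k) (ltens d l (x # xs))"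
  proof (rule eq_matI)
    fix i j assume "i < dim_row (rdiag_mat (d * ?k) (ltens d l (x # xs)))"
      "j < dim_col (rdiag_mat (d * ?k) (ltens d l (x # xs)))"
    then have i: "i < d * ?k" and j: "j < d * ?k" by (auto simp: rdiag_mat_def)
    have eq: "i = j \<longleftrightarrow> i div ?k = j div ?k \<and> i mod ?k = j mod ?k"
      by (metis div_mult_mod_eq)
    show "kron_mat (rdiag_mat d (l x)) (rdiag_mat ?k (ltens d l xs)) $$ (i, j)
        = rdiag_mat (d * ?k) (ltens d l (x # xs)) $$ (i, j)"
      unfolding kron_index[OF rdiag_mat_carrier rdiag_mat_carrier i j]
      using i j div_mod_bounds[OF i] div_mod_bounds[OF j] eq by (auto simp: rdiag_mat_def)
  qed (use kc in \<open>auto simp: rdiag_mat_def\<close>)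
  then show ?case using Cons by (simp only: tensor_channel_simps length_Cons power_Suc)
qed

lemma rdiag_one: "rdiag_mat d (\<lambda>_. 1) = 1\<^sub>m d"
  by (rule eq_matI) (auto simp: rdiag_mat_def)

lemma tensor_one: "tensor_channel (\<lambda>_. 1\<^sub>m d) xs = 1\<^sub>m (d ^ length xs)"
proof -
  have "ltens d (\<lambda>_ _. 1) xs i = 1" for i by (induction xs arbitrary: i) auto
  then have "ltens d (\<lambda>_ _. 1) xs = (\<lambda>_. 1)" by auto
  then show ?thesis using tensor_rdiag[of d "\<lambda>_ _. 1" xs] by (simp add: rdiag_one)
qed

lemma tensor_unitary:
  assumes "\<And>x. unitary_mat d (U x)"
  shows "unitary_mat (d ^ length xs) (tensor_channel U xs)"
proof -
  have U: "\<And>x. U x \<in> carrier_mat d d" using assms by (simp add: unitary_mat_def)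
  then have aU: "\<And>x. adj_mat (U x) \<in> carrier_mat d d" by (rule adj_mat_carrier)
  show ?thesis
    using assms U aU tensor_carrier[of xs U d]
    by (simp add: unitary_mat_def tensor_adj[of U d] tensor_mult[of _ d] tensor_one)
qed

lemma tensor_fc:
  assumes U: "\<And>x. unitary_mat d (U x)" and W: "\<And>x. W x = U x * rdiag_mat d (l x) * adj_mat (U x)"
  shows "uni (d ^ length xs) (op (tensor_channel U xs))"
    "op (tensor_channel W xs) = fc (d ^ length xs) (op (tensor_channel U xs)) (ltens d l xs)"
proof -
  have u: "unitary_mat (d ^ length xs) (tensor_channel U xs)" by (rule tensor_unitary[OF U])
  then show "uni (d ^ length xs) (op (tensor_channel U xs))" by (rule uni_op)
  have Uc: "\<And>x. U x \<in> carrier_mat d d" using U by (simp add: unitary_mat_def)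
  have "tensor_channel W xs = tensor_channel (\<lambda>x. U x * rdiag_mat d (l x) * adj_mat (U x)) xs"
    using W by (metis ext)
  also have "\<dots> = tensor_channel U xs * rdiag_mat (d ^ length xs) (ltens d l xs) * adj_mat (tensor_channel U xs)"
    by (simp add: tensor_adj[of U d] tensor_mult[of _ d] Uc adj_mat_carrier rdiag_mat_carrier
        mult_carrier_mat[of _ d d] flip: tensor_rdiag)
  finally show "op (tensor_channel W xs) = fc (d ^ length xs) (op (tensor_channel U xs)) (ltens d l xs)"
    by (simp add: op_fc[OF u])
qed

lemma tensor_diag:
  assumes "\<And>x. A x \<in> carrier_mat d d"
    and "\<And>x j. j < d \<Longrightarrow> A x $$ (j, j) = complex_of_real (w x j)"
    and "i < d ^ length xs"
  shows "tensor_channel A xs $$ (i, i) = complex_of_real (ltens d w xs i)"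
  using assms(3)
proof (induction xs arbitrary: i)
  case (Cons x xs)
  have i: "i < d * d ^ length xs" using Cons.prems by simp
  show ?case
    using Cons.IH[OF div_mod_bounds(2)[OF i]] assms(2)[OF div_mod_bounds(1)[OF i]]
    by (simp add: kron_index[OF assms(1) tensor_carrier[OF assms(1)] i i])
qed simp

text \<open>\<open>zs\<close> only carries a length, and the recursion on it peels off one tensor
  factor. An i.i.d. input thus yields the tensor power of the average state.\<close>

lemma tensor_mixture:
  fixes W :: "'x::finite \<Rightarrow> complex mat"
  assumes "\<And>x. W x \<in> carrier_mat d d"
  shows "mixture (d ^ length zs) (seqs (length zs)) (tensor_channel W) (\<lambda>xs. prod_list (map p xs))
    = tensor_channel (\<lambda>_. mixture d UNIV W p) zs"
proof (induction zs)
  case Nil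
  show ?case by (rule eq_matI) (auto simp: mixture_def)
next
  case (Cons z zs)
  let ?k = "d ^ length zs" and ?s = "mixture d UNIV W p" and ?pn = "\<lambda>xs. prod_list (map p xs)"
  have Tc: "tensor_channel W xs \<in> carrier_mat ?k ?k" if "xs \<in> seqs (length zs)" for xs
    using tensor_carrier[of xs W d] assms that by (simp add: seqs_def)
  have sc: "?s \<in> carrier_mat d d" and tc: "tensor_channel (\<lambda>_. ?s) zs \<in> carrier_mat ?k ?k"
    by (auto intro!: tensor_carrier mixture_carrier)
  show ?case
  proof (rule eq_matI)
    fix i j assume "i < dim_row (tensor_channel (\<lambda>_. ?s) (z # zs))" "j < dim_col (tensor_channel (\<lambda>_. ?s) (z # zs))"
    then have i: "i < d * ?k" and j: "j < d * ?k" using kron_carrier[OF sc tc] by auto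
    note b = div_mod_bounds[OF i] div_mod_bounds[OF j]
    have "mixture (d ^ length (z # zs)) (seqs (length (z # zs))) (tensor_channel W) ?pn $$ (i, j)
      = (\<Sum>x\<in>UNIV. \<Sum>xs\<in>seqs (length zs). complex_of_real (p x * ?pn xs) *
          kron_mat (W x) (tensor_channel W xs) $$ (i, j))"
      using i j by (simp add: mixture_def sum_seqs_Suc)
    also have "\<dots> = (\<Sum>x\<in>UNIV. \<Sum>xs\<in>seqs (length zs). (complex_of_real (p x) * W x $$ (i div ?k, j div ?k))
        * (complex_of_real (?pn xs) * tensor_channel W xs $$ (i mod ?k, j mod ?k)))"
      by (intro sum.cong refl) (simp add: kron_index[OF assms Tc i j])
    also have "\<dots> = ?s $$ (i div ?k, j div ?k) *
        mixture ?k (seqs (length zs)) (tensor_channel W) ?pn $$ (i mod ?k, j mod ?k)"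
      using b by (simp add: mixture_def sum_product)
    also have "\<dots> = tensor_channel (\<lambda>_. ?s) (z # zs) $$ (i, j)"
      by (simp add: Cons kron_index[OF sc tc i j])
    finally show "mixture (d ^ length (z # zs)) (seqs (length (z # zs))) (tensor_channel W) ?pn $$ (i, j)
      = tensor_channel (\<lambda>_. ?s) (z # zs) $$ (i, j)" .
  qed (use kron_carrier[OF sc tc] in \<open>auto simp: mixture_def\<close>)
qed

text \<open>Against a matrix diagonal in the basis \<open>v\<close>, the trace only sees the
  diagonal of \<open>A\<close> in that basis, so noncommuting pairs reduce to ordinary sums.\<close>

lemma rtr_mult_fc:
  assumes "uni D v" "car D A"
  shows "rtr (A * fc D v g) = (\<Sum>j<D. g j * Re (ent (adj v * A * v) j j))"
proof -
  have v: "car D v" using assms(1) by (simp add: uni_def)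
  have c: "car D (adj v * A * v)" by (intro car_times car_adj v assms(2))
  have "rtr (A * fc D v g) = rtr (adj v * (A * (v * dg D g)))"
    using rtr_comm[of "A * (v * dg D g)" "adj v"] by (simp add: fc_def mult.assoc)
  also have "\<dots> = rtr (dg D g * (adj v * A * v))"
    using rtr_comm[of "adj v * A * v" "dg D g"] by (simp add: mult.assoc)
  also have "\<dots> = (\<Sum>j<D. g j * Re (ent (adj v * A * v) j j))"
    by (simp add: rtr_car[of D] car_times car_dg c ent_dg_mult)
  finally show ?thesis .
qed

section \<open>Density matrices\<close>

lemma density_matD: "density_mat d A \<Longrightarrow> A \<in> carrier_mat d d" "density_mat d A \<Longrightarrow> hermitian_mat d A"
  "density_mat d A \<Longrightarrow> psd_mat d A" "density_mat d A \<Longrightarrow> rtr (op A) = 1"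
  using rtr_op[of A d] by (auto simp: density_mat_def psd_mat_def hermitian_mat_def)

lemma psd_diag:
  assumes "psd_mat d A" "V \<in> carrier_mat d d" "j < d"
  shows "(adj_mat V * A * V) $$ (j, j) = complex_of_real (Re ((adj_mat V * A * V) $$ (j, j)))"
    "0 \<le> Re ((adj_mat V * A * V) $$ (j, j))"
proof -
  have A: "A \<in> carrier_mat d d" "adj_mat A = A" using assms(1) by (auto simp: psd_mat_def hermitian_mat_def)
  note aV = adj_mat_carrier[OF assms(2)]
  let ?M = "adj_mat V * A * V"
  have M: "?M \<in> carrier_mat d d" using A aV assms(2) by auto
  have "op (adj_mat ?M) = op ?M"
    using A aV assms(2) M by (simp add: op_adj op_mult[of _ d] mult.assoc) (metis A(2) op_adj)
  then have "adj_mat ?M = ?M" using op_inj[OF adj_mat_carrier[OF M] M] by simp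
  then have "cnj (?M $$ (j, j)) = ?M $$ (j, j)"
    using M assms(3) by (metis adj_mat_def carrier_matD case_prod_conv index_mat(1))
  then show "?M $$ (j, j) = complex_of_real (Re (?M $$ (j, j)))" by (simp add: complex_eq_iff)
  have "?M = adj_mat V * (A * V)" using A aV assms(2) by simp
  then have "?M $$ (j, j) = row (adj_mat V) j \<bullet> col (A * V) j"
    using A aV assms(2,3) by simp
  also have "row (adj_mat V) j = map_vec cnj (col V j)"
    using assms(2,3) by (intro eq_vecI) (auto simp: adj_mat_def)
  also have "col (A * V) j = A *\<^sub>v col V j"
    using A(1) assms(2,3) by (intro eq_vecI) auto
  finally have "?M $$ (j, j) = scalar_prod (map_vec cnj (col V j)) (A *\<^sub>v col V j)" .
  moreover have "col V j \<in> carrier_vec d" using assms(2) by auto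
  ultimately show "0 \<le> Re (?M $$ (j, j))" using assms(1) by (simp add: psd_mat_def)
qed

lemma fc_diag: assumes "uni D u" shows "adj u * fc D u l * u = dg D l"
proof -
  have "adj u * fc D u l * u = (adj u * u) * dg D l * (adj u * u)" by (simp add: fc_def mult.assoc)
  then show ?thesis using assms by (simp add: uni_def one_left one_right car_dg)
qed

text \<open>The decomposition is the one chosen for \<open>log2_supp\<close>, so state and logarithm
  are diagonal together; a zero eigenvalue contributes 0 to both sides of the entropy
  formula.\<close>

lemma density_decomp:
  assumes "density_mat d A"
  obtains U l where "unitary_mat d U" "A = U * rdiag_mat d l * adj_mat U"
    "\<And>j. j < d \<Longrightarrow> 0 \<le> l j" "(\<Sum>j<d. l j) = 1" "mlog2 A \<in> carrier_mat d d"
    "rtr (op A * op (mlog2 A)) = (\<Sum>j<d. l j * ln (l j)) / ln 2"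
proof -
  obtain U l where U: "unitary_mat d U" "A = U * rdiag_mat d l * adj_mat U"
    "mlog2 A = U * rdiag_mat d (\<lambda>i. log2_supp (l i)) * adj_mat U"
    using herm_fun_decomp[OF density_matD(2)[OF assms], of log2_supp] unfolding mlog2_def by blast
  have Uc: "U \<in> carrier_mat d d" using U(1) by (rule unitary_matD)
  have u: "uni d (op U)" using U(1) by (rule uni_op)
  have A: "op A = fc d (op U) l" by (subst U(2)) (rule op_fc[OF U(1)])
  have L: "op (mlog2 A) = fc d (op U) (\<lambda>i. log2_supp (l i))" by (subst U(3)) (rule op_fc[OF U(1)])
  have Ac: "A \<in> carrier_mat d d" using assms by (rule density_matD)
  have l0: "0 \<le> l j" if "j < d" for j
  proof -
    define M where "M = adj_mat U * A * U"
    have M: "M \<in> carrier_mat d d"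
      using Uc Ac adj_mat_carrier[OF Uc] by (auto simp: M_def)
    have "op M = dg d l"
      using Uc Ac adj_mat_carrier[OF Uc]
      by (simp add: M_def op_mult[of _ d] op_adj A fc_diag[OF u, unfolded mult.assoc])
    then have "ent (op M) j j = ent (dg d l) j j" by (simp only:)
    then have "M $$ (j, j) = complex_of_real (l j)"
      using that M by (simp add: ent_op ent_dg)
    then show ?thesis using psd_diag(2)[OF density_matD(3)[OF assms] Uc that] by (simp flip: M_def)
  qed
  have s1: "(\<Sum>j<d. l j) = 1"
    using density_matD(4)[OF assms] by (simp add: A rtr_fc[OF u])
  have ent: "rtr (op A * op (mlog2 A)) = (\<Sum>j<d. l j * ln (l j)) / ln 2"
    unfolding A L fc_mult[OF u] rtr_fc[OF u] sum_divide_distrib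
    by (rule sum.cong) (use l0 in \<open>auto simp: log2_supp_def log_def not_less intro: antisym\<close>)
  have c: "mlog2 A \<in> carrier_mat d d"
    unfolding U(3) using Uc by (auto simp: rdiag_mat_def adj_mat_def)
  show ?thesis by (rule that[OF U(1,2) l0 s1 c ent])
qed

lemma mixture_density:
  assumes W: "\<And>x. x \<in> S \<Longrightarrow> density_mat d (W x)" and p: "distr_on S p"
  shows "density_mat d (mixture d S W p)"
proof -
  let ?M = "mixture d S W p"
  have Wc: "\<And>x. x \<in> S \<Longrightarrow> W x \<in> carrier_mat d d" using W density_matD(1) by blast
  have M: "?M \<in> carrier_mat d d" by (rule mixture_carrier)
  have opM: "op ?M = (\<Sum>x\<in>S. p x *\<^sub>R op (W x))" by (rule op_mixture[OF Wc])
  have adjW: "adj (op (W x)) = op (W x)" if "x \<in> S" for x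
    using density_matD(2)[OF W[OF that]] unfolding hermitian_mat_def by (metis op_adj)
  have "op (adj_mat ?M) = op ?M" by (simp add: op_adj opM adjW)
  then have herm: "adj_mat ?M = ?M" using op_inj[OF adj_mat_carrier[OF M] M] by simp
  have form: "Re (scalar_prod (map_vec cnj v) (A *\<^sub>v v)) = (\<Sum>i<d. \<Sum>j<d. Re (cnj (v $ i) * (A $$ (i, j) * v $ j)))"
    if "v \<in> carrier_vec d" "A \<in> carrier_mat d d" for v A
    using that by (simp add: scalar_prod_def atLeast0LessThan sum_distrib_left del: times_complex.sel)
  have "0 \<le> Re (scalar_prod (map_vec cnj v) (?M *\<^sub>v v))" if v: "v \<in> carrier_vec d" for v
  proof -
    have "Re (scalar_prod (map_vec cnj v) (?M *\<^sub>v v)) =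
        (\<Sum>i<d. \<Sum>j<d. \<Sum>x\<in>S. p x * Re (cnj (v $ i) * (W x $$ (i, j) * v $ j)))"
      unfolding form[OF v M]
    proof (intro sum.cong refl)
      fix i j assume "i \<in> {..<d}" "j \<in> {..<d}"
      then have "cnj (v $ i) * (?M $$ (i, j) * v $ j)
          = (\<Sum>x\<in>S. complex_of_real (p x) * (cnj (v $ i) * (W x $$ (i, j) * v $ j)))"
        by (simp add: mixture_def sum_distrib_left sum_distrib_right mult_ac)
      then show "Re (cnj (v $ i) * (?M $$ (i, j) * v $ j)) = (\<Sum>x\<in>S. p x * Re (cnj (v $ i) * (W x $$ (i, j) * v $ j)))"
        by (simp only: Re_sum) simp
    qed
    also have "\<dots> = (\<Sum>x\<in>S. \<Sum>i<d. \<Sum>j<d. p x * Re (cnj (v $ i) * (W x $$ (i, j) * v $ j)))"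
      by (simp only: sum.swap[where A = "{..<d}" and B = S])
    also have "\<dots> = (\<Sum>x\<in>S. p x * Re (scalar_prod (map_vec cnj v) (W x *\<^sub>v v)))"
      by (intro sum.cong refl) (simp only: form[OF v Wc] sum_distrib_left)
    also have "\<dots> \<ge> 0"
      using p W v by (intro sum_nonneg mult_nonneg_nonneg) (auto simp: distr_on_def density_mat_def psd_mat_def)
    finally show ?thesis .
  qed
  moreover have "mtrace ?M = 1"
  proof -
    have "mtrace ?M = (\<Sum>i<d. \<Sum>x\<in>S. complex_of_real (p x) * W x $$ (i, i))"
      by (simp add: mtrace_def mixture_def)
    also have "\<dots> = (\<Sum>x\<in>S. \<Sum>i<d. complex_of_real (p x) * W x $$ (i, i))" by (rule sum.swap)
    also have "\<dots> = (\<Sum>x\<in>S. complex_of_real (p x) * mtrace (W x))"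
      by (intro sum.cong refl) (use Wc in \<open>auto simp: mtrace_def sum_distrib_left\<close>)
    also have "\<dots> = (\<Sum>x\<in>S. complex_of_real (p x))"
      by (intro sum.cong refl) (use W in \<open>auto simp: density_mat_def\<close>)
    also have "\<dots> = 1" using p by (simp add: distr_on_def flip: of_real_sum)
    finally show ?thesis .
  qed
  ultimately show ?thesis using M herm by (auto simp: density_mat_def psd_mat_def hermitian_mat_def)
qed

section \<open>Holevo information\<close>

text \<open>The cross terms are linear in \<open>W x\<close> and average to the entropy term of the
  mixture: the difference-of-entropies form of the Holevo information.\<close>

lemma holevo_info_eq:
  assumes W: "cq_channel d W" and p: "distr_on UNIV p"
  shows "holevo_info d W p = (\<Sum>x\<in>UNIV. p x * rtr (op (W x) * op (mlog2 (W x))))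
    - rtr (op (mixture d UNIV W p) * op (mlog2 (mixture d UNIV W p)))"
proof -
  let ?s = "mixture d UNIV W p"
  have Wx: "density_mat d (W x)" for x using W by (simp add: cq_channel_def)
  have s: "density_mat d ?s" by (intro mixture_density Wx p)
  have Lc: "mlog2 A \<in> carrier_mat d d" if "density_mat d A" for A using density_decomp[OF that] by blast
  have re: "rel_entropy (W x) ?s = rtr (op (W x) * op (mlog2 (W x))) - rtr (op (W x) * op (mlog2 ?s))" for x
  proof -
    note c = density_matD(1)[OF Wx[of x]] Lc[OF Wx[of x]] Lc[OF s]
    have m: "mlog2 (W x) - mlog2 ?s \<in> carrier_mat d d" using c(3) by (rule minus_carrier_mat)
    have "rel_entropy (W x) ?s = rtr (op (W x * (mlog2 (W x) - mlog2 ?s)))"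
      unfolding rel_entropy_def by (rule rtr_op[symmetric]) (use c m in auto)
    also have "\<dots> = rtr (op (W x) * op (mlog2 (W x))) - rtr (op (W x) * op (mlog2 ?s))"
      unfolding op_mult[OF c(1) m] op_diff[OF c(2,3)] by (simp add: right_diff_distrib rtr_diff)
    finally show ?thesis .
  qed
  have "op ?s = (\<Sum>x\<in>UNIV. p x *\<^sub>R op (W x))"
    by (rule op_mixture) (rule density_matD(1)[OF Wx])
  then have "rtr (op ?s * op (mlog2 ?s)) = (\<Sum>x\<in>UNIV. p x * rtr (op (W x) * op (mlog2 ?s)))"
    by (simp add: sum_distrib_right rtr_sum rtr_scaleR)
  then show ?thesis
    by (simp add: holevo_info_def re right_diff_distrib sum_subtractf)
qed

text \<open>From \<open>l * ln (1 / l) <= 1\<close>. The crude \<open>d\<close> in place of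
  \<open>ln d\<close> is enough for the purpose, which is to make the capacity finite.\<close>

lemma neg_entropy_bounds:
  assumes "\<And>j. j < d \<Longrightarrow> 0 \<le> l j" "(\<Sum>j<d. l j) = 1"
  shows "(\<Sum>j<d. l j * ln (l j)) \<le> 0" "- real d \<le> (\<Sum>j<d. l j * ln (l j))"
proof -
  have b: "- 1 \<le> l j * ln (l j) \<and> l j * ln (l j) \<le> 0" if "j < d" for j
  proof (cases "l j = 0")
    case False
    then have l: "0 < l j" using assms(1)[OF that] by simp
    have l1: "l j \<le> 1" using member_le_sum[of j "{..<d}" l] assms that by auto
    have "ln (1 / l j) \<le> 1 / l j" using ln_le_minus_one[of "1 / l j"] l by simp
    then have "l j * ln (1 / l j) \<le> 1" using l by (simp add: field_simps)
    moreover have "ln (1 / l j) = - ln (l j)" using l by (simp add: ln_div)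
    ultimately show ?thesis using l l1 by (simp add: mult_nonneg_nonpos)
  qed simp
  show "(\<Sum>j<d. l j * ln (l j)) \<le> 0" using b by (intro sum_nonpos) auto
  have "(\<Sum>j<d. - 1 :: real) \<le> (\<Sum>j<d. l j * ln (l j))" using b by (intro sum_mono) auto
  then show "- real d \<le> (\<Sum>j<d. l j * ln (l j))" by simp
qed

lemma density_log_bounds:
  assumes "density_mat d A"
  shows "rtr (op A * op (mlog2 A)) \<le> 0" "- (real d / ln 2) \<le> rtr (op A * op (mlog2 A))"
proof -
  obtain U l where l: "\<And>j. j < d \<Longrightarrow> 0 \<le> l j" "(\<Sum>j<d. l j) = 1"
    "rtr (op A * op (mlog2 A)) = (\<Sum>j<d. l j * ln (l j)) / ln 2"
    using density_decomp[OF assms] by metis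
  show "rtr (op A * op (mlog2 A)) \<le> 0" "- (real d / ln 2) \<le> rtr (op A * op (mlog2 A))"
    using neg_entropy_bounds[OF l(1,2)] by (simp_all add: l(3) field_simps)
qed

text \<open>A supremum of reals is meaningful only over a bounded set; this is what makes
  \<open>cq_capacity\<close> an upper bound.\<close>

lemma capacity_bdd:
  assumes W: "cq_channel d W"
  shows "bdd_above (holevo_info d W ` {p. distr_on UNIV p})"
proof (rule bdd_aboveI2)
  fix p assume "p \<in> {p. distr_on (UNIV :: 'a set) p}"
  then have p: "distr_on UNIV p" by simp
  have Wx: "density_mat d (W x)" for x using W by (simp add: cq_channel_def)
  have "(\<Sum>x\<in>UNIV. p x * rtr (op (W x) * op (mlog2 (W x)))) \<le> 0"
    using p by (intro sum_nonpos mult_nonneg_nonpos density_log_bounds(1)[OF Wx]) (auto simp: distr_on_def)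
  then show "holevo_info d W p \<le> real d / ln 2"
    unfolding holevo_info_eq[OF W p]
    using density_log_bounds(2)[OF mixture_density[of UNIV d W, OF Wx p]] by simp
qed

lemma holevo_le_capacity:
  assumes "cq_channel d W" "distr_on UNIV p"
  shows "holevo_info d W p \<le> cq_capacity d W"
  unfolding cq_capacity_def by (rule cSUP_upper) (use assms capacity_bdd in auto)

text \<open>A point mass carries no information.\<close>

lemma capacity_nonneg:
  assumes W: "cq_channel d (W :: 'x::finite \<Rightarrow> complex mat)"
  shows "0 \<le> cq_capacity d W"
proof -
  define x0 :: 'x where "x0 = undefined"
  define p where "p x = (if x = x0 then 1 else 0 :: real)" for x
  have p: "distr_on UNIV p" by (simp add: distr_on_def p_def)
  have Wc: "W x \<in> carrier_mat d d" for x using W density_matD(1) by (auto simp: cq_channel_def)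
  have "mixture d UNIV W p = W x0"
  proof (rule op_inj[OF mixture_carrier Wc])
    have "op (mixture d UNIV W p) = (\<Sum>x\<in>UNIV. p x *\<^sub>R op (W x))" by (rule op_mixture[OF Wc])
    also have "\<dots> = (\<Sum>x\<in>UNIV. if x = x0 then op (W x) else 0)"
      by (rule sum.cong) (auto simp: p_def)
    finally show "op (mixture d UNIV W p) = op (W x0)" by simp
  qed
  then have "holevo_info d W p = 0"
    unfolding holevo_info_eq[OF W p] by (simp add: p_def if_distrib[of "\<lambda>c. c * _"] cong: if_cong)
  then show ?thesis using holevo_le_capacity[OF W p] by simp
qed

section \<open>Achievability\<close>

text \<open>One eigendecomposition per matrix is fixed once, so that tensor powers, thresholds and
  entropies of the same state all refer to the same basis and eigenvalues.\<close>

definition sdec :: "nat \<Rightarrow> complex mat \<Rightarrow> complex mat \<times> (nat \<Rightarrow> real)" where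
  "sdec d A = (SOME (U, l). unitary_mat d U \<and> A = U * rdiag_mat d l * adj_mat U \<and>
    (\<forall>j<d. 0 \<le> l j) \<and> (\<Sum>j<d. l j) = 1 \<and>
    rtr (op A * op (mlog2 A)) = (\<Sum>j<d. l j * ln (l j)) / ln 2)"

definition eU :: "nat \<Rightarrow> complex mat \<Rightarrow> complex mat" where "eU d A = fst (sdec d A)"
definition eL :: "nat \<Rightarrow> complex mat \<Rightarrow> nat \<Rightarrow> real" where "eL d A = snd (sdec d A)"

text \<open>Minus the von Neumann entropy, in nats.\<close>
definition hn :: "nat \<Rightarrow> complex mat \<Rightarrow> real" where
  "hn d A = (\<Sum>j<d. eL d A j * ln (eL d A j))"

lemma sdec:
  assumes "density_mat d A"
  shows "unitary_mat d (eU d A)" "A = eU d A * rdiag_mat d (eL d A) * adj_mat (eU d A)"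
    "\<And>j. j < d \<Longrightarrow> 0 \<le> eL d A j" "(\<Sum>j<d. eL d A j) = 1"
    "rtr (op A * op (mlog2 A)) = hn d A / ln 2"
proof -
  obtain U l where "unitary_mat d U" "A = U * rdiag_mat d l * adj_mat U"
    "\<And>j. j < d \<Longrightarrow> 0 \<le> l j" "(\<Sum>j<d. l j) = 1" "mlog2 A \<in> carrier_mat d d"
    "rtr (op A * op (mlog2 A)) = (\<Sum>j<d. l j * ln (l j)) / ln 2"
    using density_decomp[OF assms] by blast
  then have "case (U, l) of (U, l) \<Rightarrow> unitary_mat d U \<and> A = U * rdiag_mat d l * adj_mat U \<and>
    (\<forall>j<d. 0 \<le> l j) \<and> (\<Sum>j<d. l j) = 1 \<and>
    rtr (op A * op (mlog2 A)) = (\<Sum>j<d. l j * ln (l j)) / ln 2" by auto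
  then have "case sdec d A of (U, l) \<Rightarrow> unitary_mat d U \<and> A = U * rdiag_mat d l * adj_mat U \<and>
    (\<forall>j<d. 0 \<le> l j) \<and> (\<Sum>j<d. l j) = 1 \<and>
    rtr (op A * op (mlog2 A)) = (\<Sum>j<d. l j * ln (l j)) / ln 2"
    unfolding sdec_def by (rule someI)
  then show "unitary_mat d (eU d A)" "A = eU d A * rdiag_mat d (eL d A) * adj_mat (eU d A)"
    "\<And>j. j < d \<Longrightarrow> 0 \<le> eL d A j" "(\<Sum>j<d. eL d A j) = 1"
    "rtr (op A * op (mlog2 A)) = hn d A / ln 2"
    by (auto simp: eU_def eL_def hn_def case_prod_unfold)
qed

section \<open>Tensor powers of one state, and types of sequences\<close>

lemma tensor_const: "length xs = n \<Longrightarrow> tensor_channel (\<lambda>_. V) xs = tensor_channel (\<lambda>_. V) (replicate n ())"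
  by (induction xs arbitrary: n) auto

lemma ltens_const: "length xs = n \<Longrightarrow> ltens d (\<lambda>_. s) xs = ltens d (\<lambda>_. s) (replicate n ())"
proof (induction xs arbitrary: n)
  case (Cons x xs)
  then show ?case by (cases n) (auto simp: fun_eq_iff)
qed (auto simp: fun_eq_iff)

text \<open>The list \<open>replicate n ()\<close> stands for \<open>n\<close> copies of one state;
  \<open>pU\<close> and \<open>pL\<close> are the eigenbasis and the eigenvalues of its tensor
  power.\<close>

definition pU :: "nat \<Rightarrow> nat \<Rightarrow> complex mat \<Rightarrow> fmat" where
  "pU d n A = op (tensor_channel (\<lambda>_. eU d A) (replicate n ()))"

definition pL :: "nat \<Rightarrow> nat \<Rightarrow> complex mat \<Rightarrow> nat \<Rightarrow> real" where
  "pL d n A = ltens d (\<lambda>_. eL d A) (replicate n ())"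

lemma uni_pU: "density_mat d A \<Longrightarrow> uni (d ^ n) (pU d n A)"
  unfolding pU_def using uni_op[OF tensor_unitary[of d "\<lambda>_. eU d A" "replicate n ()"]] sdec(1)
  by simp

lemma pL_nonneg: "density_mat d A \<Longrightarrow> i < d ^ n \<Longrightarrow> 0 \<le> pL d n A i"
  unfolding pL_def by (rule ltens_nonneg) (auto simp: sdec(3))

lemma sum_pL: "density_mat d A \<Longrightarrow> (\<Sum>i<d ^ n. pL d n A i) = 1"
  using sum_ltens[of d "\<lambda>_::unit. eL d A" "replicate n ()"]
  by (simp add: pL_def sdec(4))

text \<open>The square root of the tensor power, of Hilbert-Schmidt norm 1: multiplication by it
  turns Hilbert-Schmidt bounds into trace norm bounds at no cost.\<close>

definition rootst :: "nat \<Rightarrow> nat \<Rightarrow> complex mat \<Rightarrow> fmat" where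
  "rootst d n A = fc (d ^ n) (pU d n A) (\<lambda>i. sqrt (pL d n A i))"

lemma norm_rootst: assumes "density_mat d A" shows "norm (rootst d n A) = 1"
proof -
  have "(\<Sum>i<d ^ n. (sqrt (pL d n A i))\<^sup>2) = (\<Sum>i<d ^ n. pL d n A i)"
    by (intro sum.cong refl) (simp add: pL_nonneg[OF assms])
  then show ?thesis
    by (simp add: rootst_def norm_fc[OF uni_pU[OF assms]] sum_pL[OF assms])
qed

lemma sum_list_count:
  fixes f :: "'a \<Rightarrow> 'b::real_vector"
  assumes "finite S" "set xs \<subseteq> S"
  shows "sum_list (map f xs) = (\<Sum>x\<in>S. real (count_list xs x) *\<^sub>R f x)"
  using assms(2)
proof (induction xs)
  case (Cons y xs)
  have "(\<Sum>x\<in>S. real (count_list (y # xs) x) *\<^sub>R f x)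
      = (\<Sum>x\<in>S. real (count_list xs x) *\<^sub>R f x + (if x = y then f x else 0))"
    by (intro sum.cong refl) (auto simp: scaleR_left_distrib)
  then show ?case using Cons assms(1) by (simp add: sum.distrib)
qed simp

definition ty :: "'x list \<Rightarrow> 'x \<Rightarrow> real" where
  "ty xs x = real (count_list xs x) / real (length xs)"

lemma distr_ty:
  fixes xs :: "'x::finite list"
  assumes "xs \<noteq> []"
  shows "distr_on UNIV (ty xs)"
proof -
  have "sum_list (map (\<lambda>_. 1 :: real) xs) = (\<Sum>x\<in>UNIV. real (count_list xs x) *\<^sub>R 1)"
    by (rule sum_list_count) auto
  then have "(\<Sum>x\<in>UNIV. real (count_list xs x)) = real (length xs)"
    by (simp add: sum_list_triv)
  then show ?thesis using assms by (simp add: distr_on_def ty_def flip: sum_divide_distrib)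
qed

lemma sum_list_ty:
  fixes xs :: "'x::finite list" and f :: "'x \<Rightarrow> real"
  shows "sum_list (map f xs) = real (length xs) * (\<Sum>x\<in>UNIV. ty xs x * f x)"
proof (cases "xs = []")
  case False
  then show ?thesis
    using sum_list_count[of UNIV xs f] by (simp add: ty_def sum_distrib_left)
qed simp

abbreviation evs :: "nat \<Rightarrow> ('x \<Rightarrow> complex mat) \<Rightarrow> 'x list \<Rightarrow> nat \<Rightarrow> real" where
  "evs d W xs \<equiv> ltens d (\<lambda>x. eL d (W x)) xs"

lemma tensor_state_fc:
  assumes "cq_channel d W" "length xs = n"
  defines "u \<equiv> op (tensor_channel (\<lambda>x. eU d (W x)) xs)"
    and "l \<equiv> evs d W xs"
  shows "uni (d ^ n) u" "op (tensor_channel W xs) = fc (d ^ n) u l"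
    "\<And>i. i < d ^ n \<Longrightarrow> 0 \<le> l i" "(\<Sum>i<d ^ n. l i) = 1"
proof -
  have W: "density_mat d (W x)" for x using assms(1) by (simp add: cq_channel_def)
  show "uni (d ^ n) u" "op (tensor_channel W xs) = fc (d ^ n) u l"
    using tensor_fc[of d "\<lambda>x. eU d (W x)" W "\<lambda>x. eL d (W x)" xs] sdec(1,2)[OF W] assms(2)
    by (auto simp: u_def l_def)
  show "0 \<le> l i" if "i < d ^ n" for i
    unfolding l_def by (rule ltens_nonneg) (use that assms(2) sdec(3)[OF W] in auto)
  have "prod_list (map (\<lambda>x. \<Sum>j<d. eL d (W x) j) xs) = 1"
    by (induction xs) (auto simp: sdec(4)[OF W])
  then show "(\<Sum>i<d ^ n. l i) = 1" using sum_ltens[of d "\<lambda>x. eL d (W x)" xs] assms(2) by (simp add: l_def)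
qed

lemma powr_exp: "exp (x::real) powr t = exp (t * x)"
  by (simp add: powr_def)

text \<open>\<open>hn\<close> is minus the entropy, so the threshold lies a factor
  \<open>exp (n \<delta>)\<close> above the typical eigenvalue of the product state; the tail is
  bounded by the factorised power sum, expanded to second order.\<close>

lemma state_tail_upper:
  assumes W: "cq_channel d W" and n: "length xs = n" and t: "0 \<le> t" "t \<le> 1 / 2"
  shows "(\<Sum>i<d ^ n. if exp (sum_list (map (\<lambda>x. hn d (W x)) xs) + real n * \<delta>) < evs d W xs i
      then evs d W xs i else 0) \<le> exp (real n * (16 * real d * t\<^sup>2 - t * \<delta>))"
proof -
  have Wx: "density_mat d (W x)" for x using W by (simp add: cq_channel_def)
  let ?h = "sum_list (map (\<lambda>x. hn d (W x)) xs)"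
  let ?l = "\<lambda>x. eL d (W x)"
  have "(\<Sum>i<d ^ n. if exp (?h + real n * \<delta>) < ltens d ?l xs i then ltens d ?l xs i else 0)
    \<le> exp (?h + real n * \<delta>) powr (- t) * prod_list (map (\<lambda>x. \<Sum>j<d. ?l x j powr (1 + t)) xs)"
    using tail_upper[of xs d ?l "exp (?h + real n * \<delta>)" t] sdec(3)[OF Wx] t n by simp
  also have "\<dots> \<le> exp (?h + real n * \<delta>) powr (- t) * exp (sum_list (map (\<lambda>x. t * hn d (W x) + 16 * real d * t\<^sup>2) xs))"
    using sum_powr_second_order[of d "?l _" t] sdec(3,4)[OF Wx] t
    by (intro mult_left_mono prod_list_le_exp) (auto simp: hn_def add.assoc intro!: sum_nonneg)
  also have "sum_list (map (\<lambda>x. t * hn d (W x) + 16 * real d * t\<^sup>2) xs) = t * ?h + real n * (16 * real d * t\<^sup>2)"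
    using n by (simp add: sum_list_addf sum_list_const_mult sum_list_triv)
  finally show ?thesis by (simp add: powr_exp algebra_simps flip: exp_add)
qed

text \<open>The witness is the state truncated to its typical eigenvalues, times the inverse square root
  of the reference state truncated to the typical eigenvalues of the latter.\<close>
lemma truncation:
  fixes W :: "'x::finite \<Rightarrow> complex mat" and \<delta> :: real
  assumes W: "cq_channel d W" and n: "length xs = n" "0 < n" and t: "0 \<le> t" "t \<le> 1 / 2"
  defines "\<tau> \<equiv> exp (real n * (16 * real d * t\<^sup>2 - t * \<delta>))"
  shows "\<exists>B. (norm B)\<^sup>2 \<le> exp (real n * (ln 2 * holevo_info d W (ty xs) + 2 * \<delta>)) \<and>
    (\<forall>V. contr V \<longrightarrow> rtr (V * (op (tensor_channel W xs) - B * rootst d n (mixture d UNIV W (ty xs)))) \<le> \<tau> + sqrt \<tau>)"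
proof -
  have Wx: "density_mat d (W x)" for x using W by (simp add: cq_channel_def)
  have Wc: "W x \<in> carrier_mat d d" for x using density_matD(1)[OF Wx] .
  define P where "P = ty xs"
  have P: "distr_on UNIV P" unfolding P_def by (rule distr_ty) (use n in auto)
  define \<sigma> where "\<sigma> = mixture d UNIV W P"
  have \<sigma>: "density_mat d \<sigma>" unfolding \<sigma>_def by (intro mixture_density Wx P)
  define u where "u = op (tensor_channel (\<lambda>x. eU d (W x)) xs)"
  define l where "l = evs d W xs"
  define D where "D = d ^ n"
  note st = tensor_state_fc[OF W n(1), folded u_def l_def D_def]
  define v where "v = pU d n \<sigma>"
  define s where "s = pL d n \<sigma>"
  have v: "uni D v" unfolding v_def D_def by (rule uni_pU[OF \<sigma>])
  have s0: "\<And>i. i < D \<Longrightarrow> 0 \<le> s i" unfolding s_def D_def by (rule pL_nonneg[OF \<sigma>])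
  have s_xs: "s = ltens d (\<lambda>_. eL d \<sigma>) xs" unfolding s_def pL_def by (rule ltens_const[OF n(1), symmetric])
  have v_xs: "v = op (tensor_channel (\<lambda>_. eU d \<sigma>) xs)"
    unfolding v_def pU_def by (simp add: tensor_const[OF n(1)])
  define h where "h = sum_list (map (\<lambda>x. hn d (W x)) xs)"
  \<comment> \<open>\<open>a\<close> lies a factor \<open>exp (n \<delta>)\<close> above the typical
    eigenvalue of the state, and \<open>b\<close> the same factor below that of the reference, so
    \<open>a / b\<close> is \<open>exp (n (I + 2 \<delta>))\<close> with \<open>I\<close> in
    nats.\<close>
  define a where "a = exp (h + real n * \<delta>)"
  define b where "b = exp (real n * hn d \<sigma> - real n * \<delta>)"
  have a0: "0 < a" and b0: "0 < b" by (simp_all add: a_def b_def)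
  define g where "g i = (if b \<le> s i then 1 / sqrt (s i) else 0)" for i
  define B where "B = fc D u (\<lambda>i. if l i \<le> a then l i else 0) * fc D v g"
  \<comment> \<open>One root of the eigenvalue is bounded by \<open>sqrt a\<close>; the other is
    kept, as it has Hilbert-Schmidt norm 1, and \<open>g\<close>, at most \<open>1 / sqrt b\<close>,
    acts on it.\<close>
  have "norm B \<le> sqrt a * norm (fc D u (\<lambda>i. sqrt (l i)) * fc D v g)"
    unfolding B_def
  proof (rule norm_fc_mult_le[OF st(1)])
    fix i assume i: "i < D"
    show "\<bar>if l i \<le> a then l i else 0\<bar> \<le> sqrt a * \<bar>sqrt (l i)\<bar>"
    proof (cases "l i \<le> a")
      case True
      have "l i = sqrt (l i) * sqrt (l i)" using st(3)[OF i] by simp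
      also have "\<dots> \<le> sqrt a * sqrt (l i)" using True st(3)[OF i] by (intro mult_right_mono) auto
      finally show ?thesis using True st(3)[OF i] by simp
    qed (use a0 st(3)[OF i] in simp)
  qed (use a0 in simp)
  also have "norm (fc D u (\<lambda>i. sqrt (l i)) * fc D v g) = norm (fc D v g * fc D u (\<lambda>i. sqrt (l i)))"
    by (metis adj_fc adj_mult norm_adj)
  also have "\<dots> \<le> (1 / sqrt b) * norm (fc D u (\<lambda>i. sqrt (l i)))"
    by (rule norm_fc_mult_bound[OF v]) (use b0 in \<open>auto simp: g_def intro!: divide_left_mono\<close>)
  also have "norm (fc D u (\<lambda>i. sqrt (l i))) = 1"
  proof -
    have "(\<Sum>i<D. (sqrt (l i))\<^sup>2) = (\<Sum>i<D. l i)" by (intro sum.cong refl) (simp add: st(3))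
    then show ?thesis by (simp add: norm_fc[OF st(1)] st(4))
  qed
  finally have "norm B \<le> sqrt (a / b)" using a0 by (simp add: real_sqrt_divide mult_left_mono)
  then have "(norm B)\<^sup>2 \<le> (sqrt (a / b))\<^sup>2" by (intro power_mono) auto
  also have "\<dots> = a / b" using a0 b0 by simp
  also have "\<dots> = exp (real n * (ln 2 * holevo_info d W P + 2 * \<delta>))"
  proof -
    have I: "ln 2 * holevo_info d W P = (\<Sum>x\<in>UNIV. P x * hn d (W x)) - hn d \<sigma>"
      unfolding holevo_info_eq[OF W P] sdec(5)[OF Wx] sdec(5)[OF \<sigma>] \<sigma>_def[symmetric]
      by (simp add: right_diff_distrib sum_distrib_left)
    have hh: "h = real n * (\<Sum>x\<in>UNIV. P x * hn d (W x))"
      unfolding h_def P_def n(1)[symmetric] by (rule sum_list_ty)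
    show ?thesis
      unfolding a_def b_def I hh by (simp add: algebra_simps flip: exp_diff)
  qed
  finally have norm: "(norm B)\<^sup>2 \<le> exp (real n * (ln 2 * holevo_info d W P + 2 * \<delta>))" .

  define Q where "Q = fc D v (\<lambda>i. if b \<le> s i then 0 else 1)"
  define \<tau>1 where "\<tau>1 = (\<Sum>i<D. if a < l i then l i else 0)"
  define \<tau>2 where "\<tau>2 = rtr (op (tensor_channel W xs) * Q)"
  have t1: "\<tau>1 \<le> \<tau>"
    unfolding \<tau>1_def \<tau>_def a_def h_def l_def D_def by (rule state_tail_upper[OF W n(1) t])
  \<comment> \<open>Off the typical part of the reference, the weight of the state is a classical
    quantity: only its diagonal in the eigenbasis of the tensor power of \<open>\<sigma>\<close>
    enters, and this diagonal is again a product over letters.\<close>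
  have t2: "\<tau>2 \<le> \<tau>"
  proof -
    define V where "V = eU d \<sigma>"
    have Vc: "V \<in> carrier_mat d d" using sdec(1)[OF \<sigma>] unitary_matD by (simp add: V_def)
    note aVc = adj_mat_carrier[OF Vc]
    define A where "A x = adj_mat V * W x * V" for x
    define w where "w x j = Re (A x $$ (j, j))" for x j
    have Ac: "A x \<in> carrier_mat d d" for x unfolding A_def using Vc aVc Wc by (auto intro!: mult_carrier_mat)
    have w: "A x $$ (j, j) = complex_of_real (w x j)" "0 \<le> w x j" if "j < d" for x j
      using psd_diag[OF density_matD(3)[OF Wx] Vc that, of x] by (auto simp: A_def w_def)
    have "adj v * op (tensor_channel W xs) * v = op (tensor_channel A xs)"
    proof -
      have "tensor_channel A xs = tensor_channel (\<lambda>_. adj_mat V) xs * tensor_channel W xs * tensor_channel (\<lambda>_. V) xs"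
        unfolding A_def by (simp add: tensor_mult[of _ d] Vc aVc Wc mult_carrier_mat[of _ d d])
      also have "op \<dots> = op (tensor_channel (\<lambda>_. adj_mat V) xs) * op (tensor_channel W xs) * op (tensor_channel (\<lambda>_. V) xs)"
      proof -
        have "tensor_channel (\<lambda>_. adj_mat V) xs \<in> carrier_mat D D" "tensor_channel W xs \<in> carrier_mat D D"
          "tensor_channel (\<lambda>_. V) xs \<in> carrier_mat D D"
          using tensor_carrier[of xs _ d] n(1) Vc aVc Wc by (auto simp: D_def)
        then show ?thesis by (simp add: op_mult[of _ D] mult_carrier_mat[of _ D D] mult.assoc)
      qed
      also have "op (tensor_channel (\<lambda>_. adj_mat V) xs) = adj v"
        unfolding v_xs V_def[symmetric] op_adj[symmetric] by (simp add: tensor_adj[of _ d] Vc)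
      finally show ?thesis by (simp add: v_xs V_def)
    qed
    then have ed: "Re (ent (adj v * op (tensor_channel W xs) * v) j j) = ltens d w xs j" if "j < D" for j
      using that tensor_diag[of A d w j xs] w Ac n(1) tensor_carrier[of xs A d]
      by (simp add: ent_op D_def)
    have ws: "(\<Sum>x\<in>UNIV. P x * w x j) = eL d \<sigma> j" if j: "j < d" for j
    proof -
      have uV: "uni d (op V)" unfolding V_def by (rule uni_op[OF sdec(1)[OF \<sigma>]])
      have "op \<sigma> = fc d (op V) (eL d \<sigma>)"
        by (subst sdec(2)[OF \<sigma>]) (simp add: op_fc[OF sdec(1)[OF \<sigma>]] V_def)
      then have "dg d (eL d \<sigma>) = adj (op V) * (\<Sum>x\<in>UNIV. P x *\<^sub>R op (W x)) * op V"
        using fc_diag[OF uV, of "eL d \<sigma>"] op_mixture[of UNIV W d P] Wc by (simp add: \<sigma>_def)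
      also have "\<dots> = (\<Sum>x\<in>UNIV. P x *\<^sub>R (adj (op V) * op (W x) * op V))"
        by (simp add: sum_distrib_left sum_distrib_right)
      also have "\<dots> = (\<Sum>x\<in>UNIV. P x *\<^sub>R op (A x))"
        by (intro sum.cong refl) (simp add: A_def op_mult[of _ d] Vc aVc Wc mult_carrier_mat[of _ d d] op_adj mult.assoc)
      finally have "ent (dg d (eL d \<sigma>)) j j = (\<Sum>x\<in>UNIV. complex_of_real (P x) * ent (op (A x)) j j)" by simp
      then have "complex_of_real (eL d \<sigma> j) = (\<Sum>x\<in>UNIV. complex_of_real (P x * w x j))"
        using j Ac w(1)[OF j] by (simp add: ent_dg ent_op carrier_matD[OF Ac])
      then show ?thesis by (simp only: of_real_eq_iff flip: of_real_sum)
    qed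
    \<comment> \<open>A letter that occurs in \<open>xs\<close> has positive weight in the type, so
      its diagonal vanishes wherever the eigenvalue of \<open>\<sigma>\<close> does.\<close>
    have wz: "w x j = 0" if "x \<in> set xs" "j < d" "eL d \<sigma> j = 0" for x j
    proof -
      have "(\<Sum>x\<in>UNIV. P x * w x j) = 0" using ws that by simp
      then have "P x * w x j = 0"
        using P w(2)[OF that(2)] by (subst (asm) sum_nonneg_eq_0_iff) (auto simp: distr_on_def)
      moreover have "P x \<noteq> 0" using that(1) n by (auto simp: P_def ty_def count_list_0_iff)
      ultimately show ?thesis by simp
    qed
    let ?s = "eL d \<sigma>"
    have "car D (op (tensor_channel W xs))" using st(2) car_fc[OF st(1)] by simp
    then have "\<tau>2 = (\<Sum>j<D. (if b \<le> s j then 0 else 1) * ltens d w xs j)"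
      unfolding \<tau>2_def Q_def by (simp add: rtr_mult_fc[OF v] ed)
    also have "\<dots> = (\<Sum>i<d ^ length xs. if b \<le> ltens d (\<lambda>_. ?s) xs i then 0 else ltens d w xs i)"
      unfolding D_def n(1)[symmetric] s_xs by (intro sum.cong refl) auto
    also have "\<dots> \<le> b powr t * prod_list (map (\<lambda>x. \<Sum>j<d. w x j * ?s j powr (- t)) xs)"
      by (rule tail_cross) (use w wz sdec(3)[OF \<sigma>] b0 t in auto)
    \<comment> \<open>The single factors are not controlled, only their average over the type.
      Passing from the product to the exponential of the sum of \<open>factor - 1\<close> makes this
      average appear, and it is the power sum of \<open>\<sigma>\<close>.\<close>
    also have "\<dots> \<le> b powr t * exp (sum_list (map (\<lambda>x. (\<Sum>j<d. w x j * ?s j powr (- t)) - 1) xs))"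
      using w(2) by (intro mult_left_mono prod_list_le_exp) (auto intro!: sum_nonneg mult_nonneg_nonneg)
    also have "sum_list (map (\<lambda>x. (\<Sum>j<d. w x j * ?s j powr (- t)) - 1) xs)
        = real n * ((\<Sum>j<d. ?s j powr (1 + - t)) - 1)"
    proof -
      have "(\<Sum>x\<in>UNIV. P x * ((\<Sum>j<d. w x j * ?s j powr (- t)) - 1))
          = (\<Sum>x\<in>UNIV. \<Sum>j<d. P x * w x j * ?s j powr (- t)) - 1"
        using P by (simp add: right_diff_distrib sum_subtractf distr_on_def sum_distrib_left mult.assoc)
      also have "(\<Sum>x\<in>UNIV. \<Sum>j<d. P x * w x j * ?s j powr (- t)) = (\<Sum>j<d. (\<Sum>x\<in>UNIV. P x * w x j) * ?s j powr (- t))"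
        by (subst sum.swap) (simp add: sum_distrib_right)
      also have "\<dots> = (\<Sum>j<d. ?s j powr (1 + - t))"
        by (intro sum.cong refl) (use sdec(3)[OF \<sigma>] in \<open>auto simp: ws powr_mult_base\<close>)
      finally show ?thesis unfolding sum_list_ty P_def[symmetric] n(1) by simp
    qed
    also have "b powr t * exp (real n * ((\<Sum>j<d. ?s j powr (1 + - t)) - 1))
        \<le> b powr t * exp (real n * ((- t) * hn d \<sigma> + 16 * real d * t\<^sup>2))"
      using sum_powr_second_order[of d ?s "- t"] sdec(3,4)[OF \<sigma>] t
      by (intro mult_left_mono) (auto simp: hn_def intro!: mult_left_mono)
    also have "\<dots> = \<tau>" unfolding b_def powr_exp \<tau>_def by (simp add: algebra_simps flip: exp_add)
    finally show ?thesis .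
  qed
  have t2': "(norm (fc D u (\<lambda>i. sqrt (l i)) * Q))\<^sup>2 = \<tau>2"
  proof -
    have QQ: "Q * Q = Q" unfolding Q_def fc_mult[OF v] by (rule fc_cong) auto
    have "fc D u (\<lambda>i. sqrt (l i)) * fc D u (\<lambda>i. sqrt (l i)) = op (tensor_channel W xs)"
      unfolding st(2) fc_mult[OF st(1)] by (rule fc_cong) (use st(3) in auto)
    then have "(norm (fc D u (\<lambda>i. sqrt (l i)) * Q))\<^sup>2 = rtr (adj Q * (op (tensor_channel W xs) * Q))"
      unfolding norm_sq adj_mult adj_fc by (metis mult.assoc)
    also have "\<dots> = rtr (op (tensor_channel W xs) * Q * Q)"
      by (subst rtr_comm) (simp add: Q_def)
    finally show ?thesis by (simp add: \<tau>2_def mult.assoc QQ)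
  qed
  have "rtr (V * (op (tensor_channel W xs) - B * rootst d n \<sigma>)) \<le> \<tau> + sqrt \<tau>" if V: "contr V" for V
  proof -
    have one: "fc D v (\<lambda>i. g i * sqrt (s i)) = one D - Q"
      unfolding fc_one[OF v, symmetric] Q_def fc_diff
      by (rule fc_cong) (use b0 in \<open>auto simp: g_def\<close>)
    define L where "L = fc D u (\<lambda>i. if l i \<le> a then l i else 0)"
    have cL: "car D L" unfolding L_def by (rule car_fc[OF st(1)])
    have "B * rootst d n \<sigma> = L * (one D - Q)"
      by (simp add: B_def rootst_def fc_mult[OF v] mult.assoc one flip: v_def s_def D_def L_def)
    also have "\<dots> = L - L * Q" by (simp add: right_diff_distrib one_right[OF cL])
    finally have "op (tensor_channel W xs) - B * rootst d n \<sigma> = (op (tensor_channel W xs) - L) + L * Q"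
      by simp
    also have "op (tensor_channel W xs) - L = fc D u (\<lambda>i. if a < l i then l i else 0)"
      unfolding st(2) L_def fc_diff by (rule fc_cong) auto
    finally have "rtr (V * (op (tensor_channel W xs) - B * rootst d n \<sigma>))
      = rtr (V * fc D u (\<lambda>i. if a < l i then l i else 0)) + rtr (V * (L * Q))"
      by (simp add: distrib_left rtr_add)
    also have "rtr (V * fc D u (\<lambda>i. if a < l i then l i else 0)) \<le> (\<Sum>i<D. \<bar>if a < l i then l i else 0\<bar>)"
      by (rule rtr_contr_fc_le[OF st(1) V])
    also have "\<dots> = \<tau>1" unfolding \<tau>1_def by (intro sum.cong refl) (use st(3) in auto)
    also have "\<tau>1 \<le> \<tau>" by (rule t1)
    \<comment> \<open>A square root appears because \<open>L\<close> is cut on one side only: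
      Cauchy-Schwarz pairs a factor of norm at most 1 with the root of the state times
      \<open>Q\<close>, whose squared norm is the lost weight \<open>\<tau>2\<close>.\<close>
    also have "rtr (V * (L * Q)) \<le> sqrt \<tau>"
    proof -
      let ?L1 = "fc D u (\<lambda>i. if l i \<le> a then sqrt (l i) else 0)"
      have "L = ?L1 * fc D u (\<lambda>i. sqrt (l i))"
        unfolding L_def fc_mult[OF st(1)] by (rule fc_cong) (use st(3) in auto)
      then have "rtr (V * (L * Q)) = rtr (V * ?L1 * (fc D u (\<lambda>i. sqrt (l i)) * Q))" by (simp add: mult.assoc)
      also have "\<dots> \<le> norm (V * ?L1) * norm (fc D u (\<lambda>i. sqrt (l i)) * Q)" by (rule rtr_mult_le)
      also have "\<dots> \<le> 1 * norm (fc D u (\<lambda>i. sqrt (l i)) * Q)"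
      proof (rule mult_right_mono)
        have "norm (V * ?L1) \<le> norm ?L1" by (rule contrD[OF V])
        also have "(\<Sum>i<D. (if l i \<le> a then sqrt (l i) else 0)\<^sup>2) \<le> (\<Sum>i<D. l i)"
          by (intro sum_mono) (use st(3) in auto)
        then have "norm ?L1 \<le> 1" by (simp add: norm_fc[OF st(1)] st(4))
        finally show "norm (V * ?L1) \<le> 1" .
      qed simp
      also have "\<dots> = sqrt \<tau>2" using t2' by (simp add: real_sqrt_unique)
      also have "\<dots> \<le> sqrt \<tau>" using t2 by simp
      finally show ?thesis .
    qed
    finally show ?thesis by simp
  qed
  then show ?thesis using norm unfolding \<sigma>_def P_def by blast
qed

section \<open>Random coding, one type at a time\<close>

lemma contr_uminus: "contr V \<Longrightarrow> contr (- V)"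
  by (simp add: contr_def)

lemma trace_norm_nonneg: "A \<in> carrier_mat D D \<Longrightarrow> 0 \<le> trace_norm A"
  using trace_norm_decomp[of A D] by (metis lessThan_iff real_sqrt_ge_zero sum_nonneg)

abbreviation mixn :: "nat \<Rightarrow> nat \<Rightarrow> ('x::finite \<Rightarrow> complex mat) \<Rightarrow> ('x list \<Rightarrow> real) \<Rightarrow> complex mat" where
  "mixn d n W \<equiv> mixture (d ^ n) (seqs n) (tensor_channel W)"

lemma seqs_tensor_carrier:
  assumes "cq_channel d W" "xs \<in> seqs n"
  shows "tensor_channel W xs \<in> carrier_mat (d ^ n) (d ^ n)"
  using tensor_carrier[of xs W d] assms density_matD(1) by (auto simp: seqs_def cq_channel_def)

lemma op_mixture_seqs:
  assumes "cq_channel d W"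
  shows "op (mixn d n W p) = (\<Sum>xs\<in>seqs n. p xs *\<^sub>R op (tensor_channel W xs))"
  by (rule op_mixture[OF seqs_tensor_carrier[OF assms]])

definition emp :: "'a list \<Rightarrow> 'a \<Rightarrow> real" where
  "emp ys y = real (count_list ys y) / real (length ys)"

lemma emp_sum:
  fixes f :: "'a \<Rightarrow> 'b::real_vector"
  assumes "finite S" "set ys \<subseteq> S"
  shows "(\<Sum>y\<in>S. emp ys y *\<^sub>R f y) = (1 / real (length ys)) *\<^sub>R sum_list (map f ys)"
  by (simp add: sum_list_count[OF assms] scaleR_sum_right emp_def)

lemma distr_emp:
  assumes "finite S" "set ys \<subseteq> S" "ys \<noteq> []"
  shows "distr_on S (emp ys)"
  using emp_sum[OF assms(1,2), of "\<lambda>_. 1 :: real"] assms(3)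
  by (simp add: distr_on_def emp_def sum_list_triv)

lemma type_distr_emp:
  fixes ys :: "'x::finite list list"
  assumes "length ys = M" "0 < M" "set ys \<subseteq> seqs n"
  shows "type_distr n M (emp ys)"
  using distr_emp[of "seqs n" ys] assms by (auto simp: type_distr_def emp_def)

text \<open>A type is determined by its letter counts, each between 0 and \<open>n\<close>.\<close>

lemma card_types: "card (ty ` (seqs n :: 'x::finite list set)) \<le> (n + 1) ^ card (UNIV :: 'x set)"
proof -
  let ?F = "PiE (UNIV :: 'x set) (\<lambda>_. {..n})"
  have "ty ` (seqs n :: 'x list set) \<subseteq> (\<lambda>f x. real (f x) / real n) ` ?F"
  proof
    fix g assume "g \<in> ty ` (seqs n :: 'x list set)"
    then obtain xs :: "'x list" where xs: "length xs = n" "g = ty xs" by (auto simp: seqs_def)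
    have "count_list xs \<in> ?F" using count_le_length[of xs] xs(1) by auto
    moreover have "g = (\<lambda>x. real (count_list xs x) / real n)" using xs by (auto simp: ty_def)
    ultimately show "g \<in> (\<lambda>f x. real (f x) / real n) ` ?F" by blast
  qed
  then have "card (ty ` (seqs n :: 'x list set)) \<le> card ?F"
    by (meson card_image_le card_mono finite_PiE finite_atMost finite_imageI finite le_trans)
  also have "\<dots> = (n + 1) ^ card (UNIV :: 'x set)" by (simp add: card_PiE)
  finally show ?thesis .
qed

text \<open>Truncation replaces each state by some \<open>B x\<close> times the root reference of
  its type. Within a type the right factor is common, so it suffices that averages of the
  \<open>B x\<close> agree in Hilbert-Schmidt norm; the errors of all types are summed before the
  expectation, so one codebook serves them all.\<close>

lemma covering:
  fixes W :: "'x::finite \<Rightarrow> complex mat" and \<delta> :: real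
  assumes W: "cq_channel d W" and n: "0 < n" and M: "0 < M" and t: "0 \<le> t" "t \<le> 1 / 2"
    and p: "distr_on (seqs n) p"
  defines "\<tau> \<equiv> exp (real n * (16 * real d * t\<^sup>2 - t * \<delta>))"
    and "b \<equiv> exp (real n * (ln 2 * cq_capacity d W + 2 * \<delta>))"
  shows "\<exists>q. type_distr n M q \<and>
    trace_norm (mixn d n W p - mixn d n W q)
    \<le> 2 * (\<tau> + sqrt \<tau>) + real ((n + 1) ^ card (UNIV :: 'x set)) * sqrt (b / real M)"
proof -
  let ?S = "seqs n :: 'x list set"
  let ?T = "ty ` ?S"
  have Wx: "density_mat d (W x)" for x using W by (simp add: cq_channel_def)
  have p': "\<And>x. x \<in> ?S \<Longrightarrow> 0 \<le> p x" "sum p ?S = 1" using p by (auto simp: distr_on_def)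
  define w where "w xs = op (tensor_channel W xs)" for xs
  define R where "R P = rootst d n (mixture d UNIV W P)" for P
  have dty: "distr_on UNIV (ty xs)" if "xs \<in> ?S" for xs
    using that n by (intro distr_ty) (auto simp: seqs_def)
  have "\<forall>xs\<in>?S. \<exists>B. (norm B)\<^sup>2 \<le> b \<and> (\<forall>V. contr V \<longrightarrow> rtr (V * (w xs - B * R (ty xs))) \<le> \<tau> + sqrt \<tau>)"
  proof
    fix xs assume xs: "xs \<in> ?S"
    then have len: "length xs = n" by (simp add: seqs_def)
    obtain B where B: "(norm B)\<^sup>2 \<le> exp (real n * (ln 2 * holevo_info d W (ty xs) + 2 * \<delta>))"
      "\<forall>V. contr V \<longrightarrow> rtr (V * (w xs - B * R (ty xs))) \<le> \<tau> + sqrt \<tau>"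
      using truncation[OF W len n t, of \<delta>] unfolding w_def R_def \<tau>_def by blast
    have "exp (real n * (ln 2 * holevo_info d W (ty xs) + 2 * \<delta>)) \<le> b"
      using holevo_le_capacity[OF W dty[OF xs]] n unfolding b_def by simp
    then show "\<exists>B. (norm B)\<^sup>2 \<le> b \<and> (\<forall>V. contr V \<longrightarrow> rtr (V * (w xs - B * R (ty xs))) \<le> \<tau> + sqrt \<tau>)"
      using B by (intro exI[of _ B]) auto
  qed
  then obtain B where B: "\<And>xs. xs \<in> ?S \<Longrightarrow> (norm (B xs))\<^sup>2 \<le> b"
    "\<And>xs V. xs \<in> ?S \<Longrightarrow> contr V \<Longrightarrow> rtr (V * (w xs - B xs * R (ty xs))) \<le> \<tau> + sqrt \<tau>"
    by (metis (no_types, lifting) bchoice)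
  \<comment> \<open>Sequences of another type contribute 0, so each type sees a sample of full size
    \<open>M\<close> and the number of codewords per type need not be controlled.\<close>
  define BT where "BT T xs = (if ty xs = T then B xs else 0)" for T xs
  have b0: "0 < b" by (simp add: b_def)
  define F where "F ys = (\<Sum>T\<in>?T. norm ((1 / real M) *\<^sub>R sum_list (map (BT T) ys) - (\<Sum>x\<in>?S. p x *\<^sub>R BT T x)))" for ys
  have "iexp ?S p M F = (\<Sum>T\<in>?T. iexp ?S p M (\<lambda>ys. norm ((1 / real M) *\<^sub>R sum_list (map (BT T) ys) - (\<Sum>x\<in>?S. p x *\<^sub>R BT T x))))"
    unfolding F_def by (rule iexp_sum) (use p' in auto)
  also have "\<dots> \<le> (\<Sum>T\<in>?T. sqrt (b / real M))"
    by (intro sum_mono iexp_norm_le p' M b0) (use B(1) b0 in \<open>auto simp: BT_def less_imp_le\<close>)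
  also have "\<dots> \<le> real ((n + 1) ^ card (UNIV :: 'x set)) * sqrt (b / real M)"
    using card_types[where ?'x = 'x, of n] b0
    by (simp add: mult_right_mono flip: of_nat_Suc of_nat_power del: of_nat_Suc of_nat_power power_Suc)
  finally have EF: "iexp ?S p M F \<le> real ((n + 1) ^ card (UNIV :: 'x set)) * sqrt (b / real M)" .
  obtain ys where ys: "length ys = M" "set ys \<subseteq> ?S" "F ys \<le> iexp ?S p M F"
    using iexp_witness[of ?S p M F, OF p'] by blast
  have q: "type_distr n M (emp ys)" by (rule type_distr_emp[OF ys(1) M ys(2)])
  have demp: "distr_on ?S (emp ys)" using q by (simp add: type_distr_def)
  let ?mix = "mixture (d ^ n) ?S (tensor_channel W)"
  have mc: "?mix r \<in> carrier_mat (d ^ n) (d ^ n)" for r by (rule mixture_carrier)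
  obtain V where V: "contr V" "trace_norm (?mix p - ?mix (emp ys)) = rtr (V * op (?mix p - ?mix (emp ys)))"
    using trace_norm_attained[OF minus_carrier_mat[OF mc]] by blast
  have opd: "op (?mix p - ?mix (emp ys)) = (\<Sum>x\<in>?S. p x *\<^sub>R w x) - (\<Sum>x\<in>?S. emp ys x *\<^sub>R w x)"
    unfolding op_diff[OF mc mc] op_mixture_seqs[OF W] w_def ..
  define k where "k x = B x * R (ty x)" for x
  have wk: "(\<Sum>x\<in>?S. r x *\<^sub>R w x) = (\<Sum>x\<in>?S. r x *\<^sub>R (w x - k x)) + (\<Sum>x\<in>?S. r x *\<^sub>R k x)" for r
    by (simp add: scaleR_diff_right sum_subtractf)
  have rest: "rtr (U * (\<Sum>x\<in>?S. r x *\<^sub>R (w x - k x))) \<le> \<tau> + sqrt \<tau>" if "distr_on ?S r" "contr U" for r U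
  proof -
    have "rtr (U * (\<Sum>x\<in>?S. r x *\<^sub>R (w x - k x))) = (\<Sum>x\<in>?S. r x * rtr (U * (w x - k x)))"
      by (simp add: sum_distrib_left rtr_sum rtr_scaleR)
    also have "\<dots> \<le> (\<Sum>x\<in>?S. r x * (\<tau> + sqrt \<tau>))"
      using that by (intro sum_mono mult_left_mono) (auto simp: k_def B(2) distr_on_def)
    also have "\<dots> = \<tau> + sqrt \<tau>" using that(1) by (simp add: distr_on_def flip: sum_distrib_right)
    finally show ?thesis .
  qed
  have split: "(\<Sum>x\<in>?S. r x *\<^sub>R k x) = (\<Sum>T\<in>?T. (\<Sum>x\<in>?S. r x *\<^sub>R BT T x) * R T)" for r
  proof -
    have "(\<Sum>T\<in>?T. (\<Sum>x\<in>?S. r x *\<^sub>R BT T x) * R T) = (\<Sum>T\<in>?T. \<Sum>x\<in>?S. r x *\<^sub>R (BT T x * R T))"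
      by (simp add: sum_distrib_right)
    also have "\<dots> = (\<Sum>x\<in>?S. \<Sum>T\<in>?T. r x *\<^sub>R (BT T x * R T))" by (rule sum.swap)
    also have "\<dots> = (\<Sum>x\<in>?S. r x *\<^sub>R k x)"
    proof (intro sum.cong refl)
      fix x assume x: "x \<in> ?S"
      have "(\<Sum>T\<in>?T. r x *\<^sub>R (BT T x * R T)) = (\<Sum>T\<in>?T. if T = ty x then r x *\<^sub>R k x else 0)"
        by (intro sum.cong refl) (auto simp: BT_def k_def)
      then show "(\<Sum>T\<in>?T. r x *\<^sub>R (BT T x * R T)) = r x *\<^sub>R k x" using x by simp
    qed
    finally show ?thesis by simp
  qed
  have main: "rtr (V * ((\<Sum>x\<in>?S. p x *\<^sub>R k x) - (\<Sum>x\<in>?S. emp ys x *\<^sub>R k x))) \<le> F ys"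
  proof -
    define Z where "Z T = (\<Sum>x\<in>?S. p x *\<^sub>R BT T x) - (\<Sum>x\<in>?S. emp ys x *\<^sub>R BT T x)" for T
    have "rtr (V * ((\<Sum>x\<in>?S. p x *\<^sub>R k x) - (\<Sum>x\<in>?S. emp ys x *\<^sub>R k x))) = (\<Sum>T\<in>?T. rtr (V * (Z T * R T)))"
      unfolding split Z_def by (simp add: left_diff_distrib sum_subtractf sum_distrib_left flip: rtr_sum)
        (simp add: right_diff_distrib sum_subtractf sum_distrib_left)
    also have "\<dots> \<le> (\<Sum>T\<in>?T. norm (Z T))"
    proof (rule sum_mono)
      fix T assume "T \<in> ?T"
      then have T: "distr_on UNIV T" using dty by auto
      have nR: "norm (R T) = 1" unfolding R_def by (intro norm_rootst mixture_density Wx T)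
      \<comment> \<open>Cyclicity puts the root of norm 1 next to the contraction; Cauchy-Schwarz
        then leaves \<open>norm (Z T)\<close> alone.\<close>
      have "rtr (V * (Z T * R T)) = rtr (R T * V * Z T)"
        using rtr_comm[of "V * Z T" "R T"] by (simp add: mult.assoc)
      also have "\<dots> \<le> norm (R T * V) * norm (Z T)" by (rule rtr_mult_le)
      also have "\<dots> \<le> 1 * norm (Z T)"
        using contr_mult_right[OF V(1), of "R T"] nR by (intro mult_right_mono) auto
      finally show "rtr (V * (Z T * R T)) \<le> norm (Z T)" by simp
    qed
    also have "\<dots> = F ys"
      unfolding F_def Z_def emp_sum[OF finite_seqs ys(2)] ys(1) by (simp add: norm_minus_commute)
    finally show ?thesis .
  qed
  \<comment> \<open>The truncation error is paid twice, for \<open>p\<close> and for the codebook,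
    the latter tested with \<open>- V\<close>.\<close>
  have "rtr (V * op (?mix p - ?mix (emp ys))) = rtr (V * (\<Sum>x\<in>?S. p x *\<^sub>R (w x - k x)))
      + rtr (- V * (\<Sum>x\<in>?S. emp ys x *\<^sub>R (w x - k x)))
      + rtr (V * ((\<Sum>x\<in>?S. p x *\<^sub>R k x) - (\<Sum>x\<in>?S. emp ys x *\<^sub>R k x)))"
    unfolding opd wk[of p] wk[of "emp ys"] by (simp add: algebra_simps flip: rtr_add)
  also have "\<dots> \<le> (\<tau> + sqrt \<tau>) + (\<tau> + sqrt \<tau>) + F ys"
    by (intro add_mono rest main p demp V(1) contr_uminus)
  finally have "trace_norm (?mix p - ?mix (emp ys)) \<le> 2 * (\<tau> + sqrt \<tau>) + real ((n + 1) ^ card (UNIV :: 'x set)) * sqrt (b / real M)"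
    using ys(3) EF V(2) by simp
  then show ?thesis using q by blast
qed

section \<open>Bounds on the resolution error from bounds for single inputs\<close>

lemma type_distr_exists:
  assumes "0 < M" shows "\<exists>q. type_distr n M (q :: 'x::finite list \<Rightarrow> real)"
  using type_distr_emp[of "replicate M (replicate n (undefined :: 'x))" M n] assms
  by (auto simp: seqs_def)

lemma rtr_contr_state_le:
  assumes W: "cq_channel d W" and x: "x \<in> seqs n" and U: "contr U"
  shows "rtr (U * op (tensor_channel W x)) \<le> 1"
proof -
  have "length x = n" using x by (simp add: seqs_def)
  note st = tensor_state_fc[OF W this]
  have "rtr (U * op (tensor_channel W x)) \<le> (\<Sum>i<d ^ n. \<bar>ltens d (\<lambda>x. eL d (W x)) x i\<bar>)"
    unfolding st(2) by (rule rtr_contr_fc_le[OF st(1) U])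
  also have "\<dots> = 1" using st(3,4) by simp
  finally show ?thesis .
qed

lemma rtr_contr_mixture_le:
  assumes W: "cq_channel d (W :: 'x::finite \<Rightarrow> complex mat)" and r: "distr_on (seqs n) r" and U: "contr U"
  shows "rtr (U * (\<Sum>x\<in>seqs n. r x *\<^sub>R op (tensor_channel W x))) \<le> 1"
proof -
  have "rtr (U * (\<Sum>x\<in>seqs n. r x *\<^sub>R op (tensor_channel W x))) = (\<Sum>x\<in>seqs n. r x * rtr (U * op (tensor_channel W x)))"
    by (simp add: sum_distrib_left rtr_sum rtr_scaleR)
  also have "\<dots> \<le> (\<Sum>x\<in>seqs n. r x * 1)"
    using r by (intro sum_mono mult_left_mono rtr_contr_state_le[OF W _ U]) (auto simp: distr_on_def)
  finally show ?thesis using r by (simp add: distr_on_def)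
qed

lemma trace_norm_mixture_diff_le:
  assumes W: "cq_channel d (W :: 'x::finite \<Rightarrow> complex mat)" and p: "distr_on (seqs n) p" and q: "distr_on (seqs n) q"
  shows "trace_norm (mixn d n W p - mixn d n W q) \<le> 2"
proof -
  let ?mix = "mixn d n W"
  have mc: "?mix r \<in> carrier_mat (d ^ n) (d ^ n)" for r by (rule mixture_carrier)
  obtain V where V: "contr V" "trace_norm (?mix p - ?mix q) = rtr (V * op (?mix p - ?mix q))"
    using trace_norm_attained[OF minus_carrier_mat[OF mc]] by blast
  have "rtr (V * op (?mix p - ?mix q)) = rtr (V * op (?mix p)) + rtr (- V * op (?mix q))"
    unfolding op_diff[OF mc mc] by (simp add: right_diff_distrib flip: rtr_add)
  then show ?thesis
    using rtr_contr_mixture_le[OF W p V(1)] rtr_contr_mixture_le[OF W q contr_uminus[OF V(1)]] V(2)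
    by (simp add: op_mixture_seqs[OF W])
qed

lemma resol_err_le:
  assumes W: "cq_channel d (W :: 'x::finite \<Rightarrow> complex mat)"
    and q: "\<And>p. distr_on (seqs n) p \<Longrightarrow> \<exists>q. type_distr n M q \<and>
      trace_norm (mixn d n W p - mixn d n W q) \<le> 2 * e"
  shows "resol_err d W n M \<le> e"
  unfolding resol_err_def
proof (rule cSUP_least)
  have "distr_on (seqs n) (emp [replicate n (undefined :: 'x)])"
    by (rule distr_emp[OF finite_seqs]) (auto simp: seqs_def)
  then show "{p. distr_on (seqs n :: 'x list set) p} \<noteq> {}" by blast
next
  fix p assume "p \<in> {p. distr_on (seqs n :: 'x list set) p}"
  then obtain r where r: "type_distr n M r"
    "trace_norm (mixn d n W p - mixn d n W r) \<le> 2 * e"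
    using q by blast
  show "(INF q\<in>{q. type_distr n M q}. trace_norm (mixn d n W p
      - mixn d n W q) / 2) \<le> e"
  proof (rule cINF_lower2)
    show "bdd_below ((\<lambda>q. trace_norm (mixn d n W p
      - mixn d n W q) / 2) ` {q. type_distr n M q})"
      by (rule bdd_belowI2[of _ 0])
        (simp add: trace_norm_nonneg[OF minus_carrier_mat[OF mixture_carrier]])
  qed (use r in auto)
qed

text \<open>The supremum over inputs is bounded because two output states are at halved trace
  distance at most 1; \<open>0 < M\<close> provides an \<open>M\<close>-type to witness
  this.\<close>

lemma resol_err_ge:
  assumes W: "cq_channel d (W :: 'x::finite \<Rightarrow> complex mat)" and M: "0 < M" and p: "distr_on (seqs n) p"
  shows "(INF q\<in>{q. type_distr n M q}. trace_norm (mixn d n W p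
      - mixn d n W q) / 2) \<le> resol_err d W n M"
  unfolding resol_err_def
proof (rule cSUP_upper)
  obtain r :: "'x list \<Rightarrow> real" where r: "type_distr n M r" using type_distr_exists[OF M] by blast
  then have r': "distr_on (seqs n) r" by (simp add: type_distr_def)
  show "bdd_above ((\<lambda>p. INF q\<in>{q. type_distr n M q}. trace_norm (mixn d n W p
      - mixn d n W q) / 2) ` {p. distr_on (seqs n) p})"
  proof (rule bdd_aboveI2[of _ _ 1])
    fix p' assume "p' \<in> {p. distr_on (seqs n :: 'x list set) p}"
    then have p': "distr_on (seqs n) p'" by simp
    show "(INF q\<in>{q. type_distr n M q}. trace_norm (mixn d n W p'
      - mixn d n W q) / 2) \<le> 1"
    proof (rule cINF_lower2)
      show "bdd_below ((\<lambda>q. trace_norm (mixn d n W p'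
        - mixn d n W q) / 2) ` {q. type_distr n M q})"
        by (rule bdd_belowI2[of _ 0])
          (simp add: trace_norm_nonneg[OF minus_carrier_mat[OF mixture_carrier]])
      show "trace_norm (mixn d n W p'
        - mixn d n W r) / 2 \<le> 1"
        using trace_norm_mixture_diff_le[OF W p' r'] by simp
    qed (use r in auto)
  qed
qed (use p in auto)

lemma resol_err_nonneg:
  assumes W: "cq_channel d (W :: 'x::finite \<Rightarrow> complex mat)" and M: "0 < M"
  shows "0 \<le> resol_err d W n M"
proof -
  have p: "distr_on (seqs n) (emp [replicate n (undefined :: 'x)])"
    by (rule distr_emp[OF finite_seqs]) (auto simp: seqs_def)
  have "0 \<le> (INF q\<in>{q. type_distr n M q}. trace_norm (mixn d n W (emp [replicate n (undefined :: 'x)])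
      - mixn d n W q) / 2)"
    by (rule cINF_greatest)
      (use type_distr_exists[OF M] in \<open>auto simp: trace_norm_nonneg[OF minus_carrier_mat[OF mixture_carrier]]\<close>)
  then show ?thesis using resol_err_ge[OF W M p] by linarith
qed

lemma resol_err_upper:
  fixes W :: "'x::finite \<Rightarrow> complex mat" and \<delta> :: real
  assumes W: "cq_channel d W" and n: "0 < n" and M: "0 < M" and t: "0 \<le> t" "t \<le> 1 / 2"
  defines "\<tau> \<equiv> exp (real n * (16 * real d * t\<^sup>2 - t * \<delta>))"
  shows "resol_err d W n M \<le> \<tau> + sqrt \<tau> + (real n + 1) ^ card (UNIV :: 'x set) *
    sqrt (exp (real n * (ln 2 * cq_capacity d W + 2 * \<delta>)) / real M)"
proof (rule resol_err_le[OF W])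
  fix p assume p: "distr_on (seqs n :: 'x list set) p"
  let ?c = "(real n + 1) ^ card (UNIV :: 'x set) *
    sqrt (exp (real n * (ln 2 * cq_capacity d W + 2 * \<delta>)) / real M)"
  have e: "real ((n + 1) ^ card (UNIV :: 'x set)) = (real n + 1) ^ card (UNIV :: 'x set)"
    by (simp add: add.commute)
  obtain q where q: "type_distr n M q"
    "trace_norm (mixn d n W p - mixn d n W q)
    \<le> 2 * (\<tau> + sqrt \<tau>) + ?c"
    using covering[OF W n M t p, of \<delta>] unfolding \<tau>_def e by blast
  have *: "0 \<le> c \<Longrightarrow> 2 * x + c \<le> 2 * (x + c)" for x c :: real by simp
  have "2 * (\<tau> + sqrt \<tau>) + ?c \<le> 2 * (\<tau> + sqrt \<tau> + ?c)" by (rule *) simp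
  then show "\<exists>q. type_distr n M q \<and> trace_norm (mixn d n W p - mixn d n W q)
    \<le> 2 * (\<tau> + sqrt \<tau> + ?c)"
    using q order_trans by blast
qed

section \<open>Converse\<close>

text \<open>Exponential Markov inequality at parameter 1, with \<open>exp g <= 1 + 2 g\<close> on
  the unit interval. The bound is informative when \<open>\<eta> > 2 m\<close>, and then
  exponentially small in \<open>N\<close>, which will itself be exponential in the block
  length.\<close>

lemma chernoff:
  assumes p: "\<And>x. x \<in> S \<Longrightarrow> 0 \<le> p x" "sum p S = 1"
    and g: "\<And>x. x \<in> S \<Longrightarrow> 0 \<le> g x" "\<And>x. x \<in> S \<Longrightarrow> g x \<le> 1" and m: "(\<Sum>x\<in>S. p x * g x) \<le> m"
  shows "iexp S p N (\<lambda>xs. if real N * \<eta> \<le> sum_list (map g xs) then 1 else 0) \<le> exp (real N * (2 * m - \<eta>))"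
proof -
  have ep: "exp (sum_list (map g xs)) = prod_list (map (\<lambda>x. exp (g x)) xs)" for xs
    by (induction xs) (auto simp: exp_add)
  have "(\<Sum>x\<in>S. p x * exp (g x)) \<le> (\<Sum>x\<in>S. p x * (1 + 2 * g x))"
  proof (intro sum_mono mult_left_mono p)
    fix x assume x: "x \<in> S"
    have "exp (g x) \<le> 1 + g x + (g x)\<^sup>2" using exp_bound g x by blast
    also have "(g x)\<^sup>2 \<le> g x * 1" unfolding power2_eq_square using g x by (intro mult_left_mono) auto
    finally show "exp (g x) \<le> 1 + 2 * g x" by simp
  qed
  also have "\<dots> = 1 + 2 * (\<Sum>x\<in>S. p x * g x)"
    by (simp add: distrib_left sum.distrib p(2) sum_distrib_left mult.left_commute)
  also have "\<dots> \<le> 1 + 2 * m" using m by simp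
  also have "\<dots> \<le> exp (2 * m)" by (rule exp_ge_add_one_self)
  finally have le: "(\<Sum>x\<in>S. p x * exp (g x)) \<le> exp (2 * m)" .
  have "iexp S p N (\<lambda>xs. if real N * \<eta> \<le> sum_list (map g xs) then 1 else 0)
    \<le> iexp S p N (\<lambda>xs. exp (- (real N * \<eta>)) * prod_list (map (\<lambda>x. exp (g x)) xs))"
    by (rule iexp_mono[OF p(1)]) (auto simp flip: ep exp_add)
  also have "\<dots> = exp (- (real N * \<eta>)) * (\<Sum>x\<in>S. p x * exp (g x)) ^ N"
    by (simp add: iexp_cmult iexp_prod)
  also have "\<dots> \<le> exp (- (real N * \<eta>)) * exp (2 * m) ^ N"
    using p(1) by (intro mult_left_mono power_mono le sum_nonneg) auto
  finally show ?thesis by (simp add: algebra_simps flip: exp_add exp_of_nat_mult)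
qed

lemma list_with_counts:
  assumes "finite S" shows "\<exists>zs. set zs \<subseteq> S \<and> (\<forall>x\<in>S. count_list zs x = k x)"
  using assms
proof (induction S rule: finite_induct)
  case (insert x S)
  then obtain zs where zs: "set zs \<subseteq> S" "\<forall>x\<in>S. count_list zs x = k x" by blast
  have rep: "count_list (replicate m x) y = (if y = x then m else 0)" for m y
    by (induction m) auto
  show ?case
    by (rule exI[of _ "zs @ replicate (k x) x"])
      (use zs insert.hyps in \<open>auto simp: rep count_list_0_iff\<close>)
qed simp

text \<open>The numbers \<open>M q(x)\<close> are nonnegative integers with sum \<open>M\<close>, so
  they are the multiplicities of a list of \<open>M\<close> codewords. Counting such lists therefore
  bounds the number of \<open>M\<close>-types.\<close>

lemma type_distr_emp_ex:
  fixes q :: "'x::finite list \<Rightarrow> real"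
  assumes "type_distr n M q" "0 < M"
  shows "\<exists>zs. length zs = M \<and> set zs \<subseteq> seqs n \<and> (\<forall>x\<in>seqs n. q x = emp zs x)"
proof -
  define k where "k x = nat \<lfloor>real M * q x\<rfloor>" for x
  have k: "real (k x) = real M * q x" if "x \<in> seqs n" for x
  proof -
    have "real M * q x \<in> \<int>" "0 \<le> real M * q x"
      using assms that by (auto simp: type_distr_def distr_on_def)
    then show ?thesis unfolding k_def by (auto elim!: Ints_cases)
  qed
  obtain zs where zs: "set zs \<subseteq> seqs n" "\<forall>x\<in>seqs n. count_list zs x = k x"
    using list_with_counts[OF finite_seqs, of n k] by blast
  have "real (length zs) = (\<Sum>x\<in>seqs n. real (count_list zs x))"
    using sum_count_set[OF zs(1) finite_seqs] by (simp flip: of_nat_sum)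
  also have "\<dots> = (\<Sum>x\<in>seqs n. real M * q x)" by (intro sum.cong refl) (simp add: zs(2) k)
  also have "\<dots> = real M" using assms by (simp add: type_distr_def distr_on_def flip: sum_distrib_left)
  finally have len: "length zs = M" by simp
  have "q x = emp zs x" if "x \<in> seqs n" for x
    using zs(2) k[OF that] that assms(2) by (simp add: emp_def len field_simps)
  then show ?thesis using zs(1) len by blast
qed

lemma rtr_sandwich_nonneg:
  assumes "uni D u" "\<And>i. i < D \<Longrightarrow> 0 \<le> l i"
  shows "rtr (adj X * fc D u l * X) = (norm (fc D u (\<lambda>i. sqrt (l i)) * X))\<^sup>2"
proof -
  have "fc D u l = fc D u (\<lambda>i. sqrt (l i)) * fc D u (\<lambda>i. sqrt (l i))"
    unfolding fc_mult[OF assms(1)] by (rule fc_cong) (use assms(2) in auto)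
  then show ?thesis by (simp add: norm_sq mult.assoc)
qed

lemma state_sandwich_nonneg:
  assumes "cq_channel d W" "x \<in> seqs n"
  shows "0 \<le> rtr (adj X * op (tensor_channel W x) * X)"
proof -
  have "length x = n" using assms(2) by (simp add: seqs_def)
  note st = tensor_state_fc[OF assms(1) this]
  show ?thesis using rtr_sandwich_nonneg[OF st(1,3), where X = X] by (simp add: st(2))
qed

lemma state_car_adj:
  assumes "cq_channel d W" "x \<in> seqs n"
  shows "car (d ^ n) (op (tensor_channel W x))" "adj (op (tensor_channel W x)) = op (tensor_channel W x)"
    "rtr (op (tensor_channel W x)) = 1"
proof -
  have "length x = n" using assms(2) by (simp add: seqs_def)
  note st = tensor_state_fc[OF assms(1) this]
  show "car (d ^ n) (op (tensor_channel W x))" "adj (op (tensor_channel W x)) = op (tensor_channel W x)"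
    "rtr (op (tensor_channel W x)) = 1"
    using car_fc[OF st(1)] st by (simp_all add: rtr_fc[OF st(1)])
qed

lemma mixture_spectral:
  assumes W: "cq_channel d (W :: 'x::finite \<Rightarrow> complex mat)" and r: "distr_on (seqs n) r"
  defines "\<rho> \<equiv> (\<Sum>x\<in>seqs n. r x *\<^sub>R op (tensor_channel W x))"
  shows "car (d ^ n) \<rho>" "adj \<rho> = \<rho>" "rtr \<rho> = 1"
    "\<exists>z k. uni (d ^ n) z \<and> \<rho> = fc (d ^ n) z k \<and> (\<forall>i<d ^ n. 0 \<le> k i) \<and> (\<Sum>i<d ^ n. k i) = 1"
proof -
  show c: "car (d ^ n) \<rho>" unfolding \<rho>_def by (intro car_sum car_scaleR state_car_adj[OF W])
  show a: "adj \<rho> = \<rho>" unfolding \<rho>_def by (simp add: state_car_adj[OF W])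
  show t: "rtr \<rho> = 1" using r unfolding \<rho>_def by (simp add: rtr_sum rtr_scaleR state_car_adj[OF W] distr_on_def)
  obtain z k where z: "uni (d ^ n) z" "\<rho> = fc (d ^ n) z k" using spectral[OF c a] by blast
  have "0 \<le> k i" if "i < d ^ n" for i
  proof -
    let ?e = "fc (d ^ n) z (\<lambda>j. if j = i then 1 else 0)"
    have "rtr (adj ?e * \<rho> * ?e) = (\<Sum>x\<in>seqs n. r x * rtr (adj ?e * op (tensor_channel W x) * ?e))"
      unfolding \<rho>_def by (simp add: sum_distrib_left sum_distrib_right rtr_sum rtr_scaleR)
    also have "\<dots> \<ge> 0"
      using r by (intro sum_nonneg mult_nonneg_nonneg state_sandwich_nonneg[OF W]) (auto simp: distr_on_def)
    finally have "0 \<le> rtr (adj ?e * \<rho> * ?e)" .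
    also have "rtr (adj ?e * \<rho> * ?e) = k i"
      using that by (simp add: z(2) fc_mult[OF z(1)] rtr_fc[OF z(1)] if_distrib cong: if_cong)
    finally show ?thesis .
  qed
  moreover have "(\<Sum>i<d ^ n. k i) = 1" using t by (simp add: z rtr_fc[OF z(1)])
  ultimately show "\<exists>z k. uni (d ^ n) z \<and> \<rho> = fc (d ^ n) z k \<and> (\<forall>i<d ^ n. 0 \<le> k i) \<and> (\<Sum>i<d ^ n. k i) = 1"
    using z by blast
qed

section \<open>Projections as tests\<close>

definition proj :: "nat \<Rightarrow> fmat \<Rightarrow> bool" where
  "proj D T \<longleftrightarrow> car D T \<and> adj T = T \<and> T * T = T"

lemma proj_fc:
  assumes "uni D u" shows "proj D (fc D u (\<lambda>i. if A i then 1 else 0))"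
  unfolding proj_def fc_mult[OF assms]
  by (intro conjI car_fc[OF assms] adj_fc fc_cong) auto

lemma proj_compl:
  assumes "proj D T" shows "proj D (one D - T)"
  using assms by (auto simp: proj_def left_diff_distrib right_diff_distrib one_left one_right car_dg intro: car_diff)

lemma proj_norm_sq: assumes "proj D T" shows "(norm (T * X))\<^sup>2 = rtr (adj X * T * X)"
proof -
  have T: "adj T = T" "T * T = T" using assms by (auto simp: proj_def)
  have "(norm (T * X))\<^sup>2 = rtr (adj X * (T * T) * X)" by (simp add: norm_sq T(1) mult.assoc)
  then show ?thesis by (simp only: T(2))
qed

lemma proj_contr: assumes "proj D T" shows "contr T"
  unfolding contr_def
proof
  fix X
  have "(norm (T * X))\<^sup>2 = rtr (adj X * (T * X))" by (simp add: proj_norm_sq[OF assms] mult.assoc)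
  also have "\<dots> \<le> norm (adj X) * norm (T * X)" by (rule rtr_mult_le)
  finally have "norm (T * X) * norm (T * X) \<le> norm X * norm (T * X)"
    by (simp add: norm_adj power2_eq_square)
  then show "norm (T * X) \<le> norm X"
    by (metis mult_le_cancel_right norm_ge_zero order.trans not_less)
qed

lemma term_le_sum_list:
  fixes f :: "'a \<Rightarrow> real"
  assumes "y \<in> set ys" "\<And>x. x \<in> set ys \<Longrightarrow> 0 \<le> f x"
  shows "f y \<le> sum_list (map f ys)"
  using assms
proof (induction ys)
  case (Cons x ys)
  have "0 \<le> sum_list (map f ys)" using Cons.prems(2) by (intro sum_list_nonneg) auto
  then show ?case using Cons by (auto intro: order_trans add_increasing)
qed simp

lemma rtr_minus: "rtr (- A) = - rtr A"
  using rtr_scaleR[of "- 1" A] by simp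

text \<open>\<open>T\<close> projects onto the positive part of
  \<open>\<tau> - \<gamma> \<sigma>'\<close>. The difference has nonnegative trace there, so
  \<open>\<gamma>\<close> times the weight of \<open>\<sigma>'\<close> is at most the weight of
  \<open>\<tau>\<close>, which is at most 1. On the complement the difference is negative
  semidefinite, a fact recorded through its values on compressed projections
  \<open>P\<close>.\<close>

lemma neyman_pearson:
  assumes \<tau>: "car D \<tau>" "adj \<tau> = \<tau>" "\<And>T. contr T \<Longrightarrow> rtr (T * \<tau>) \<le> 1"
    and \<sigma>: "car D \<sigma>'" "adj \<sigma>' = \<sigma>'" and \<gamma>: "0 < \<gamma>"
  shows "\<exists>T. proj D T \<and> rtr (T * \<sigma>') \<le> 1 / \<gamma> \<and>
    (\<forall>P. proj D P \<longrightarrow> rtr ((one D - T) * P * (one D - T) * \<tau>) \<le> \<gamma> * rtr ((one D - T) * P * (one D - T) * \<sigma>'))"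
proof -
  have "car D (\<tau> - \<gamma> *\<^sub>R \<sigma>')" "adj (\<tau> - \<gamma> *\<^sub>R \<sigma>') = \<tau> - \<gamma> *\<^sub>R \<sigma>'"
    using \<tau> \<sigma> by (simp_all add: car_diff car_scaleR)
  then obtain w h where w: "uni D w" "\<tau> - \<gamma> *\<^sub>R \<sigma>' = fc D w h" using spectral by blast
  let ?T = "fc D w (\<lambda>i. if 0 < h i then 1 else 0)"
  have T: "proj D ?T" by (rule proj_fc[OF w(1)])
  have "0 \<le> rtr (?T * (\<tau> - \<gamma> *\<^sub>R \<sigma>'))"
    unfolding w(2) fc_mult[OF w(1)] rtr_fc[OF w(1)] by (intro sum_nonneg) auto
  then have "\<gamma> * rtr (?T * \<sigma>') \<le> rtr (?T * \<tau>)" by (simp add: right_diff_distrib rtr_diff rtr_scaleR)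
  also have "\<dots> \<le> 1" by (intro \<tau>(3) proj_contr[OF T])
  finally have 1: "rtr (?T * \<sigma>') \<le> 1 / \<gamma>" using \<gamma> by (simp add: field_simps)
  have Q: "one D - ?T = fc D w (\<lambda>i. if 0 < h i then 0 else 1)"
    unfolding fc_one[OF w(1), symmetric] fc_diff by (rule fc_cong) auto
  have "rtr ((one D - ?T) * P * (one D - ?T) * \<tau>) \<le> \<gamma> * rtr ((one D - ?T) * P * (one D - ?T) * \<sigma>')"
    if P: "proj D P" for P
  proof -
    let ?Q = "one D - ?T" and ?R = "fc D w (\<lambda>i. sqrt (if 0 < h i then 0 else - h i))"
    have "?Q * fc D w h * ?Q = - 1 *\<^sub>R (?R * ?R)"
      unfolding Q fc_mult[OF w(1)] fc_scaleR by (rule fc_cong) auto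
    moreover have "rtr (?Q * P * ?Q * fc D w h) = rtr (P * (?Q * fc D w h * ?Q))"
      using rtr_comm[of ?Q "P * ?Q * fc D w h"] by (simp only: mult.assoc)
    ultimately have "rtr (?Q * P * ?Q * fc D w h) = - rtr (P * (?R * ?R))"
      by (simp add: rtr_minus)
    also have "rtr (P * (?R * ?R)) = (norm (P * ?R))\<^sup>2"
      unfolding proj_norm_sq[OF P] using rtr_comm[of "P * ?R" ?R] by (simp add: mult.assoc)
    finally have "rtr (?Q * P * ?Q * (\<tau> - \<gamma> *\<^sub>R \<sigma>')) \<le> 0" by (simp add: w(2))
    then show ?thesis by (simp only: right_diff_distrib rtr_diff mult_scaleR_right rtr_scaleR)
  qed
  then show ?thesis using T 1 by blast
qed

text \<open>For \<open>G = Q P Q\<close> the matrix \<open>2 G - 1\<close> is a contraction, and as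
  \<open>op A\<close> has trace 0 this gains a factor 1/2 over testing with \<open>G\<close>
  itself.\<close>

lemma trace_norm_test:
  assumes A: "A \<in> carrier_mat D D" and T: "proj D Q" "proj D P" and tr: "rtr (op A) = 0"
  shows "rtr (Q * P * Q * op A) \<le> trace_norm A / 2"
proof -
  define G where "G = Q * P * Q"
  have adjG: "adj G = G" using T by (simp add: G_def proj_def mult.assoc)
  have cG: "car D G" using T by (simp add: G_def proj_def car_times)
  have "contr (2 *\<^sub>R G - one D)"
    unfolding contr_def
  proof
    fix X
    define Y where "Y = one D * X"
    have GX: "G * X = G * Y" unfolding Y_def by (simp add: one_right[OF cG] flip: mult.assoc)
    have "inner (G * X) Y = rtr (adj X * G * Y)" by (simp add: inner_fmat_def adjG mult.assoc)
    also have "\<dots> = rtr (adj (Q * X) * P * (Q * X))"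
      using T by (simp add: mult.assoc proj_def flip: GX) (simp add: G_def mult.assoc)
    also have "\<dots> = (norm (P * (Q * X)))\<^sup>2" by (rule proj_norm_sq[OF T(2), symmetric])
    also have "\<dots> \<ge> (norm (G * X))\<^sup>2"
      using contrD[OF proj_contr[OF T(1)], of "P * (Q * X)"] by (simp add: G_def mult.assoc power_mono)
    \<comment> \<open>\<open>G^2 <= G\<close> as quadratic forms, which yields the contraction
      property.\<close>
    finally have *: "(norm (G * X))\<^sup>2 \<le> inner (G * X) Y" .
    have "(norm ((2 *\<^sub>R G - one D) * X))\<^sup>2 = (norm (2 *\<^sub>R (G * X) - Y))\<^sup>2"
      by (simp add: left_diff_distrib Y_def)
    also have "\<dots> = 4 * (norm (G * X))\<^sup>2 - 4 * inner (G * X) Y + (norm Y)\<^sup>2"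
      by (simp add: power2_norm_eq_inner inner_diff_left inner_diff_right inner_commute)
    also have "\<dots> \<le> (norm Y)\<^sup>2" using * by simp
    also have "\<dots> \<le> (norm X)\<^sup>2" unfolding Y_def by (intro power_mono contrD contr_one) simp
    finally show "norm ((2 *\<^sub>R G - one D) * X) \<le> norm X" by (rule power2_le_imp_le) simp
  qed
  from rtr_contr_le_trace_norm[OF A this] show ?thesis
    by (simp add: left_diff_distrib rtr_diff rtr_scaleR one_left[OF car_op[OF A]] tr G_def)
qed

text \<open>The root \<open>r\<close> of the state has norm 1 and splits as
  \<open>P Q r + (1 - P) r + P T r\<close> with \<open>Q = 1 - T\<close>. The triangle inequality
  shows that two possibly noncommuting tests, each passed with high probability, are also passed in
  succession.\<close>

lemma gentle:
  assumes z: "uni D z" "\<And>i. i < D \<Longrightarrow> 0 \<le> k i" "(\<Sum>i<D. k i) = 1"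
    and T: "proj D T" and P: "proj D P"
    and \<alpha>: "rtr (T * fc D z k) \<le> \<alpha>" and \<beta>: "rtr ((one D - P) * fc D z k) \<le> \<beta>"
    and le: "sqrt \<alpha> + sqrt \<beta> \<le> 1"
  shows "(1 - sqrt \<alpha> - sqrt \<beta>)\<^sup>2 \<le> rtr ((one D - T) * P * (one D - T) * fc D z k)"
proof -
  let ?r = "fc D z (\<lambda>i. sqrt (k i))" and ?Q = "one D - T"
  have rr: "?r * ?r = fc D z k" unfolding fc_mult[OF z(1)] by (rule fc_cong) (use z(2) in auto)
  have cr: "car D ?r" by (rule car_fc[OF z(1)])
  have n: "(norm (X * ?r))\<^sup>2 = rtr (X * fc D z k)" if "proj D X" for X
    unfolding proj_norm_sq[OF that] using rtr_comm[of "X * ?r" ?r] by (simp add: mult.assoc flip: rr)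
  have "norm ?r = 1"
  proof -
    have "(\<Sum>i<D. (sqrt (k i))\<^sup>2) = 1" using z(2,3) by simp
    then show ?thesis by (simp add: norm_fc[OF z(1)])
  qed
  moreover have "?r = P * (?Q * ?r) + (one D - P) * ?r + P * (T * ?r)"
    by (simp add: left_diff_distrib right_diff_distrib one_left[OF cr])
  ultimately have "1 \<le> norm (P * (?Q * ?r)) + norm ((one D - P) * ?r) + norm (P * (T * ?r))"
    by (metis norm_triangle_ineq norm_triangle_le add_mono order_refl)
  also have "norm ((one D - P) * ?r) \<le> sqrt \<beta>"
    using n[OF proj_compl[OF P]] \<beta> by (simp add: real_le_rsqrt)
  also have "norm (P * (T * ?r)) \<le> norm (T * ?r)" by (rule contrD[OF proj_contr[OF P]])
  also have "norm (T * ?r) \<le> sqrt \<alpha>" using n[OF T] \<alpha> by (simp add: real_le_rsqrt)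
  finally have "1 - sqrt \<alpha> - sqrt \<beta> \<le> norm (P * (?Q * ?r))" by simp
  then have "(1 - sqrt \<alpha> - sqrt \<beta>)\<^sup>2 \<le> (norm (P * (?Q * ?r)))\<^sup>2" using le by (intro power_mono) auto
  also have "\<dots> = rtr (?Q * P * ?Q * fc D z k)"
  proof -
    have "(norm (P * (?Q * ?r)))\<^sup>2 = rtr (adj (?Q * ?r) * P * (?Q * ?r))" by (rule proj_norm_sq[OF P])
    also have "adj (?Q * ?r) = ?r * ?Q" using T by (simp add: proj_def)
    also have "rtr (?r * ?Q * P * (?Q * ?r)) = rtr (?Q * P * ?Q * (?r * ?r))"
      using rtr_comm[of ?r "?Q * P * (?Q * ?r)"] by (simp only: mult.assoc)
    finally show ?thesis by (simp only: rr)
  qed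
  finally show ?thesis .
qed

text \<open>The witness is the spectral projection of \<open>\<rho>\<close> onto the eigenvalues above \<open>a \<eta> / N\<close>.
  Off its range each of the averaged states, being at most \<open>N \<rho>\<close>, is below \<open>a \<eta>\<close>, which is negligible
  on the at most \<open>1 / a\<close> eigenvectors with eigenvalue above \<open>a\<close>.\<close>
lemma average_projection:
  assumes W: "cq_channel d (W :: 'x::finite \<Rightarrow> complex mat)"
    and ys: "set ys \<subseteq> seqs n" "length ys = N" "0 < N" and a: "0 < a" and \<eta>: "0 < \<eta>"
    and \<kappa>: "\<And>xs. \<kappa> xs = (\<Sum>i<d ^ n. if evs d W xs i < a then evs d W xs i else 0)"
  defines "\<rho> \<equiv> (\<Sum>x\<in>seqs n. emp ys x *\<^sub>R op (tensor_channel W x))"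
  shows "\<exists>P. proj (d ^ n) P \<and> rtr P \<le> real N / (a * \<eta>) \<and>
    rtr ((one (d ^ n) - P) * \<rho>) \<le> sum_list (map \<kappa> ys) / real N + sqrt \<eta>"
proof -
  define D where "D = d ^ n"
  have demp: "distr_on (seqs n) (emp ys)" using ys by (intro distr_emp finite_seqs) auto
  obtain z k where z: "uni D z" "\<rho> = fc D z k" "\<And>i. i < D \<Longrightarrow> 0 \<le> k i" "(\<Sum>i<D. k i) = 1"
    using mixture_spectral(4)[OF W demp] unfolding \<rho>_def[symmetric] D_def by blast
  \<comment> \<open>With \<open>N * c = a * \<eta>\<close>, domination of a single state by
    \<open>N * \<rho>\<close> turns the cut-off for \<open>\<rho>\<close> into
    \<open>a * \<eta>\<close> for each state.\<close>
  define c where "c = a * \<eta> / real N"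
  have c: "0 < c" using a \<eta> ys by (simp add: c_def)
  define P where "P = fc D z (\<lambda>i. if c \<le> k i then 1 else 0)"
  define Q where "Q = fc D z (\<lambda>i. if c \<le> k i then 0 else 1)"
  have P: "proj D P" unfolding P_def by (rule proj_fc[OF z(1)])
  have Q: "one D - P = Q" unfolding Q_def P_def fc_one[OF z(1), symmetric] fc_diff by (rule fc_cong) auto
  have pQ: "proj D Q" unfolding Q[symmetric] by (rule proj_compl[OF P])
  have "rtr P \<le> (\<Sum>i<D. k i / c)"
    unfolding P_def rtr_fc[OF z(1)] by (intro sum_mono) (use z(3) c in \<open>auto simp: field_simps\<close>)
  also have "\<dots> = real N / (a * \<eta>)" unfolding sum_divide_distrib[symmetric] z(4) by (simp add: c_def)
  finally have rank: "rtr P \<le> real N / (a * \<eta>)" .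
  have single: "rtr (Q * op (tensor_channel W y)) \<le> \<kappa> y + sqrt \<eta>" if y: "y \<in> set ys" for y
  proof -
    have yS: "y \<in> seqs n" using y ys by auto
    then have len: "length y = n" by (simp add: seqs_def)
    define u where "u = op (tensor_channel (\<lambda>x. eU d (W x)) y)"
    define l where "l = ltens d (\<lambda>x. eL d (W x)) y"
    note st = tensor_state_fc[OF W len, folded u_def l_def D_def]
    define L where "L = fc D u (\<lambda>i. if l i < a then 0 else 1)"
    define q where "q = fc D u (\<lambda>i. sqrt (l i))"
    have cq: "contr Q" by (rule proj_contr[OF pQ])
    have sq: "norm (q * (Q * X)) \<le> sqrt (a * \<eta>) * norm X" for X
    proof -
      let ?Y = "Q * X"
      have "(norm (q * ?Y))\<^sup>2 = rtr (adj ?Y * op (tensor_channel W y) * ?Y)"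
        unfolding q_def st(2) by (rule rtr_sandwich_nonneg[OF st(1,3), symmetric])
      also have "\<dots> \<le> (\<Sum>x\<leftarrow>ys. rtr (adj ?Y * op (tensor_channel W x) * ?Y))"
        by (intro term_le_sum_list[where f = "\<lambda>x. rtr (adj ?Y * op (tensor_channel W x) * ?Y)"]
            state_sandwich_nonneg[OF W, of _ n]) (use y ys(1) in auto)
      also have "\<dots> = real N * rtr (adj ?Y * \<rho> * ?Y)"
      proof -
        have "rtr (adj ?Y * \<rho> * ?Y) = (\<Sum>x\<in>seqs n. emp ys x *\<^sub>R rtr (adj ?Y * op (tensor_channel W x) * ?Y))"
          unfolding \<rho>_def by (simp add: sum_distrib_left sum_distrib_right rtr_sum rtr_scaleR)
        also have "\<dots> = (1 / real N) *\<^sub>R (\<Sum>x\<leftarrow>ys. rtr (adj ?Y * op (tensor_channel W x) * ?Y))"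
          unfolding emp_sum[OF finite_seqs ys(1)] ys(2) ..
        finally show ?thesis using ys(3) by simp
      qed
      also have "rtr (adj ?Y * \<rho> * ?Y) = (norm (fc D z (\<lambda>i. sqrt (k i)) * ?Y))\<^sup>2"
        unfolding z(2) by (rule rtr_sandwich_nonneg[OF z(1,3)])
      also have "fc D z (\<lambda>i. sqrt (k i)) * ?Y = fc D z (\<lambda>i. if c \<le> k i then 0 else sqrt (k i)) * X"
      proof -
        have "fc D z (\<lambda>i. sqrt (k i)) * Q = fc D z (\<lambda>i. if c \<le> k i then 0 else sqrt (k i))"
          unfolding Q_def fc_mult[OF z(1)] by (rule fc_cong) auto
        then show ?thesis by (simp flip: mult.assoc)
      qed
      also have "(norm (fc D z (\<lambda>i. if c \<le> k i then 0 else sqrt (k i)) * X))\<^sup>2 \<le> (sqrt c * norm X)\<^sup>2"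
        by (intro power_mono norm_fc_mult_bound[OF z(1)]) (use z(3) c in auto)
      also have "real N * (sqrt c * norm X)\<^sup>2 = (sqrt (a * \<eta>) * norm X)\<^sup>2"
        using c a \<eta> ys(3) by (simp add: power_mult_distrib c_def)
      finally have "(norm (q * ?Y))\<^sup>2 \<le> (sqrt (a * \<eta>) * norm X)\<^sup>2" using ys(3) by simp
      then show ?thesis by (rule power2_le_imp_le) (use a \<eta> in simp)
    qed
    have nL: "norm L \<le> 1 / sqrt a"
    proof -
      have "(\<Sum>i<D. (if l i < a then 0 else 1)\<^sup>2) \<le> (\<Sum>i<D. l i / a)"
        by (intro sum_mono) (use st(3) a in \<open>auto simp: field_simps\<close>)
      also have "\<dots> = 1 / a" by (simp add: st(4) flip: sum_divide_distrib)
      finally have "sqrt (\<Sum>i<D. (if l i < a then 0 else 1)\<^sup>2) \<le> sqrt (1 / a)"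
        by (rule real_sqrt_le_mono)
      then show ?thesis
        unfolding L_def norm_fc[OF st(1)] by (simp only: real_sqrt_divide real_sqrt_one)
    qed
    have nq: "norm q = 1"
    proof -
      have "(\<Sum>i<D. (sqrt (l i))\<^sup>2) = 1" using st(3,4) by simp
      then show ?thesis by (simp add: q_def norm_fc[OF st(1)])
    qed
    \<comment> \<open>The small eigenvalues are charged to \<open>\<kappa>\<close>; the large ones,
      at most \<open>1 / a\<close> in number, are written as \<open>q * q * L\<close> so that one
      root can meet both \<open>Q\<close> and \<open>L\<close> while the other has norm 1.\<close>
    have "op (tensor_channel W y) = fc D u (\<lambda>i. if l i < a then l i else 0) + q * q * L"
      unfolding st(2) q_def L_def fc_mult[OF st(1)] fc_add by (rule fc_cong) (use st(3) in auto)
    then have "rtr (Q * op (tensor_channel W y))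
        = rtr (Q * fc D u (\<lambda>i. if l i < a then l i else 0)) + rtr (Q * (q * q * L))"
      by (simp add: distrib_left rtr_add)
    also have "rtr (Q * fc D u (\<lambda>i. if l i < a then l i else 0)) \<le> (\<Sum>i<D. \<bar>if l i < a then l i else 0\<bar>)"
      by (rule rtr_contr_fc_le[OF st(1) cq])
    also have "\<dots> = \<kappa> y" unfolding \<kappa> l_def[symmetric] D_def[symmetric] by (intro sum.cong refl) (use st(3) in auto)
    also have "rtr (Q * (q * q * L)) \<le> sqrt \<eta>"
    proof -
      have "rtr (Q * (q * q * L)) = rtr (L * (Q * q) * q)"
        using rtr_comm[of "Q * (q * q)" L] by (simp add: mult.assoc)
      also have "\<dots> \<le> norm (L * (Q * q)) * norm q" by (rule rtr_mult_le)
      also have "norm (L * (Q * q)) = norm (q * (Q * L))"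
      proof -
        have "adj (L * (Q * q)) = q * (Q * L)" using pQ by (simp add: L_def q_def proj_def mult.assoc)
        then show ?thesis by (metis norm_adj)
      qed
      also have "\<dots> \<le> sqrt (a * \<eta>) * norm L" by (rule sq)
      also have "\<dots> \<le> sqrt (a * \<eta>) * (1 / sqrt a)" using a \<eta> by (intro mult_left_mono nL) auto
      also have "\<dots> = sqrt \<eta>" using a by (simp add: real_sqrt_mult)
      finally show ?thesis by (simp add: nq)
    qed
    finally show ?thesis by simp
  qed
  have "rtr ((one D - P) * \<rho>) = (\<Sum>x\<in>seqs n. emp ys x *\<^sub>R rtr (Q * op (tensor_channel W x)))"
    unfolding Q \<rho>_def by (simp add: sum_distrib_left rtr_sum rtr_scaleR)
  also have "\<dots> = (1 / real N) * (\<Sum>x\<leftarrow>ys. rtr (Q * op (tensor_channel W x)))"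
    unfolding emp_sum[OF finite_seqs ys(1)] ys(2) by simp
  also have "\<dots> \<le> (1 / real N) * (\<Sum>x\<leftarrow>ys. \<kappa> x + sqrt \<eta>)"
    using single by (intro mult_left_mono sum_list_mono) auto
  also have "\<dots> = sum_list (map \<kappa> ys) / real N + sqrt \<eta>"
    using ys(2,3) by (simp add: sum_list_addf sum_list_triv field_simps)
  finally show ?thesis using P rank unfolding D_def by blast
qed

lemma product_distr:
  fixes p :: "'x::finite \<Rightarrow> real"
  assumes "distr_on UNIV p"
  shows "distr_on (seqs n) (\<lambda>xs. prod_list (map p xs))"
proof -
  have "0 \<le> prod_list (map p xs)" for xs
    using assms by (induction xs) (auto simp: distr_on_def)
  moreover have "(\<Sum>xs\<in>seqs n. prod_list (map p xs)) = 1"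
    using sum_seqs_prod[where p = p and n = n and F = "\<lambda>_. 1"] iexp_const[of p UNIV n 1] assms by (simp add: distr_on_def)
  ultimately show ?thesis by (simp add: distr_on_def)
qed

lemma product_state:
  fixes W :: "'x::finite \<Rightarrow> complex mat"
  assumes W: "cq_channel d W" and p: "distr_on UNIV p"
  defines "\<sigma> \<equiv> mixture d UNIV W p"
  shows "(\<Sum>xs\<in>seqs n. prod_list (map p xs) *\<^sub>R op (tensor_channel W xs)) = fc (d ^ n) (pU d n \<sigma>) (pL d n \<sigma>)"
proof -
  have Wx: "density_mat d (W x)" for x using W by (simp add: cq_channel_def)
  have \<sigma>: "density_mat d \<sigma>" unfolding \<sigma>_def by (intro mixture_density Wx p)
  have "(\<Sum>xs\<in>seqs n. prod_list (map p xs) *\<^sub>R op (tensor_channel W xs))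
      = op (tensor_channel (\<lambda>_. \<sigma>) (replicate n ()))"
    using tensor_mixture[of W d "replicate n ()" p] density_matD(1)[OF Wx]
    by (simp add: \<sigma>_def op_mixture_seqs[OF W, symmetric])
  also have "\<dots> = fc (d ^ n) (pU d n \<sigma>) (pL d n \<sigma>)"
    using tensor_fc(2)[of d "\<lambda>_. eU d \<sigma>" "\<lambda>_. \<sigma>" "\<lambda>_. eL d \<sigma>" "replicate n ()"] sdec(1,2)[OF \<sigma>]
    by (simp add: pU_def pL_def)
  finally show ?thesis .
qed

text \<open>A union bound over all \<open>M\<close>-types: if they approximate the outputs of all empirical
  distributions of \<open>N\<close> codewords, then there must be many of them.\<close>
lemma converse_shot:
  fixes W :: "'x::finite \<Rightarrow> complex mat"
  assumes W: "cq_channel d W" and p: "distr_on UNIV p" and N: "0 < N" and M: "0 < M"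
    and pos: "0 < \<gamma>" "0 < \<eta>" "0 < \<eta>3" "0 < a" "0 < b"
    and le: "sqrt \<eta>1 + sqrt (\<eta>3 + sqrt \<eta>) \<le> 1"
    and err: "resol_err d W n M < (1 - sqrt \<eta>1 - sqrt (\<eta>3 + sqrt \<eta>))\<^sup>2 - \<gamma> * b * (real N / (a * \<eta>))"
  defines "\<sigma> \<equiv> mixture d UNIV W p"
  defines "\<kappa> \<equiv> \<lambda>xs. \<Sum>i<d ^ n. if evs d W xs i < a then evs d W xs i else 0"
  defines "\<nu> \<equiv> \<Sum>xs\<in>seqs n. prod_list (map p xs) * \<kappa> xs"
    and "\<mu> \<equiv> \<Sum>i<d ^ n. if b < pL d n \<sigma> i then pL d n \<sigma> i else 0"
  shows "1 \<le> \<nu> / \<eta>3 + real (card (UNIV :: 'x set) ^ (n * M)) * exp (real N * (2 * (1 / \<gamma> + \<mu>) - \<eta>1))"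
proof -
  let ?S = "seqs n :: 'x list set" and ?mix = "mixn d n W"
  define D where "D = d ^ n"
  define w where "w x = op (tensor_channel W x)" for x
  define pn where "pn xs = prod_list (map p xs)" for xs
  have pn: "distr_on ?S pn" unfolding pn_def by (rule product_distr[OF p])
  have pn': "\<And>x. x \<in> ?S \<Longrightarrow> 0 \<le> pn x" "sum pn ?S = 1" using pn by (auto simp: distr_on_def)
  have Wx: "density_mat d (W x)" for x using W by (simp add: cq_channel_def)
  have \<sigma>: "density_mat d \<sigma>" unfolding \<sigma>_def by (intro mixture_density Wx p)
  define v where "v = pU d n \<sigma>"
  define s where "s = pL d n \<sigma>"
  have v: "uni D v" unfolding v_def D_def by (rule uni_pU[OF \<sigma>])
  have s0: "\<And>i. i < D \<Longrightarrow> 0 \<le> s i" unfolding s_def D_def by (rule pL_nonneg[OF \<sigma>])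
  have \<sigma>n: "(\<Sum>x\<in>?S. pn x *\<^sub>R w x) = fc D v s"
    unfolding pn_def w_def v_def s_def D_def \<sigma>_def by (rule product_state[OF W p])
  \<comment> \<open>Eigenvalues of the product state above \<open>b\<close> are cut off: their
    weight \<open>\<mu>\<close> reappears in the mean of the tests, and what remains is bounded by
    \<open>b\<close>.\<close>
  define \<sigma>' where "\<sigma>' = fc D v (\<lambda>i. if b < s i then 0 else s i)"
  define \<tau> where "\<tau> zs = (\<Sum>x\<in>?S. emp zs x *\<^sub>R w x)" for zs
  \<comment> \<open>\<open>M\<close>-types are counted as lists of codewords. The test
    \<open>T zs\<close> is fixed for each list before any codeword of \<open>ys\<close> is drawn,
    which is what a union bound requires.\<close>
  define Z where "Z = {zs :: 'x list list. set zs \<subseteq> ?S \<and> length zs = M}"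
  have finZ: "finite Z" unfolding Z_def by (rule finite_lists_length_eq) simp
  have cardZ: "card Z = card (UNIV :: 'x set) ^ (n * M)"
    unfolding Z_def by (simp add: card_lists_length_eq card_seqs power_mult)
  have "\<forall>zs\<in>Z. \<exists>T. proj D T \<and> rtr (T * \<sigma>') \<le> 1 / \<gamma> \<and>
    (\<forall>P. proj D P \<longrightarrow> rtr ((one D - T) * P * (one D - T) * \<tau> zs) \<le> \<gamma> * rtr ((one D - T) * P * (one D - T) * \<sigma>'))"
  proof
    fix zs assume "zs \<in> Z"
    then have zs: "distr_on ?S (emp zs)" using M by (intro distr_emp finite_seqs) (auto simp: Z_def)
    show "\<exists>T. proj D T \<and> rtr (T * \<sigma>') \<le> 1 / \<gamma> \<and>
      (\<forall>P. proj D P \<longrightarrow> rtr ((one D - T) * P * (one D - T) * \<tau> zs) \<le> \<gamma> * rtr ((one D - T) * P * (one D - T) * \<sigma>'))"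
    proof (rule neyman_pearson)
      show "car D (\<tau> zs)" "adj (\<tau> zs) = \<tau> zs"
        unfolding \<tau>_def w_def D_def by (rule mixture_spectral[OF W zs])+
      show "rtr (T * \<tau> zs) \<le> 1" if "contr T" for T
        unfolding \<tau>_def w_def by (rule rtr_contr_mixture_le[OF W zs that])
      show "car D \<sigma>'" "adj \<sigma>' = \<sigma>'" unfolding \<sigma>'_def by (auto intro: car_fc[OF v])
    qed (rule pos)
  qed
  then obtain T where T: "\<And>zs. zs \<in> Z \<Longrightarrow> proj D (T zs)" "\<And>zs. zs \<in> Z \<Longrightarrow> rtr (T zs * \<sigma>') \<le> 1 / \<gamma>"
    "\<And>zs P. zs \<in> Z \<Longrightarrow> proj D P \<Longrightarrow> rtr ((one D - T zs) * P * (one D - T zs) * \<tau> zs)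
      \<le> \<gamma> * rtr ((one D - T zs) * P * (one D - T zs) * \<sigma>')"
    by (metis (no_types, lifting) bchoice)
  define g where "g zs y = rtr (T zs * w y)" for zs y
  have g0: "0 \<le> g zs y" and g1: "g zs y \<le> 1" if "zs \<in> Z" "y \<in> ?S" for zs y
  proof -
    have Tz: "adj (T zs) = T zs" "T zs * T zs = T zs" using T(1)[OF that(1)] by (auto simp: proj_def)
    have "rtr (adj (T zs) * w y * T zs) = rtr (T zs * T zs * w y)"
      using rtr_comm[of "T zs * w y" "T zs"] by (simp add: Tz(1) mult.assoc)
    then show "0 \<le> g zs y"
      using state_sandwich_nonneg[OF W that(2), of "T zs"] by (simp add: g_def w_def Tz(2))
    show "g zs y \<le> 1" unfolding g_def w_def
      by (rule rtr_contr_state_le[OF W that(2) proj_contr[OF T(1)[OF that(1)]]])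
  qed
  have gm: "(\<Sum>y\<in>?S. pn y * g zs y) \<le> 1 / \<gamma> + \<mu>" if zs: "zs \<in> Z" for zs
  proof -
    have "(\<Sum>y\<in>?S. pn y * g zs y) = rtr (T zs * (\<Sum>y\<in>?S. pn y *\<^sub>R w y))"
      by (simp add: g_def sum_distrib_left rtr_sum rtr_scaleR)
    also have "\<dots> = rtr (T zs * \<sigma>') + rtr (T zs * fc D v (\<lambda>i. if b < s i then s i else 0))"
    proof -
      have "fc D v s = \<sigma>' + fc D v (\<lambda>i. if b < s i then s i else 0)"
        unfolding \<sigma>'_def fc_add by (rule fc_cong) auto
      then show ?thesis unfolding \<sigma>n by (simp add: distrib_left rtr_add)
    qed
    also have "rtr (T zs * fc D v (\<lambda>i. if b < s i then s i else 0)) \<le> (\<Sum>i<D. \<bar>if b < s i then s i else 0\<bar>)"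
      by (rule rtr_contr_fc_le[OF v proj_contr[OF T(1)[OF zs]]])
    also have "\<dots> = \<mu>" unfolding \<mu>_def s_def[symmetric] D_def[symmetric]
      by (intro sum.cong refl) (use s0 in auto)
    finally show ?thesis using T(2)[OF zs] by simp
  qed
  \<comment> \<open>If neither bad event occurs, \<open>Q P Q\<close> with \<open>Q = 1 - T\<close>
    has a value near 1 on \<open>\<rho>\<close>, while on \<open>\<tau>\<close> it is at most
    \<open>\<gamma> * b\<close> times the rank bound for \<open>P\<close>; this gap exceeds the
    assumed resolution error.\<close>
  have key: "real N * \<eta>3 \<le> sum_list (map \<kappa> ys) \<or> (\<exists>zs\<in>Z. real N * \<eta>1 \<le> sum_list (map (g zs) ys))"
    if ys: "length ys = N" "set ys \<subseteq> ?S" for ys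
  proof (rule ccontr)
    assume "\<not> ?thesis"
    then have c1: "sum_list (map \<kappa> ys) < real N * \<eta>3"
      and c2: "\<And>zs. zs \<in> Z \<Longrightarrow> sum_list (map (g zs) ys) < real N * \<eta>1" by auto
    have demp: "distr_on ?S (emp ys)" using ys N by (intro distr_emp finite_seqs) auto
    let ?B = "(1 - sqrt \<eta>1 - sqrt (\<eta>3 + sqrt \<eta>))\<^sup>2 - \<gamma> * b * (real N / (a * \<eta>))"
    \<comment> \<open>Strictness of \<open>err\<close> yields an actual \<open>M\<close>-type below
      the bound, whether or not the infimum is attained.\<close>
    have "\<exists>q. type_distr n M q \<and> trace_norm (?mix (emp ys) - ?mix q) / 2 < ?B"
    proof (rule ccontr)
      assume "\<not> ?thesis"
      then have "?B \<le> (INF q\<in>{q. type_distr n M q}. trace_norm (?mix (emp ys) - ?mix q) / 2)"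
        using type_distr_exists[OF M] by (intro cINF_greatest) (auto simp: not_less)
      then show False using resol_err_ge[OF W M demp] err by linarith
    qed
    then obtain q where q: "type_distr n M q" "trace_norm (?mix (emp ys) - ?mix q) / 2 < ?B" by blast
    obtain zs where zs: "length zs = M" "set zs \<subseteq> ?S" "\<And>x. x \<in> ?S \<Longrightarrow> q x = emp zs x"
      using type_distr_emp_ex[OF q(1) M] by blast
    have Zzs: "zs \<in> Z" using zs by (simp add: Z_def)
    have dzs: "distr_on ?S (emp zs)" using zs M by (intro distr_emp finite_seqs) auto
    define \<rho> where "\<rho> = (\<Sum>x\<in>?S. emp ys x *\<^sub>R w x)"
    have mc: "?mix r \<in> carrier_mat D D" for r unfolding D_def by (rule mixture_carrier)
    have "op (?mix q) = \<tau> zs"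
      unfolding op_mixture_seqs[OF W] \<tau>_def w_def by (intro sum.cong refl) (simp add: zs(3))
    then have opA: "op (?mix (emp ys) - ?mix q) = \<rho> - \<tau> zs"
      unfolding op_diff[OF mc mc] by (simp add: op_mixture_seqs[OF W] \<rho>_def w_def)
    obtain z k where z: "uni D z" "\<rho> = fc D z k" "\<And>i. i < D \<Longrightarrow> 0 \<le> k i" "(\<Sum>i<D. k i) = 1"
      using mixture_spectral(4)[OF W demp] unfolding \<rho>_def w_def D_def by blast
    obtain P where P: "proj D P" "rtr P \<le> real N / (a * \<eta>)"
      "rtr ((one D - P) * \<rho>) \<le> sum_list (map \<kappa> ys) / real N + sqrt \<eta>"
      using average_projection[OF W ys(2,1) N pos(4,2), of \<kappa>] unfolding \<kappa>_def \<rho>_def w_def D_def by blast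
    have P3: "rtr ((one D - P) * \<rho>) \<le> \<eta>3 + sqrt \<eta>"
    proof -
      have "sum_list (map \<kappa> ys) / real N \<le> \<eta>3" using c1 N by (simp add: field_simps)
      then show ?thesis using P(3) by linarith
    qed
    let ?T = "T zs"
    let ?Q = "one D - ?T"
    have Tp: "proj D ?T" by (rule T(1)[OF Zzs])
    have Qp: "proj D ?Q" by (rule proj_compl[OF Tp])
    have "rtr (?T * \<rho>) = (\<Sum>x\<in>?S. emp ys x *\<^sub>R g zs x)"
      unfolding \<rho>_def g_def by (simp add: sum_distrib_left rtr_sum rtr_scaleR)
    also have "\<dots> = sum_list (map (g zs) ys) / real N"
      unfolding emp_sum[OF finite_seqs ys(2)] ys(1) by simp
    also have "\<dots> \<le> \<eta>1" using c2[OF Zzs] N by (simp add: field_simps)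
    finally have T1: "rtr (?T * \<rho>) \<le> \<eta>1" .
    have r1: "(1 - sqrt \<eta>1 - sqrt (\<eta>3 + sqrt \<eta>))\<^sup>2 \<le> rtr (?Q * P * ?Q * \<rho>)"
      unfolding z(2) by (rule gentle[OF z(1,3,4) Tp P(1)]) (use T1 P3 le z(2) in auto)
    have r2: "rtr (?Q * P * ?Q * \<tau> zs) \<le> \<gamma> * b * (real N / (a * \<eta>))"
    proof -
      have PP: "P * P = P" "adj P = P" "adj ?Q = ?Q" using P(1) Qp by (auto simp: proj_def)
      have "rtr (?Q * P * ?Q * \<sigma>') = rtr (?Q * (P * P) * ?Q * \<sigma>')" by (simp only: PP)
      also have "\<dots> = rtr (P * ?Q * \<sigma>' * (?Q * P))"
        using rtr_comm[of "?Q * P" "P * ?Q * \<sigma>'"] by (simp only: mult.assoc)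
      also have "\<dots> = rtr (adj (?Q * P) * \<sigma>' * (?Q * P))" by (simp only: adj_mult PP)
      also have "\<dots> = (norm (fc D v (\<lambda>i. sqrt (if b < s i then 0 else s i)) * (?Q * P)))\<^sup>2"
        unfolding \<sigma>'_def by (rule rtr_sandwich_nonneg[OF v]) (use s0 in auto)
      also have "\<dots> \<le> (sqrt b * norm (?Q * P))\<^sup>2"
        by (intro power_mono norm_fc_mult_bound[OF v]) (use s0 pos in auto)
      also have "\<dots> \<le> (sqrt b * norm P)\<^sup>2"
        using contrD[OF proj_contr[OF Qp], of P] pos by (intro power_mono mult_left_mono) auto
      also have "\<dots> = b * rtr P" using pos by (simp add: power_mult_distrib norm_sq PP)
      also have "\<dots> \<le> b * (real N / (a * \<eta>))" using P(2) pos by (intro mult_left_mono) auto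
      finally have "\<gamma> * rtr (?Q * P * ?Q * \<sigma>') \<le> \<gamma> * (b * (real N / (a * \<eta>)))"
        using pos by (intro mult_left_mono) auto
      then show ?thesis using T(3)[OF Zzs P(1)] by (simp only: mult.assoc)
    qed
    have "rtr \<rho> = 1" "rtr (\<tau> zs) = 1"
      unfolding \<rho>_def \<tau>_def w_def by (rule mixture_spectral[OF W demp] mixture_spectral[OF W dzs])+
    then have "rtr (?Q * P * ?Q * op (?mix (emp ys) - ?mix q)) \<le> trace_norm (?mix (emp ys) - ?mix q) / 2"
      by (intro trace_norm_test[OF minus_carrier_mat[OF mc] Qp P(1)]) (simp add: opA rtr_diff)
    then have "rtr (?Q * P * ?Q * \<rho>) - rtr (?Q * P * ?Q * \<tau> zs) \<le> trace_norm (?mix (emp ys) - ?mix q) / 2"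
      unfolding opA by (simp only: right_diff_distrib rtr_diff)
    then show False using q(2) r1 r2 by linarith
  qed
  have \<kappa>0: "0 \<le> \<kappa> x" if "x \<in> ?S" for x
  proof -
    have len: "length x = n" using that by (simp add: seqs_def)
    show ?thesis unfolding \<kappa>_def by (intro sum_nonneg) (use tensor_state_fc(3)[OF W len] in auto)
  qed
  let ?ind = "\<lambda>zs ys. if real N * \<eta>1 \<le> sum_list (map (g zs) ys) then 1 else (0::real)"
  have "1 = iexp ?S pn N (\<lambda>_. 1)" using pn'(2) by (simp add: iexp_const)
  \<comment> \<open>The two events are replaced by functions with computable means: Markov's
    inequality for the average of \<open>\<kappa>\<close>, and a sum of indicators for the union
    bound.\<close>
  also have "\<dots> \<le> iexp ?S pn N (\<lambda>ys. (1 / (real N * \<eta>3)) * sum_list (map \<kappa> ys) + (\<Sum>zs\<in>Z. ?ind zs ys))"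
  proof (rule iexp_mono[OF pn'(1)])
    fix ys assume ys: "length ys = N" "set ys \<subseteq> ?S"
    have i0: "0 \<le> (\<Sum>zs\<in>Z. ?ind zs ys)" by (intro sum_nonneg) auto
    have k0: "0 \<le> sum_list (map \<kappa> ys)" using ys(2) \<kappa>0 by (intro sum_list_nonneg) auto
    from key[OF ys] show "1 \<le> (1 / (real N * \<eta>3)) * sum_list (map \<kappa> ys) + (\<Sum>zs\<in>Z. ?ind zs ys)"
    proof
      assume "real N * \<eta>3 \<le> sum_list (map \<kappa> ys)"
      then have "1 \<le> (1 / (real N * \<eta>3)) * sum_list (map \<kappa> ys)" using N pos by (simp add: field_simps)
      then show ?thesis using i0 by linarith
    next
      assume "\<exists>zs\<in>Z. real N * \<eta>1 \<le> sum_list (map (g zs) ys)"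
      then obtain zs where "zs \<in> Z" "?ind zs ys = 1" by auto
      then have "1 \<le> (\<Sum>zs\<in>Z. ?ind zs ys)"
        using member_le_sum[of zs Z "\<lambda>zs. ?ind zs ys"] finZ by simp
      moreover have "0 \<le> (1 / (real N * \<eta>3)) * sum_list (map \<kappa> ys)"
        using k0 N pos by (intro mult_nonneg_nonneg) auto
      ultimately show ?thesis by linarith
    qed
  qed
  also have "\<dots> = (1 / (real N * \<eta>3)) * (real N * \<nu>) + (\<Sum>zs\<in>Z. iexp ?S pn N (?ind zs))"
    unfolding iexp_add iexp_cmult iexp_sum_list[OF pn'(2)] iexp_sum[OF finZ pn'(2)] \<nu>_def pn_def ..
  also have "(\<Sum>zs\<in>Z. iexp ?S pn N (?ind zs)) \<le> (\<Sum>zs\<in>Z. exp (real N * (2 * (1 / \<gamma> + \<mu>) - \<eta>1)))"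
    by (intro sum_mono chernoff pn' g0 g1 gm)
  also have "\<dots> = real (card (UNIV :: 'x set) ^ (n * M)) * exp (real N * (2 * (1 / \<gamma> + \<mu>) - \<eta>1))"
    by (simp add: cardZ)
  also have "(1 / (real N * \<eta>3)) * (real N * \<nu>) = \<nu> / \<eta>3" using N by simp
  finally show ?thesis by simp
qed

section \<open>Asymptotics\<close>

text \<open>Half of the linear gain absorbs the quadratic loss once
  \<open>32 d t <= \<delta>\<close>; \<open>d + 1\<close> avoids a division by 0.\<close>

lemma exponent_choice:
  fixes \<delta> :: real
  assumes "0 < \<delta>"
  shows "\<exists>t>0. t \<le> 1 / 2 \<and> 16 * real d * t\<^sup>2 - t * \<delta> \<le> - (t * \<delta> / 2)"
proof -
  define t where "t = min (1 / 2) (\<delta> / (32 * (real d + 1)))"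
  have t0: "0 < t" using assms by (simp add: t_def)
  have "16 * real d * t \<le> 16 * (real d + 1) * t" using t0 by simp
  also have "\<dots> \<le> 16 * (real d + 1) * (\<delta> / (32 * (real d + 1)))"
    by (intro mult_left_mono) (auto simp: t_def)
  also have "\<dots> = \<delta> / 2" by (simp add: field_simps)
  finally have "t * (16 * real d * t) \<le> t * (\<delta> / 2)" using t0 by (intro mult_left_mono) auto
  then have "16 * real d * t\<^sup>2 - t * \<delta> \<le> - (t * \<delta> / 2)"
    by (simp add: power2_eq_square algebra_simps)
  moreover have "t \<le> 1 / 2" unfolding t_def by (rule min.cobounded1)
  ultimately show ?thesis using t0 by blast
qed

lemma half_le_floor:
  fixes x :: real
  assumes "1 \<le> x"
  shows "x / 2 \<le> real (nat \<lfloor>x\<rfloor>)" "0 < nat \<lfloor>x\<rfloor>" "real (nat \<lfloor>x\<rfloor>) \<le> x"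
proof -
  have f: "1 \<le> \<lfloor>x\<rfloor>" using assms by simp
  then have g: "real (nat \<lfloor>x\<rfloor>) = of_int \<lfloor>x\<rfloor>" "1 \<le> real_of_int \<lfloor>x\<rfloor>" by simp_all
  show "x / 2 \<le> real (nat \<lfloor>x\<rfloor>)" unfolding g(1) using g(2) real_of_int_floor_gt_diff_one[of x] by linarith
  show "0 < nat \<lfloor>x\<rfloor>" using f by simp
  show "real (nat \<lfloor>x\<rfloor>) \<le> x" unfolding g(1) by (rule of_int_floor_le)
qed

lemma two_powr: "2 powr (x::real) = exp (x * ln 2)"
  by (simp add: powr_def)

text \<open>A limit and not merely a liminf: besides bounding the rate, it shows that
  \<open>min_size\<close> is eventually a minimum over a nonempty set.\<close>

lemma resol_err_tendsto_0:
  fixes W :: "'x::finite \<Rightarrow> complex mat"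
  assumes W: "cq_channel d W" and R: "cq_capacity d W < R"
  shows "(\<lambda>n. resol_err d W n (nat \<lfloor>2 powr (real n * R)\<rfloor>)) \<longlonglongrightarrow> 0"
proof -
  define C where "C = cq_capacity d W"
  define K where "K = card (UNIV :: 'x set)"
  have C0: "0 \<le> C" unfolding C_def by (rule capacity_nonneg[OF W])
  \<comment> \<open>The excess exponent \<open>ln 2 * (R - C)\<close> is \<open>4 c\<close>: the
    covering bound spends \<open>2 c\<close>, and the root of the remaining
    \<open>exp (- 2 c n)\<close> beats the polynomial number of types.\<close>
  define c where "c = ln 2 * (R - C) / 4"
  have c: "0 < c" using R by (simp add: c_def C_def)
  obtain t where t: "0 < t" "t \<le> 1 / 2" "16 * real d * t\<^sup>2 - t * c \<le> - (t * c / 2)"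
    using exponent_choice[OF c] by blast
  define k where "k = t * c / 2"
  have k: "0 < k" using t c by (simp add: k_def)
  define f where "f n = exp (- (k * real n)) + exp (- (k / 2 * real n)) + sqrt 2 * ((real n + 1) ^ K * exp (- (c * real n)))" for n
  have M1: "1 \<le> 2 powr (real n * R)" for n 
    using R C0 by (intro ge_one_powr_ge_zero mult_nonneg_nonneg) (auto simp: C_def)
  have "resol_err d W n (nat \<lfloor>2 powr (real n * R)\<rfloor>) \<le> f n" if n: "0 < n" for n
  proof -
    define M where "M = nat \<lfloor>2 powr (real n * R)\<rfloor>"
    have M: "0 < M" "exp (real n * R * ln 2) / 2 \<le> real M"
      using half_le_floor[OF M1[of n]] by (simp_all add: M_def two_powr)
    let ?\<tau> = "exp (real n * (16 * real d * t\<^sup>2 - t * c))"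
    have "real n * (16 * real d * t\<^sup>2 - t * c) \<le> real n * (- k)"
      using t(3) by (intro mult_left_mono) (auto simp: k_def)
    then have \<tau>: "?\<tau> \<le> exp (- (k * real n))" by (simp add: mult.commute)
    have "sqrt ?\<tau> \<le> sqrt (exp (- (k * real n)))" using \<tau> by (rule real_sqrt_le_mono)
    also have "\<dots> = exp (- (k / 2 * real n))"
      by (rule real_sqrt_unique) (simp_all add: power2_eq_square flip: exp_add)
    finally have s\<tau>: "sqrt ?\<tau> \<le> exp (- (k / 2 * real n))" .
    have "exp (real n * (ln 2 * C + 2 * c)) / real M \<le> exp (real n * (ln 2 * C + 2 * c)) / (exp (real n * R * ln 2) / 2)"
      using M by (intro divide_left_mono) auto
    also have "\<dots> = 2 * (exp (- (c * real n)))\<^sup>2"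
      by (simp add: c_def power2_eq_square field_simps flip: exp_diff exp_add)
    finally have "sqrt (exp (real n * (ln 2 * C + 2 * c)) / real M) \<le> sqrt (2 * (exp (- (c * real n)))\<^sup>2)"
      by (rule real_sqrt_le_mono)
    also have "\<dots> = sqrt 2 * exp (- (c * real n))" by (simp add: real_sqrt_mult)
    finally have "(real n + 1) ^ K * sqrt (exp (real n * (ln 2 * C + 2 * c)) / real M) \<le> (real n + 1) ^ K * (sqrt 2 * exp (- (c * real n)))"
      by (intro mult_left_mono) auto
    then show ?thesis
      using resol_err_upper[OF W n M(1) less_imp_le[OF t(1)] t(2), of c] \<tau> s\<tau>
      unfolding f_def M_def[symmetric] C_def[symmetric] K_def[symmetric] by (simp only: mult_ac)
  qed
  then have up: "\<forall>\<^sub>F n in sequentially. resol_err d W n (nat \<lfloor>2 powr (real n * R)\<rfloor>) \<le> f n"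
    by (intro eventually_sequentiallyI[of 1]) auto
  have lo: "\<forall>\<^sub>F n in sequentially. 0 \<le> resol_err d W n (nat \<lfloor>2 powr (real n * R)\<rfloor>)"
    by (intro always_eventually allI resol_err_nonneg[OF W] half_le_floor M1)
  have "(\<lambda>n. (real n + 1) ^ K * exp (- (c * real n))) \<longlonglongrightarrow> 0" using c by real_asymp
  moreover have "(\<lambda>n. exp (- (k * real n))) \<longlonglongrightarrow> 0" "(\<lambda>n. exp (- (k / 2 * real n))) \<longlonglongrightarrow> 0"
    using k by real_asymp+
  ultimately have "f \<longlonglongrightarrow> 0 + 0 + sqrt 2 * 0"
    unfolding f_def by (intro tendsto_add tendsto_mult tendsto_const)
  then show ?thesis by (intro tendsto_sandwich[OF lo up tendsto_const]) simp
qed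

text \<open>The threshold is set by the mean \<open>h\<close> over \<open>p\<close>, so atypical
  sequences may violate it. Averaging over the i.i.d. input first turns the sum into an
  \<open>n\<close>-th power of one mean, to which the expansion applies.\<close>

lemma lower_tail_mean:
  fixes W :: "'x::finite \<Rightarrow> complex mat" and \<delta> :: real and n :: nat
  assumes W: "cq_channel d W" and p: "distr_on UNIV p" and t: "0 \<le> t" "t \<le> 1 / 2"
  defines "h \<equiv> \<Sum>x\<in>UNIV. p x * hn d (W x)"
  defines "a \<equiv> exp (real n * (h - \<delta>))"
  shows "(\<Sum>xs\<in>seqs n. prod_list (map p xs) * (\<Sum>i<d ^ n. if evs d W xs i < a
      then evs d W xs i else 0)) \<le> exp (real n * (16 * real d * t\<^sup>2 - t * \<delta>))"
proof -
  have Wx: "density_mat d (W x)" for x using W by (simp add: cq_channel_def)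
  let ?l = "\<lambda>x. eL d (W x)"
  have "(\<Sum>xs\<in>seqs n. prod_list (map p xs) * (\<Sum>i<d ^ n. if ltens d ?l xs i < a then ltens d ?l xs i else 0))
    \<le> (\<Sum>xs\<in>seqs n. prod_list (map p xs) * (a powr t * prod_list (map (\<lambda>x. \<Sum>j<d. ?l x j powr (1 - t)) xs)))"
  proof (intro sum_mono mult_left_mono)
    fix xs :: "'x list" assume xs: "xs \<in> seqs n"
    then show "(\<Sum>i<d ^ n. if ltens d ?l xs i < a then ltens d ?l xs i else 0)
      \<le> a powr t * prod_list (map (\<lambda>x. \<Sum>j<d. ?l x j powr (1 - t)) xs)"
      using tail_lower[of xs d ?l a t] sdec(3)[OF Wx] t by (simp add: seqs_def a_def)
    show "0 \<le> prod_list (map p xs)" using product_distr[OF p, of n] xs by (simp add: distr_on_def)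
  qed
  also have "\<dots> = a powr t * (\<Sum>x\<in>UNIV. p x * (\<Sum>j<d. ?l x j powr (1 - t))) ^ n"
    by (simp add: sum_seqs_prod iexp_cmult iexp_prod)
  also have "\<dots> \<le> a powr t * exp (- (t * h) + 16 * real d * t\<^sup>2) ^ n"
  proof (intro mult_left_mono power_mono)
    have "(\<Sum>x\<in>UNIV. p x * (\<Sum>j<d. ?l x j powr (1 - t))) \<le> (\<Sum>x\<in>UNIV. p x * (1 + - t * hn d (W x) + 16 * real d * t\<^sup>2))"
      using sum_powr_second_order[of d "?l _" "- t"] sdec(3,4)[OF Wx] t p
      by (intro sum_mono mult_left_mono) (auto simp: hn_def distr_on_def)
    also have "\<dots> = (\<Sum>x\<in>UNIV. p x + - t * (p x * hn d (W x)) + p x * (16 * real d * t\<^sup>2))"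
      by (intro sum.cong refl) (simp add: algebra_simps)
    also have "\<dots> = 1 + (- (t * h) + 16 * real d * t\<^sup>2)"
    proof -
      have "(\<Sum>x\<in>UNIV. p x * (16 * real d * t\<^sup>2)) = 16 * real d * t\<^sup>2"
        using p by (simp add: distr_on_def flip: sum_distrib_right)
      then show ?thesis using p
        by (simp only: sum.distrib distr_on_def h_def sum_distrib_left[symmetric])
    qed
    also have "\<dots> \<le> exp (- (t * h) + 16 * real d * t\<^sup>2)" by (rule exp_ge_add_one_self)
    finally show "(\<Sum>x\<in>UNIV. p x * (\<Sum>j<d. ?l x j powr (1 - t))) \<le> exp (- (t * h) + 16 * real d * t\<^sup>2)" .
    show "0 \<le> (\<Sum>x\<in>UNIV. p x * (\<Sum>j<d. ?l x j powr (1 - t)))"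
      using p by (intro sum_nonneg mult_nonneg_nonneg) (auto simp: distr_on_def)
  qed simp
  also have "\<dots> = exp (real n * (16 * real d * t\<^sup>2 - t * \<delta>))"
    by (simp add: a_def powr_exp algebra_simps flip: exp_of_nat_mult exp_add)
  finally show ?thesis .
qed

text \<open>\<open>M = 0\<close> has to be excluded: there every distribution meets the integrality
  condition and the error is 0. The bound is uniform in \<open>M\<close>, so that it can be applied
  to \<open>min_size\<close>.\<close>

lemma converse_eventually:
  fixes W :: "'x::finite \<Rightarrow> complex mat"
  assumes W: "cq_channel d W" and p: "distr_on UNIV p" and \<epsilon>: "0 < \<epsilon>" "\<epsilon> < 1"
    and c: "0 < c" "c < ln 2 * holevo_info d W p"
  shows "\<forall>\<^sub>F n in sequentially. \<forall>M\<ge>1. resol_err d W n M \<le> \<epsilon> \<longrightarrow> exp (real n * c) \<le> real M"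
proof -
  have Wx: "density_mat d (W x)" for x using W by (simp add: cq_channel_def)
  define \<sigma> where "\<sigma> = mixture d UNIV W p"
  have \<sigma>: "density_mat d \<sigma>" unfolding \<sigma>_def by (intro mixture_density Wx p)
  define h where "h = (\<Sum>x\<in>UNIV. p x * hn d (W x))"
  define J where "J = ln 2 * holevo_info d W p"
  have J: "J = h - hn d \<sigma>"
    unfolding J_def holevo_info_eq[OF W p] sdec(5)[OF Wx] sdec(5)[OF \<sigma>] \<sigma>_def[symmetric] h_def
    by (simp add: right_diff_distrib sum_distrib_left)
  \<comment> \<open>With \<open>N\<close> near \<open>exp (n (c + \<delta>))\<close>, the ratio
    \<open>b / a * N\<close> has exponent
    \<open>- J + 2 \<delta> + c + \<delta> = - \<delta>\<close>.\<close>
  define \<delta> where "\<delta> = (J - c) / 4"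
  have \<delta>: "0 < \<delta>" using c by (simp add: \<delta>_def J_def)
  obtain t where t: "0 < t" "t \<le> 1 / 2" "16 * real d * t\<^sup>2 - t * \<delta> \<le> - (t * \<delta> / 2)"
    using exponent_choice[OF \<delta>] by blast
  define k where "k = t * \<delta> / 2"
  have k: "0 < k" using t \<delta> by (simp add: k_def)
  \<comment> \<open>Both roots in \<open>converse_shot\<close> will equal \<open>\<theta>\<close>,
    so the success value is at least \<open>1 - 4 \<theta> = 1 - (1 - \<epsilon>) / 4\<close>;
    giving up another \<open>(1 - \<epsilon>) / 4\<close> for the \<open>\<gamma> * b\<close> term
    still leaves more than \<open>\<epsilon>\<close>.\<close>
  define \<theta> where "\<theta> = (1 - \<epsilon>) / 16"
  have \<theta>: "0 < \<theta>" "\<theta> < 1 / 2" using \<epsilon> by (simp_all add: \<theta>_def)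
  \<comment> \<open>Then \<open>1 / \<gamma>\<close> and \<open>\<mu>\<close> are each at most
    \<open>\<theta>^2 / 8\<close>, so twice their sum is at most half of the acceptance threshold
    \<open>\<theta>^2\<close>; and \<open>sqrt \<eta> = \<theta>^2 / 2\<close> completes the value
    \<open>\<theta>^2 / 2\<close> of \<open>\<eta>3\<close> to \<open>\<theta>^2\<close>.\<close>
  define \<gamma> where "\<gamma> = 8 / \<theta>\<^sup>2"
  define \<eta> where "\<eta> = (\<theta>\<^sup>2 / 2)\<^sup>2"
  define X where "X = ln (real (card (UNIV :: 'x set)))"
  have card: "0 < card (UNIV :: 'x set)" by (simp add: card_gt_0_iff)
  have X: "0 \<le> X" unfolding X_def using card by (simp add: Suc_leI)
  have pos: "0 < \<gamma>" "0 < \<eta>" "0 < \<theta>\<^sup>2 / 2" using \<theta> by (simp_all add: \<gamma>_def \<eta>_def)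
  have sq\<eta>: "\<theta>\<^sup>2 / 2 + sqrt \<eta> = \<theta>\<^sup>2" using \<theta> by (simp add: \<eta>_def)
  have "\<forall>\<^sub>F n in sequentially. exp (- (k * real n)) \<le> \<theta>\<^sup>2 / 8"
  proof -
    have "(\<lambda>n. exp (- (k * real n))) \<longlonglongrightarrow> 0" using k by real_asymp
    then have "\<forall>\<^sub>F n in sequentially. exp (- (k * real n)) < \<theta>\<^sup>2 / 8"
      using \<theta> by (intro order_tendstoD(2)) auto
    then show ?thesis by (rule eventually_mono) simp
  qed
  moreover have "\<forall>\<^sub>F n in sequentially. \<gamma> / \<eta> * exp (- (\<delta> * real n)) < (1 - \<epsilon>) / 4"
  proof -
    have "(\<lambda>n. \<gamma> / \<eta> * exp (- (\<delta> * real n))) \<longlonglongrightarrow> 0" using \<delta> by real_asymp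
    then show ?thesis using \<epsilon> by (intro order_tendstoD(2)) auto
  qed
  \<comment> \<open>The surplus \<open>\<delta>\<close> in the exponent of \<open>N\<close> pays for
    the factor \<open>n * X\<close> that comes from counting \<open>M\<close>-types and for the
    constants; the \<open>+ 1\<close> keeps the later divisor positive even for
    \<open>X = 0\<close>.\<close>
  moreover have "\<forall>\<^sub>F n in sequentially. exp (real n * c) * (real n * X + 1) \<le> exp (real n * (c + \<delta>)) * (\<theta>\<^sup>2 / 4) - 1"
  proof -
    have "(\<lambda>n. (real n * X + 1) * exp (- (\<delta> * real n)) + exp (- ((c + \<delta>) * real n))) \<longlonglongrightarrow> 0"
    proof -
      have "(\<lambda>n. real n * exp (- (\<delta> * real n))) \<longlonglongrightarrow> 0" "(\<lambda>n. exp (- (\<delta> * real n))) \<longlonglongrightarrow> 0"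
        "(\<lambda>n. exp (- ((c + \<delta>) * real n))) \<longlonglongrightarrow> 0"
        using \<delta> c(1) by real_asymp+
      then have "(\<lambda>n. X * (real n * exp (- (\<delta> * real n))) + exp (- (\<delta> * real n)) + exp (- ((c + \<delta>) * real n))) \<longlonglongrightarrow> X * 0 + 0 + 0"
        by (intro tendsto_add tendsto_mult tendsto_const)
      then show ?thesis by (simp add: algebra_simps)
    qed
    then have "\<forall>\<^sub>F n in sequentially. (real n * X + 1) * exp (- (\<delta> * real n)) + exp (- ((c + \<delta>) * real n)) < \<theta>\<^sup>2 / 4"
      using \<theta> by (intro order_tendstoD(2)) auto
    then show ?thesis
    proof (rule eventually_mono)
      fix n assume "(real n * X + 1) * exp (- (\<delta> * real n)) + exp (- ((c + \<delta>) * real n)) < \<theta>\<^sup>2 / 4"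
      then have "exp (real n * (c + \<delta>)) * ((real n * X + 1) * exp (- (\<delta> * real n)) + exp (- ((c + \<delta>) * real n)))
          \<le> exp (real n * (c + \<delta>)) * (\<theta>\<^sup>2 / 4)" by (intro mult_left_mono) auto
      moreover have "exp (real n * (c + \<delta>)) * ((real n * X + 1) * exp (- (\<delta> * real n)) + exp (- ((c + \<delta>) * real n)))
          = exp (real n * c) * (real n * X + 1) + 1"
      proof -
        have 1: "exp (real n * (c + \<delta>)) * exp (- (\<delta> * real n)) = exp (real n * c)"
          by (simp add: algebra_simps flip: exp_add)
        have 2: "exp (real n * (c + \<delta>)) * exp (- ((c + \<delta>) * real n)) = 1"
          by (simp add: algebra_simps flip: exp_add)
        have "exp (real n * (c + \<delta>)) * ((real n * X + 1) * exp (- (\<delta> * real n)) + exp (- ((c + \<delta>) * real n)))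
          = (exp (real n * (c + \<delta>)) * exp (- (\<delta> * real n))) * (real n * X + 1) + exp (real n * (c + \<delta>)) * exp (- ((c + \<delta>) * real n))"
          by (simp only: distrib_left mult_ac)
        then show ?thesis by (simp only: 1 2)
      qed
      ultimately show "exp (real n * c) * (real n * X + 1) \<le> exp (real n * (c + \<delta>)) * (\<theta>\<^sup>2 / 4) - 1" by linarith
    qed
  qed
  ultimately show ?thesis
  proof eventually_elim
    case (elim n)
    show ?case
    proof (intro allI impI)
      fix M :: nat assume M1: "1 \<le> M" and err: "resol_err d W n M \<le> \<epsilon>"
      define a where "a = exp (real n * (h - \<delta>))"
      define b where "b = exp (real n * hn d \<sigma> + real n * \<delta>)"
      define N where "N = nat \<lfloor>exp (real n * (c + \<delta>))\<rfloor>"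
      have "1 \<le> exp (real n * (c + \<delta>))" using c(1) \<delta> by simp
      note N = half_le_floor[OF this, folded N_def]
      define \<mu> where "\<mu> = (\<Sum>i<d ^ n. if b < pL d n \<sigma> i then pL d n \<sigma> i else 0)"
      define \<nu> where "\<nu> = (\<Sum>xs\<in>seqs n. prod_list (map p xs) * (\<Sum>i<d ^ n. if evs d W xs i < a
        then evs d W xs i else 0))"
      have "real n * (16 * real d * t\<^sup>2 - t * \<delta>) \<le> real n * (- k)"
        using t(3) by (intro mult_left_mono) (auto simp: k_def)
      then have \<tau>: "exp (real n * (16 * real d * t\<^sup>2 - t * \<delta>)) \<le> \<theta>\<^sup>2 / 8"
        using elim(1) by (intro order_trans[OF _ elim(1)]) (simp add: mult.commute)
      have \<nu>: "\<nu> \<le> \<theta>\<^sup>2 / 8"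
        using lower_tail_mean[OF W p less_imp_le[OF t(1)] t(2), of n \<delta>] \<tau>
        unfolding \<nu>_def a_def h_def by linarith
      have \<mu>: "\<mu> \<le> \<theta>\<^sup>2 / 8"
      proof -
        \<comment> \<open>A single state is a channel with one input letter, so the tail bound for
          products of channel states covers its tensor powers.\<close>
        have "cq_channel d (\<lambda>_::unit. \<sigma>)" using \<sigma> by (simp add: cq_channel_def)
        from state_tail_upper[OF this length_replicate less_imp_le[OF t(1)] t(2), of n "()" \<delta>]
        have "\<mu> \<le> exp (real n * (16 * real d * t\<^sup>2 - t * \<delta>))"
          unfolding \<mu>_def b_def pL_def by (simp add: sum_list_replicate)
        then show ?thesis using \<tau> by linarith
      qed
      have small: "\<gamma> * b * (real N / (a * \<eta>)) < (1 - \<epsilon>) / 4"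
      proof -
        have "\<gamma> * b * (real N / (a * \<eta>)) = \<gamma> / \<eta> * (b / a * real N)" by (simp add: mult_ac)
        also have "\<dots> \<le> \<gamma> / \<eta> * (b / a * exp (real n * (c + \<delta>)))"
          using pos N(3) by (intro mult_left_mono) (auto simp: a_def b_def)
        also have "b / a * exp (real n * (c + \<delta>)) = exp (- (\<delta> * real n))"
        proof -
          have hJ: "hn d \<sigma> = h - c - 4 * \<delta>" using J by (simp add: \<delta>_def field_simps)
          show ?thesis unfolding a_def b_def hJ exp_diff[symmetric] exp_add[symmetric]
            by (simp add: algebra_simps)
        qed
        finally show ?thesis using elim(2) by linarith
      qed
      have gap: "\<epsilon> < (1 - 2 * \<theta>)\<^sup>2 - (1 - \<epsilon>) / 4"
      proof -
        have "1 - 4 * \<theta> \<le> (1 - 2 * \<theta>)\<^sup>2" by (simp add: power2_eq_square algebra_simps)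
        moreover have "4 * \<theta> = (1 - \<epsilon>) / 4" by (simp add: \<theta>_def)
        moreover have "1 - (1 - \<epsilon>) / 4 \<le> y \<Longrightarrow> \<epsilon> < y - (1 - \<epsilon>) / 4" for y
          using \<epsilon> by (simp add: field_simps)
        ultimately show ?thesis by simp
      qed
      have e: "1 - sqrt (\<theta>\<^sup>2) - sqrt (\<theta>\<^sup>2 / 2 + sqrt \<eta>) = 1 - 2 * \<theta>"
        unfolding sq\<eta> using \<theta> by simp
      have "r \<le> \<epsilon> \<Longrightarrow> s < q \<Longrightarrow> \<epsilon> < y - q \<Longrightarrow> r < y - s" for r s q y :: real by linarith
      from this[OF err small gap] have err': "resol_err d W n M < (1 - sqrt (\<theta>\<^sup>2) - sqrt (\<theta>\<^sup>2 / 2 + sqrt \<eta>))\<^sup>2 - \<gamma> * b * (real N / (a * \<eta>))"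
        by (simp only: e)
      have le': "sqrt (\<theta>\<^sup>2) + sqrt (\<theta>\<^sup>2 / 2 + sqrt \<eta>) \<le> 1" using \<theta> unfolding sq\<eta> by simp
      have "0 < M" "0 < a" "0 < b" using M1 by (auto simp: a_def b_def)
      from converse_shot[OF W p N(2) this(1) pos this(2,3) le' err']
      have shot: "1 \<le> \<nu> / (\<theta>\<^sup>2 / 2) + real (card (UNIV :: 'x set) ^ (n * M)) * exp (real N * (2 * (1 / \<gamma> + \<mu>) - \<theta>\<^sup>2))"
        unfolding \<nu>_def \<mu>_def \<sigma>_def .
      have \<nu>': "\<nu> / (\<theta>\<^sup>2 / 2) \<le> 1 / 2"
      proof -
        have "\<nu> \<le> 1 / 2 * (\<theta>\<^sup>2 / 2)" using \<nu> pos(3) by linarith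
        then show ?thesis using pos(3) by (simp only: pos_divide_le_eq)
      qed
      have "2 * (1 / \<gamma> + \<mu>) - \<theta>\<^sup>2 \<le> - (\<theta>\<^sup>2 / 2)" using \<mu> by (simp add: \<gamma>_def)
      then have "real N * (2 * (1 / \<gamma> + \<mu>) - \<theta>\<^sup>2) \<le> real N * (- (\<theta>\<^sup>2 / 2))" by (rule mult_left_mono) simp
      then have "exp (real N * (2 * (1 / \<gamma> + \<mu>) - \<theta>\<^sup>2)) \<le> exp (real N * (- (\<theta>\<^sup>2 / 2)))"
        by (simp only: exp_le_cancel_iff)
      then have "real (card (UNIV :: 'x set) ^ (n * M)) * exp (real N * (2 * (1 / \<gamma> + \<mu>) - \<theta>\<^sup>2))
          \<le> real (card (UNIV :: 'x set) ^ (n * M)) * exp (real N * (- (\<theta>\<^sup>2 / 2)))"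
        by (rule mult_left_mono) simp
      moreover have "real (card (UNIV :: 'x set) ^ (n * M)) = exp (real (n * M) * X)"
        using card by (simp add: X_def exp_of_nat_mult del: of_nat_mult)
      \<comment> \<open>As \<open>\<nu>\<close> accounts for at most one half, the union bound must
        contribute the other half; its logarithm compares \<open>n * M * X\<close> with
        \<open>N * \<theta>^2 / 2\<close>.\<close>
      ultimately have "1 / 2 \<le> exp (real (n * M) * X) * exp (real N * (- (\<theta>\<^sup>2 / 2)))"
        using shot \<nu>' by (simp only:)
      also have "\<dots> = exp (real (n * M) * X - real N * (\<theta>\<^sup>2 / 2))" by (simp flip: exp_add)
      finally have "ln (1 / 2) \<le> ln (exp (real (n * M) * X - real N * (\<theta>\<^sup>2 / 2)))"
        by (rule ln_mono) simp
      then have "ln (1 / 2) \<le> real (n * M) * X - real N * (\<theta>\<^sup>2 / 2)" by (simp only: ln_exp)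
      moreover have "ln (1 / 2) \<ge> (- 1 :: real)" using ln_le_minus_one[of "2 :: real"] by (simp add: ln_div)
      moreover have "exp (real n * (c + \<delta>)) * (\<theta>\<^sup>2 / 4) \<le> real N * (\<theta>\<^sup>2 / 2)"
        using mult_right_mono[OF N(1), of "\<theta>\<^sup>2 / 2"] by simp
      ultimately have "exp (real n * c) * (real n * X + 1) \<le> real (n * M) * X"
        using elim(3) by linarith
      also have "\<dots> \<le> real M * (real n * X + 1)" by (simp add: algebra_simps)
      finally show "exp (real n * c) \<le> real M"
        by (rule mult_right_le_imp_le) (use X in \<open>simp add: add_nonneg_pos\<close>)
    qed
  qed
qed

theorem theorem1:
  fixes W :: "'x::finite \<Rightarrow> complex mat" and d :: nat and \<epsilon> :: real
  assumes "cq_channel d W"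
    and "0 < \<epsilon>" and "\<epsilon> < 1"
  shows "resol_rate d W = ereal (cq_capacity d W)
       \<and> resol_rate_eps d W \<epsilon> = ereal (cq_capacity d W)"
proof -
  note W = assms(1)
  define C where "C = cq_capacity d W"
  have C0: "0 \<le> C" unfolding C_def by (rule capacity_nonneg[OF W])
  \<comment> \<open>A zero liminf gives error below \<open>\<epsilon>\<close> only for infinitely
    many \<open>n\<close>, which is enough because \<open>resol_rate_eps\<close> is a liminf as
    well.\<close>
  have le1: "resol_rate_eps d W \<epsilon> \<le> resol_rate d W"
    unfolding resol_rate_def
  proof (intro Inf_greatest, clarsimp)
    fix R :: real assume R: "0 < R" and lim: "\<forall>\<gamma>>0. liminf (\<lambda>n. ereal (resol_err d W n (nat \<lfloor>2 powr (real n * (R + \<gamma>))\<rfloor>))) = 0"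
    show "resol_rate_eps d W \<epsilon> \<le> ereal R"
    proof (rule ereal_le_epsilon2)
      fix \<gamma> :: real assume \<gamma>: "0 < \<gamma>"
      let ?M = "\<lambda>n. nat \<lfloor>2 powr (real n * (R + \<gamma>))\<rfloor>"
      have M1: "1 \<le> 2 powr (real n * (R + \<gamma>))" for n
        using R \<gamma> by (intro ge_one_powr_ge_zero mult_nonneg_nonneg) auto
      have "liminf (\<lambda>n. ereal (resol_err d W n (?M n))) < ereal \<epsilon>" using lim \<gamma> assms(2) by simp
      then have "\<exists>\<^sub>F n in sequentially. ereal (resol_err d W n (?M n)) < ereal \<epsilon>"
        unfolding frequently_def using Liminf_bounded[of "ereal \<epsilon>" "\<lambda>n. ereal (resol_err d W n (?M n))" sequentially]
        by (auto simp: not_less)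
      then have "\<exists>\<^sub>F n in sequentially. resol_err d W n (?M n) \<le> \<epsilon> \<and> 0 < n"
        by (rule frequently_eventually_conj[THEN frequently_elim1, OF _ eventually_gt_at_top[of 0]]) auto
      then have fr: "\<exists>\<^sub>F n in sequentially. ereal (log 2 (real (min_size d W \<epsilon> n)) / real n) \<le> ereal (R + \<gamma>)"
      proof (rule frequently_elim1)
        fix n assume n: "resol_err d W n (?M n) \<le> \<epsilon> \<and> 0 < n"
        have "?M n \<ge> 1" using half_le_floor(2)[OF M1[of n]] by linarith
        then have P: "?M n \<ge> 1 \<and> resol_err d W n (?M n) \<le> \<epsilon>" using n by blast
        have "min_size d W \<epsilon> n \<le> ?M n" unfolding min_size_def by (rule Least_le) (rule P)
        then have "real (min_size d W \<epsilon> n) \<le> 2 powr (real n * (R + \<gamma>))"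
          using half_le_floor(3)[OF M1[of n]] by linarith
        moreover have "1 \<le> min_size d W \<epsilon> n" unfolding min_size_def
          using LeastI[of "\<lambda>M. M \<ge> 1 \<and> resol_err d W n M \<le> \<epsilon>", OF P] by blast
        ultimately have "log 2 (real (min_size d W \<epsilon> n)) \<le> log 2 (2 powr (real n * (R + \<gamma>)))"
          by (intro log_mono) auto
        then show "ereal (log 2 (real (min_size d W \<epsilon> n)) / real n) \<le> ereal (R + \<gamma>)"
          using n by (simp add: field_simps)
      qed
      show "resol_rate_eps d W \<epsilon> \<le> ereal R + ereal \<gamma>"
      proof (rule ccontr)
        assume "\<not> ?thesis"
        then have "ereal (R + \<gamma>) < liminf (\<lambda>n. ereal (log 2 (real (min_size d W \<epsilon> n)) / real n))"
          by (simp add: resol_rate_eps_def not_le)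
        then have "\<forall>\<^sub>F n in sequentially. ereal (R + \<gamma>) < ereal (log 2 (real (min_size d W \<epsilon> n)) / real n)"
          by (rule less_LiminfD)
        then show False using fr by (auto simp: frequently_def not_le elim: eventually_mono)
      qed
    qed
  qed
  have le2: "resol_rate d W \<le> ereal C"
  proof (rule ereal_le_epsilon2)
    fix e :: real assume e: "0 < e"
    \<comment> \<open>Adding \<open>e\<close> makes the rate positive even if
      \<open>C = 0\<close>.\<close>
    have "C + e \<in> {R. R > 0 \<and> (\<forall>\<gamma>>0. liminf (\<lambda>n. ereal (resol_err d W n (nat \<lfloor>2 powr (real n * (R + \<gamma>))\<rfloor>))) = 0)}"
    proof (intro CollectI conjI allI impI)
      show "0 < C + e" using C0 e by simp
      fix \<gamma> :: real assume "0 < \<gamma>"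
      then have "(\<lambda>n. resol_err d W n (nat \<lfloor>2 powr (real n * (C + e + \<gamma>))\<rfloor>)) \<longlonglongrightarrow> 0"
        using e by (intro resol_err_tendsto_0[OF W]) (simp add: C_def)
      then have "(\<lambda>n. ereal (resol_err d W n (nat \<lfloor>2 powr (real n * (C + e + \<gamma>))\<rfloor>))) \<longlonglongrightarrow> ereal 0"
        by (rule tendsto_ereal)
      then show "liminf (\<lambda>n. ereal (resol_err d W n (nat \<lfloor>2 powr (real n * (C + e + \<gamma>))\<rfloor>))) = 0"
        by (simp add: lim_imp_Liminf zero_ereal_def)
    qed
    then have "resol_rate d W \<le> ereal (C + e)"
      unfolding resol_rate_def by (intro Inf_lower imageI)
    then show "resol_rate d W \<le> ereal C + ereal e" by simp
  qed
  have le3: "ereal C \<le> resol_rate_eps d W \<epsilon>"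
  proof (rule dense_le)
    fix y :: ereal assume y: "y < ereal C"
    show "y \<le> resol_rate_eps d W \<epsilon>"
    proof (cases y)
      case (real r)
      have "(\<lambda>n. resol_err d W n (nat \<lfloor>2 powr (real n * (C + 1))\<rfloor>)) \<longlonglongrightarrow> 0"
        by (rule resol_err_tendsto_0[OF W]) (simp add: C_def)
      then have "\<forall>\<^sub>F n in sequentially. resol_err d W n (nat \<lfloor>2 powr (real n * (C + 1))\<rfloor>) < \<epsilon>"
        using assms(2) by (rule order_tendstoD(2))
      \<comment> \<open>\<open>LEAST\<close> satisfies its predicate only if some size does; the
        limit at rate \<open>C + 1\<close> provides one.\<close>
      then have ms: "\<forall>\<^sub>F n in sequentially. 1 \<le> min_size d W \<epsilon> n \<and> resol_err d W n (min_size d W \<epsilon> n) \<le> \<epsilon>"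
      proof (rule eventually_mono)
        fix n assume n: "resol_err d W n (nat \<lfloor>2 powr (real n * (C + 1))\<rfloor>) < \<epsilon>"
        have "1 \<le> 2 powr (real n * (C + 1))"
          using C0 by (intro ge_one_powr_ge_zero mult_nonneg_nonneg) auto
        then have "nat \<lfloor>2 powr (real n * (C + 1))\<rfloor> \<ge> 1"
          using half_le_floor(2)[of "2 powr (real n * (C + 1))"] by linarith
        then have "nat \<lfloor>2 powr (real n * (C + 1))\<rfloor> \<ge> 1 \<and> resol_err d W n (nat \<lfloor>2 powr (real n * (C + 1))\<rfloor>) \<le> \<epsilon>"
          using n by simp
        then show "1 \<le> min_size d W \<epsilon> n \<and> resol_err d W n (min_size d W \<epsilon> n) \<le> \<epsilon>"
          unfolding min_size_def by (rule LeastI)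
      qed
      have "\<forall>\<^sub>F n in sequentially. r \<le> log 2 (real (min_size d W \<epsilon> n)) / real n"
      \<comment> \<open>The converse needs a positive exponent; for \<open>r <= 0\<close> the bound
        is trivial since \<open>min_size\<close> is at least 1.\<close>
      proof (cases "r \<le> 0")
        case True
        from ms show ?thesis
        proof (rule eventually_mono)
          fix n assume "1 \<le> min_size d W \<epsilon> n \<and> resol_err d W n (min_size d W \<epsilon> n) \<le> \<epsilon>"
          then have "0 \<le> log 2 (real (min_size d W \<epsilon> n)) / real n" by simp
          then show "r \<le> log 2 (real (min_size d W \<epsilon> n)) / real n" using True by linarith
        qed
      next
        case False
        have "r < cq_capacity d W" using y real by (simp add: C_def)
        moreover have "{p. distr_on (UNIV :: 'x set) p} \<noteq> {}"
          using distr_ty[of "[undefined :: 'x]"] by blast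
        ultimately obtain p where p: "distr_on UNIV p" "r < holevo_info d W p"
          unfolding cq_capacity_def using less_cSUP_iff[OF _ capacity_bdd[OF W]] by blast
        have "\<forall>\<^sub>F n in sequentially. \<forall>M\<ge>1. resol_err d W n M \<le> \<epsilon> \<longrightarrow> exp (real n * (ln 2 * r)) \<le> real M"
          by (rule converse_eventually[OF W p(1) assms(2,3)]) (use False p(2) in auto)
        then show ?thesis using ms eventually_gt_at_top[of 0]
        proof eventually_elim
          case (elim n)
          then have "exp (real n * (ln 2 * r)) \<le> real (min_size d W \<epsilon> n)" by blast
          then have "ln (exp (real n * (ln 2 * r))) \<le> ln (real (min_size d W \<epsilon> n))"
            using elim by (subst ln_le_cancel_iff) auto
          then show ?case using elim by (simp add: log_def field_simps)
        qed
      qed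
      then show ?thesis unfolding real resol_rate_eps_def
        by (intro Liminf_bounded) (auto elim: eventually_mono)
    qed (use y in auto)
  qed
  from le1 le2 le3 show ?thesis unfolding C_def[symmetric] by (meson order.antisym order.trans)
qed

end
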